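(* Let $f(\tau)=\prod_{n\mid N}\eta(n\tau)^{r_n}=\sum_n c_f(n)q^n$ be a weakly admissible eta-quotient of level $N$ and weight $k=\frac12\sum_n r_n$, and put $\mathbf r=(r_n)_{n\mid N}$, $x_N=\sum_{n\mid N}nr_n$, $\varpi=\prod_{n\mid N}(N/n)^{|r_n|}$. Then for every $l\in L_f$ there exists a unique $c_l\in\mathbb{C}$ such that $$l^{-\frac k2}\sum_{\substack{a\mid l,\ d=l/a\\(a,N)=1}}\Big(\frac a\varpi\Big)a^kc_f\Big(\frac{ln}{a^2}\Big)\sum_{\substack{0\le b<d\\(a,b,d)=1}}\Big(\frac{-Nb}{(a,d)}\Big)^{2k}e\Big(bd\Big(\frac nl-\frac{x_N}{24}\Big)\Big)\psi_{l,\mathbf r}(a,b)=c_l\cdot c_f(n)$$ for all $n\in\frac{x_N}{24}+\mathbb{Z}$ (with $c_f(\frac{ln}{a^2})=0$ if $\frac{ln}{a^2}\notin\frac{x_N}{24}+\mathbb{Z}$). Moreover, $c_l$ equals the left-hand side with $n=\frac{x_N}{24}$.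
   Context: $e(x)=\exp(2\pi ix)$, $q=e(\tau)$, $\eta(\tau)=q^{1/24}\prod(1-q^n)$, $r_n\in\mathbb{Z}$, level $N=\operatorname{lcm}\{n:r_n\ne0\}$. $\widetilde{\Gamma_0(N)}$: pairs $(\gamma,\varepsilon(c\tau+d)^{1/2})$, $\gamma=\begin{pmatrix}a&b\\c&d\end{pmatrix}\in\Gamma_0(N)$, $\varepsilon=\pm1$, principal square root, product $(\gamma_1,\phi_1)(\gamma_2,\phi_2)=(\gamma_1\gamma_2,\phi_1(\gamma_2\tau)\phi_2(\tau))$; $\widetilde\gamma=(\gamma,(c\tau+d)^{1/2})$; $(g|_k(\gamma,\phi))(\tau)=\phi(\tau)^{-2k}g(\gamma\tau)$. Character of $f$: $\chi(\gamma,\varepsilon(c\tau+d)^{1/2})=\varepsilon^{-2k}e(\frac1{24}\sum r_n\Psi\begin{pmatrix}a&bn\\c/n&d\end{pmatrix})$, $\Psi\begin{pmatrix}a&b\\c&d\end{pmatrix}=\frac{a+d}c+12s(-d,c)-3$ ($c>0$), $\frac{a+d}c+12s(d,-c)+3$ ($c<0$), $b$ ($c=0,a>0$), $-b-6$ ($c=0,a<0$); $s(h,c)=\sum_{r\bmod c}((r/c))((hr/c))$. $M_k$, $S_k$: holomorphic $g$ with $g|_k\gamma=\chi(\gamma)g$ on $\widetilde{\Gamma_0(N)}$, with all $g|_k\widetilde\gamma$ ($\gamma\in\mathrm{SL}_2(\mathbb{Z})$) having $q$-expansions $\sum_{n\in\frac1h\mathbb{Z}}c_nq^n$ with $c_n=0$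 for $n<0$ (resp. $n\le 0$). Weakly admissible: $f\in M_k(\Gamma_0(N),\chi)$ and either $\dim M_k(\Gamma_0(N),\chi)=1$, or $\dim M_k\ge2$, $\dim S_k(\Gamma_0(N),\chi)=1$ and $f$ is a cusp form. $m_f=24/\gcd(24,\sum(N/n)r_n,\sum nr_n)$; $L_f=\{l\ge1:l\equiv1\bmod m_f\}$ if $k\in\mathbb{Z}$, and additionally $l$ a perfect square if $k\in\frac12+\mathbb{Z}$. With $d=l/a$: $\psi_{l,\mathbf r}(a,b)=e(-\frac{k+\delta}4(d-1)+\frac{(k+\delta)(l-1)(N-1)}4)$ if $2\nmid l$; $e(-\frac{k+\delta}4(a-1)-\frac{N(k+\delta)(1+\delta_1)}4b)$ if $2\mid l,2\mid N$; $1$ if $2\mid l,2\nmid N$; $\delta=0$ (resp. $1$) if $\varpi=2^\alpha(4m+1)$ (resp. $2^\alpha(4m+3)$); $\delta_1=1$ if $2\mid l$, $4\mid N$, $k\in\frac12+\mathbb{Z}$, $v_2(\varpi)$ odd, else $0$. $(\frac mn)$: Kronecker–Jacobi symbol with $(\frac m0)=0$ for $m\ne\pm1$, $(\frac{\pm1}0)=1$. $c_f(n)$: coefficients of $f=\sum_{n\in\frac{x_N}{24}+\mathbb{Z}_{\ge0}}c_f(n)q^n$. *)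

theory Defs
  imports "HOL-Analysis.Analysis" "HOL-Number_Theory.Number_Theory"
begin

definition ee :: "real \<Rightarrow> complex" where
  "ee x = exp (2 * pi * \<i> * complex_of_real x)"

definition HH :: "complex set" where
  "HH = {z. Im z > 0}"

definition eta :: "complex \<Rightarrow> complex" where
  "eta \<tau> = exp (2 * pi * \<i> * \<tau> / 24) *
            (\<Prod>n. (1 - exp (2 * pi * \<i> * of_nat (Suc n) * \<tau>)))"

definition supp :: "(nat \<Rightarrow> int) \<Rightarrow> nat set" where
  "supp r = {n. r n \<noteq> 0}"

definition level :: "(nat \<Rightarrow> int) \<Rightarrow> nat" where
  "level r = Lcm (supp r)"

definition eta_quot :: "(nat \<Rightarrow> int) \<Rightarrow> complex \<Rightarrow> complex" where
  "eta_quot r \<tau> = (\<Prod>n\<in>supp r. eta (of_nat n * \<tau>) powi r n)"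

definition wt2 :: "(nat \<Rightarrow> int) \<Rightarrow> int" where
  "wt2 r = (\<Sum>n\<in>supp r. r n)"

definition wt :: "(nat \<Rightarrow> int) \<Rightarrow> real" where
  "wt r = real_of_int (wt2 r) / 2"

definition xN :: "(nat \<Rightarrow> int) \<Rightarrow> int" where
  "xN r = (\<Sum>n\<in>supp r. int n * r n)"

definition varpi :: "(nat \<Rightarrow> int) \<Rightarrow> int" where
  "varpi r = (\<Prod>n\<in>supp r. int (level r div n) ^ nat \<bar>r n\<bar>)"

text \<open>Coefficients c_f(x) of f = sum c_f(x) q^x (x in x_N/24 + Z), extracted as Fourier
  coefficients of the 1-periodic function f(tau) e(-x tau) on the line Im tau = 1;
  c_f(x) = 0 for x not in x_N/24 + Z.\<close>
definition cf :: "(nat \<Rightarrow> int) \<Rightarrow> real \<Rightarrow> complex" where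
  "cf r x = (if (\<exists>m::int. x = real_of_int (xN r) / 24 + real_of_int m)
     then integral {0..1} (\<lambda>t::real. eta_quot r (complex_of_real t + \<i>) *
            exp (- 2 * pi * \<i> * complex_of_real x * (complex_of_real t + \<i>)))
     else 0)"

definition saw :: "real \<Rightarrow> real" where
  "saw x = (if x \<in> \<int> then 0 else x - of_int \<lfloor>x\<rfloor> - 1/2)"

definition dsum :: "int \<Rightarrow> int \<Rightarrow> real" where
  "dsum h c = (\<Sum>x\<in>{0..<c}. saw (of_int x / of_int c) * saw (of_int (h * x) / of_int c))"

definition Psi :: "int \<Rightarrow> int \<Rightarrow> int \<Rightarrow> int \<Rightarrow> real" where
  "Psi a b c d =
    (if c > 0 then of_int (a + d) / of_int c + 12 * dsum (- d) c - 3
     else if c < 0 then of_int (a + d) / of_int c + 12 * dsum d (- c) + 3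
     else if a > 0 then of_int b
     else - of_int b - 6)"

text \<open>chi((a,b;c,d), eps (c tau + d)^(1/2))\<close>
definition chi :: "(nat \<Rightarrow> int) \<Rightarrow> int \<Rightarrow> int \<Rightarrow> int \<Rightarrow> int \<Rightarrow> complex \<Rightarrow> complex" where
  "chi r a b c d \<epsilon> = \<epsilon> powi (- wt2 r) *
      ee ((1/24) * (\<Sum>n\<in>supp r. of_int (r n) * Psi a (b * int n) (c div int n) d))"

text \<open>(g |_k (gamma, eps (c tau + d)^(1/2)))(tau), principal square root csqrt\<close>
definition slash :: "(nat \<Rightarrow> int) \<Rightarrow> (complex \<Rightarrow> complex) \<Rightarrow> int \<Rightarrow> int \<Rightarrow> int \<Rightarrow> int
                     \<Rightarrow> complex \<Rightarrow> complex \<Rightarrow> complex" where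
  "slash r g a b c d \<epsilon> \<tau> =
     (\<epsilon> * csqrt (of_int c * \<tau> + of_int d)) powi (- wt2 r) *
     g ((of_int a * \<tau> + of_int b) / (of_int c * \<tau> + of_int d))"

definition transforms :: "(nat \<Rightarrow> int) \<Rightarrow> (complex \<Rightarrow> complex) \<Rightarrow> bool" where
  "transforms r g \<longleftrightarrow>
     (\<forall>a b c d \<epsilon>. a * d - b * c = 1 \<and> int (level r) dvd c \<and> (\<epsilon> = 1 \<or> \<epsilon> = -1) \<longrightarrow>
        (\<forall>\<tau>\<in>HH. slash r g a b c d \<epsilon> \<tau> = chi r a b c d \<epsilon> * g \<tau>))"

definition cusp_expansions :: "bool \<Rightarrow> (nat \<Rightarrow> int) \<Rightarrow> (complex \<Rightarrow> complex) \<Rightarrow> bool" where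
  "cusp_expansions strict r g \<longleftrightarrow>
     (\<forall>a b c d. a * d - b * c = 1 \<longrightarrow>
        (\<exists>h::nat. h > 0 \<and> (\<exists>co::nat \<Rightarrow> complex. (strict \<longrightarrow> co 0 = 0) \<and>
           (\<forall>\<tau>\<in>HH. (\<lambda>m. co m * exp (2 * pi * \<i> * of_nat m * \<tau> / of_nat h))
                        sums slash r g a b c d 1 \<tau>))))"

definition MF :: "(nat \<Rightarrow> int) \<Rightarrow> (complex \<Rightarrow> complex) \<Rightarrow> bool" where
  "MF r g \<longleftrightarrow> g holomorphic_on HH \<and> transforms r g \<and> cusp_expansions False r g"

definition SF :: "(nat \<Rightarrow> int) \<Rightarrow> (complex \<Rightarrow> complex) \<Rightarrow> bool" where
  "SF r g \<longleftrightarrow> g holomorphic_on HH \<and> transforms r g \<and> cusp_expansions True r g"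

definition dim_eq_1 :: "((complex \<Rightarrow> complex) \<Rightarrow> bool) \<Rightarrow> bool" where
  "dim_eq_1 V \<longleftrightarrow> (\<exists>g. V g \<and> (\<exists>\<tau>\<in>HH. g \<tau> \<noteq> 0) \<and>
                        (\<forall>h. V h \<longrightarrow> (\<exists>c. \<forall>\<tau>\<in>HH. h \<tau> = c * g \<tau>)))"

definition dim_ge_2 :: "((complex \<Rightarrow> complex) \<Rightarrow> bool) \<Rightarrow> bool" where
  "dim_ge_2 V \<longleftrightarrow> (\<exists>g h. V g \<and> V h \<and>
      (\<forall>\<alpha> \<beta>. (\<forall>\<tau>\<in>HH. \<alpha> * g \<tau> + \<beta> * h \<tau> = 0) \<longrightarrow> \<alpha> = 0 \<and> \<beta> = 0))"

definition weakly_admissible :: "(nat \<Rightarrow> int) \<Rightarrow> bool" where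
  "weakly_admissible r \<longleftrightarrow> MF r (eta_quot r) \<and>
     (dim_eq_1 (MF r) \<or> (dim_ge_2 (MF r) \<and> dim_eq_1 (SF r) \<and> SF r (eta_quot r)))"

definition mf :: "(nat \<Rightarrow> int) \<Rightarrow> int" where
  "mf r = 24 div gcd 24 (gcd (\<Sum>n\<in>supp r. int (level r div n) * r n) (xN r))"

definition Lf :: "(nat \<Rightarrow> int) \<Rightarrow> nat set" where
  "Lf r = {l. l \<ge> 1 \<and> [int l = 1] (mod mf r) \<and> (odd (wt2 r) \<longrightarrow> (\<exists>s. l = s\<^sup>2))}"

definition kron2 :: "int \<Rightarrow> int" where
  "kron2 m = (if even m then 0 else if m mod 8 = 1 \<or> m mod 8 = 7 then 1 else -1)"

definition kron_prime :: "int \<Rightarrow> nat \<Rightarrow> int" where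
  "kron_prime m p = (if p = 2 then kron2 m else Legendre m (int p))"

definition kronecker :: "int \<Rightarrow> int \<Rightarrow> int" where
  "kronecker m n =
    (if n = 0 then (if m = 1 \<or> m = -1 then 1 else 0)
     else (if n < 0 \<and> m < 0 then -1 else 1) *
          (\<Prod>p\<in>prime_factors (nat \<bar>n\<bar>). kron_prime m p ^ multiplicity p (nat \<bar>n\<bar>)))"

definition delta :: "(nat \<Rightarrow> int) \<Rightarrow> real" where
  "delta r = (let w = varpi r div 2 ^ multiplicity 2 (varpi r) in
              if w mod 4 = 1 then 0 else 1)"

definition delta1 :: "(nat \<Rightarrow> int) \<Rightarrow> nat \<Rightarrow> real" where
  "delta1 r l = (if even l \<and> 4 dvd level r \<and> odd (wt2 r) \<and> odd (multiplicity 2 (varpi r))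
                 then 1 else 0)"

definition psi :: "(nat \<Rightarrow> int) \<Rightarrow> nat \<Rightarrow> nat \<Rightarrow> nat \<Rightarrow> complex" where
  "psi r l a b =
    (let d = l div a; kd = wt r + delta r; N = level r in
     if odd l then ee (- kd / 4 * (real d - 1) + kd * (real l - 1) * (real N - 1) / 4)
     else if even N then ee (- kd / 4 * (real a - 1) - real N * kd * (1 + delta1 r l) / 4 * real b)
     else 1)"

definition hecke_lhs :: "(nat \<Rightarrow> int) \<Rightarrow> nat \<Rightarrow> real \<Rightarrow> complex" where
  "hecke_lhs r l n =
     complex_of_real (real l powr (- wt r / 2)) *
     (\<Sum>a\<in>{a. a dvd l \<and> coprime a (level r)}.
        (let d = l div a in
         of_int (kronecker (int a) (varpi r)) * complex_of_real (real a powr wt r) *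
         cf r (real l * n / (real a)\<^sup>2) *
         (\<Sum>b\<in>{b. b < d \<and> gcd (gcd a b) d = 1}.
            of_int (kronecker (- int (level r) * int b) (int (gcd a d))) powi wt2 r *
            ee (real b * real d * (n / real l - real_of_int (xN r) / 24)) *
            psi r l a b)))"

end

theory Submission
  imports Defs "HOL-Complex_Analysis.Complex_Analysis" "HOL-Computational_Algebra.Nth_Powers"
begin

text \<open>Write \<open>f\<close> for the eta-quotient. The left-hand side of the identity is, up to the factor
  $l^{k/2}$, the $n$-th coefficient of $g(\tau) = \sum_{(a,b)} w(a,b)\, d^{-k} f((a\tau+b)/d)$, where
  $w(a,b)$ collects the Kronecker symbols and roots of unity. By weak admissibility $f$ spans either the
  space of modular forms or that of cusp forms for its character. If $g$ lies in that space it is a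
  multiple of $f$, whose leading coefficient is 1.

  Since $f$ has no zeros, the transformation law of $g$ says that the weight-0 functions
  $w(a,b)\, d^{-k} f((a\tau+b)/d) / f(\tau)$ are permuted by $\Gamma_0(N)$. The matrices $(a, b; 0, d)$ represent the
  left cosets in one double coset, hence only two facts are needed: the function belonging to
  $(1, 0; 0, l)$ is fixed by its stabilizer, and every other one arises from it by a single suitable element.
  Both are identities for the character, which Dedekind reciprocity and
  quadratic reciprocity turn into Petersson's formula; the element in the second fact is chosen
  such that most of its factors are trivial.\<close>

section \<open>The Kronecker symbol\<close>

text \<open>The obstacle is half-integral weight: the principal square root satisfies the cocycle
  law only up to sign, so composing transformation laws directly would mean tracking signs. Division
  by f removes the automorphy factor; what remains are functions on the half-plane on which plain
  integer matrices act, and the root has to be split as a product only when one factor is a positive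
  real number. The congruence for l enters as the statement that 24 divides (l-1) x_N and (l-1) y_N,
  where y_N is the sum of (N/n) r_n. If 2 or 3 divides l, then l-1 is invertible at that prime and
  the divisibility passes to x_N and y_N, so these primes need not be excluded from l. For odd 2k
  the perfect square l = a d makes a/gcd(a,d) a square, which lets the Kronecker symbol over
  gcd(a,d) in the sum stand for the symbol over a that the character produces.\<close>

lemma kronecker_prod_mset:
  assumes "n > 0"
  shows "kronecker m (int n) = prod_mset (image_mset (kron_prime m) (prime_factorization n))"
proof -
  have "prod_mset (image_mset (kron_prime m) (prime_factorization n))
      = (\<Prod>p\<in>prime_factors n. kron_prime m p ^ count (prime_factorization n) p)"
    by (rule image_prod_mset_multiplicity)
  also have "\<dots> = (\<Prod>p\<in>prime_factors n. kron_prime m p ^ multiplicity p n)"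
    by (intro prod.cong) (auto simp: count_prime_factorization)
  finally show ?thesis using assms by (simp add: kronecker_def)
qed

lemma kronecker_1_right [simp]: "kronecker m 1 = 1"
  using kronecker_prod_mset[of 1 m] by simp

lemma kronecker_prime:
  assumes "prime p"
  shows "kronecker m (int p) = kron_prime m p"
  using kronecker_prod_mset[of p m] assms
  by (simp add: prime_gt_0_nat prime_factorization_prime)

lemma kronecker_mult_right:
  assumes "n1 > 0" "n2 > 0"
  shows "kronecker m (n1 * n2) = kronecker m n1 * kronecker m n2"
proof -
  obtain k1 k2 where k: "n1 = int k1" "n2 = int k2" "k1 > 0" "k2 > 0"
    using assms by (metis zero_less_imp_eq_int)
  have "kronecker m (n1 * n2) = kronecker m (int (k1 * k2))" by (simp add: k)
  also have "\<dots> = kronecker m (int k1) * kronecker m (int k2)"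
    using k by (subst (1 2 3) kronecker_prod_mset) (auto simp: prime_factorization_mult)
  finally show ?thesis by (simp add: k)
qed

text \<open>The Kronecker symbol is multiplicative in its lower entry, so a positive entry is
  rebuilt from 1 one prime at a time and statements about it reduce to primes.\<close>

lemma kronecker_induct [consumes 1, case_names one step]:
  assumes "n > (0::int)"
  assumes "P 1"
  assumes "\<And>p m. prime p \<Longrightarrow> m > 0 \<Longrightarrow> int p dvd n \<Longrightarrow> m dvd n \<Longrightarrow> P m \<Longrightarrow> P (int p * m)"
  shows "P n"
proof -
  have "m dvd nat n \<Longrightarrow> m > 0 \<Longrightarrow> P (int m)" for m
  proof (induction m rule: prime_divisors_induct)
    case (factor p x)
    have "x > 0" using factor.prems by (cases x) auto
    moreover have "x dvd nat n" using factor.prems(1) by (metis dvd_mult_right)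
    moreover have "int p dvd n" "int x dvd n" using factor.prems(1) assms(1)
      by (metis dvd_mult_left dvd_mult_right int_dvd_int_iff nat_0_le less_imp_le)+
    ultimately show ?case using assms(3)[of p "int x"] factor by simp
  qed (use assms in \<open>auto simp: dvd_1_iff_1\<close>)
  from this[of "nat n"] show ?thesis using assms(1) by simp
qed

lemma odd_mod_4: "odd (a::int) \<Longrightarrow> a mod 4 = 1 \<or> a mod 4 = 3"
  by presburger

lemma odd_mod_8: "odd (a::int) \<Longrightarrow> a mod 8 = 1 \<or> a mod 8 = 3 \<or> a mod 8 = 5 \<or> a mod 8 = 7"
  by presburger

lemma kron2_mult: "kron2 (a * b) = kron2 a * kron2 b"
proof -
  have ab: "a * b mod 8 = x * y mod 8" if "a mod 8 = x" "b mod 8 = y" for x y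
    using that by (metis mod_mult_eq)
  show ?thesis
  proof (cases "odd a \<and> odd b")
    case True
    then have "a mod 8 = 1 \<or> a mod 8 = 3 \<or> a mod 8 = 5 \<or> a mod 8 = 7"
      "b mod 8 = 1 \<or> b mod 8 = 3 \<or> b mod 8 = 5 \<or> b mod 8 = 7"
      using odd_mod_8 by blast+
    then show ?thesis using True by - (elim disjE; frule (1) ab; simp add: kron2_def)
  qed (auto simp: kron2_def)
qed

lemma Legendre_values: "Legendre a p \<in> {-1, 0, 1}"
  by (auto simp: Legendre_def)

lemma Legendre_cong:
  assumes "[a = b] (mod p)"
  shows "Legendre a p = Legendre b p"
proof -
  have "[a = 0] (mod p) \<longleftrightarrow> [b = 0] (mod p)" using assms cong_sym cong_trans by blast
  moreover have "QuadRes p a \<longleftrightarrow> QuadRes p b"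
    unfolding QuadRes_def using assms cong_sym cong_trans by blast
  ultimately show ?thesis by (simp add: Legendre_def)
qed

text \<open>Euler's criterion fixes a symbol only modulo p. The values -1, 0, 1 are distinct modulo
  p > 2, which turns such congruences into equalities.\<close>

lemma cong_small_signs:
  assumes "[a = b] (mod p)" "a \<in> {-1,0,1}" "b \<in> {-1,0,1}" "(p::int) > 2"
  shows "a = b"
proof -
  have "p dvd a - b" using assms(1) by (simp add: cong_iff_dvd_diff)
  moreover have "\<bar>a - b\<bar> \<le> 2" using assms by auto
  ultimately show ?thesis using assms(4) dvd_imp_le_int[of "a - b" p] by linarith
qed

lemma Legendre_mult:
  assumes "prime p" "p > 2"
  shows "Legendre (a * b) (int p) = Legendre a (int p) * Legendre b (int p)"
proof (rule cong_small_signs)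
  let ?e = "(p - 1) div 2"
  have "[Legendre (a * b) (int p) = (a * b) ^ ?e] (mod int p)"
    using euler_criterion[OF assms] .
  also have "(a * b) ^ ?e = a ^ ?e * b ^ ?e" by (simp add: power_mult_distrib)
  also have "[a ^ ?e * b ^ ?e = Legendre a (int p) * Legendre b (int p)] (mod int p)"
    by (intro cong_mult cong_sym[OF euler_criterion[OF assms]])
  finally show "[Legendre (a * b) (int p) = Legendre a (int p) * Legendre b (int p)] (mod int p)" .
  show "Legendre (a * b) (int p) \<in> {-1, 0, 1}" by (rule Legendre_values)
  show "Legendre a (int p) * Legendre b (int p) \<in> {-1, 0, 1}"
    using Legendre_values[of a "int p"] Legendre_values[of b "int p"] by auto
  show "2 < int p" using assms by simp
qed

lemma prime_neq_2_gt: "prime (p::nat) \<Longrightarrow> p \<noteq> 2 \<Longrightarrow> p > 2"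
  using prime_ge_2_nat[of p] by linarith

lemma kron_prime_mult: "prime p \<Longrightarrow> kron_prime (a * b) p = kron_prime a p * kron_prime b p"
  by (auto simp: kron_prime_def kron2_mult Legendre_mult prime_neq_2_gt)

lemma kronecker_mult_left:
  assumes "n > 0"
  shows "kronecker (a * b) n = kronecker a n * kronecker b n"
  using assms
proof (induction n rule: kronecker_induct)
  case (step p m)
  then show ?case
    by (simp add: kronecker_mult_right prime_gt_0_nat kronecker_prime kron_prime_mult)
qed simp

lemma kronecker_1_left: "n > 0 \<Longrightarrow> kronecker 1 n = 1"
proof (induction n rule: kronecker_induct)
  case (step p m)
  have "QuadRes (int p) 1" unfolding QuadRes_def by (rule exI[of _ 1]) simp
  then have "kron_prime 1 p = 1"
    using step prime_neq_2_gt[of p]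
    by (auto simp: kron_prime_def kron2_def Legendre_def cong_def)
  then show ?case using step
    by (simp add: kronecker_mult_right prime_gt_0_nat kronecker_prime)
qed simp

lemma kronecker_power_left: "n > 0 \<Longrightarrow> kronecker (a ^ j) n = kronecker a n ^ j"
  by (induction j) (auto simp: kronecker_1_left kronecker_mult_left)

lemma kronecker_prod_left:
  "n > 0 \<Longrightarrow> kronecker (prod f A) n = (\<Prod>i\<in>A. kronecker (f i) n)"
  by (induction A rule: infinite_finite_induct) (auto simp: kronecker_1_left kronecker_mult_left)

lemma kronecker_power_right: "n > 0 \<Longrightarrow> kronecker m (n ^ j) = kronecker m n ^ j"
  by (induction j) (auto simp: kronecker_mult_right)

lemma kronecker_prod_right:
  "(\<And>i. i \<in> A \<Longrightarrow> g i > 0) \<Longrightarrow> kronecker m (prod g A) = (\<Prod>i\<in>A. kronecker m (g i))"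
  by (induction A rule: infinite_finite_induct) (auto simp: kronecker_mult_right prod_pos)

text \<open>The symbol over an odd prime is periodic in that prime, whereas over 2 it depends on the
  residue modulo 8; hence the restriction to odd \<open>n\<close>.\<close>

lemma kronecker_cong:
  assumes "n > 0" "odd n" "[a = b] (mod n)"
  shows "kronecker a n = kronecker b n"
  using assms
proof (induction n rule: kronecker_induct)
  case (step p m)
  have "[a = b] (mod int p)" "[a = b] (mod m)"
    using step by (auto intro: cong_modulus_mult cong_dvd_modulus)
  moreover have "p \<noteq> 2" using step by auto
  ultimately show ?case using step
    by (simp add: kronecker_mult_right prime_gt_0_nat kronecker_prime kron_prime_def
         Legendre_cong[of a b])
qed simp

lemma kron_prime_sign:
  assumes "prime p" "\<not> int p dvd a"
  shows "kron_prime a p \<in> {-1, 1}"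
  using assms by (auto simp: kron_prime_def kron2_def Legendre_def cong_0_iff)

lemma kronecker_sign:
  assumes "n > 0" "coprime a n"
  shows "kronecker a n \<in> {-1, 1}"
  using assms
proof (induction n rule: kronecker_induct)
  case (step p m)
  then have "coprime a (int p)" "coprime a m" by auto
  then have "\<not> int p dvd a" using step(1)
    by (metis coprime_absorb_right coprime_commute not_prime_unit of_nat_1 prime_nat_int_transfer)
  with kron_prime_sign[OF step(1), of a] step \<open>coprime a m\<close> show ?case
    by (auto simp: kronecker_mult_right prime_gt_0_nat kronecker_prime)
qed simp

section \<open>Quadratic reciprocity and its supplements\<close>

definition qr_sign :: "int \<Rightarrow> int \<Rightarrow> int" where
  "qr_sign m n = (if m mod 4 = 3 \<and> n mod 4 = 3 then -1 else 1)"

lemma qr_sign_mult_left: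
  assumes "odd a" "odd b"
  shows "qr_sign (a * b) n = qr_sign a n * qr_sign b n"
proof -
  have ab: "a * b mod 4 = x * y mod 4" if "a mod 4 = x" "b mod 4 = y" for x y
    using that by (metis mod_mult_eq)
  show ?thesis using odd_mod_4[OF assms(1)] odd_mod_4[OF assms(2)]
    by - (elim disjE; frule (1) ab; simp add: qr_sign_def)
qed

lemma qr_sign_commute: "qr_sign a b = qr_sign b a"
  by (auto simp: qr_sign_def)

text \<open>The product form of reciprocity is solved for one symbol by multiplying with the other,
  whose square is 1; for p = q both symbols vanish.\<close>

lemma Legendre_reciprocity:
  assumes "prime p" "p > 2" "prime q" "q > 2"
  shows "Legendre (int p) (int q) = qr_sign (int p) (int q) * Legendre (int q) (int p)"
proof (cases "p = q")
  case True
  then show ?thesis by (simp add: Legendre_def cong_def)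
next
  case False
  have sq: "Legendre (int q) (int p) ^ 2 = 1"
  proof -
    have "\<not> p dvd q" using False assms by (metis prime_nat_iff primes_dvd_imp_eq)
    then have "Legendre (int q) (int p) \<in> {-1,1}" by (auto simp: Legendre_def cong_0_iff)
    then show ?thesis by auto
  qed
  have par: "((-1)::int) ^ ((p - 1) div 2 * ((q - 1) div 2)) = qr_sign (int p) (int q)"
  proof -
    have o: "odd p" "odd q" using assms prime_odd_nat by auto
    have "odd ((p - 1) div 2) \<longleftrightarrow> p mod 4 = 3" "odd ((q - 1) div 2) \<longleftrightarrow> q mod 4 = 3"
      using o by presburger+
    moreover have "int p mod 4 = 3 \<longleftrightarrow> p mod 4 = 3" "int q mod 4 = 3 \<longleftrightarrow> q mod 4 = 3"
      by presburger+
    ultimately have "odd ((p - 1) div 2 * ((q - 1) div 2)) \<longleftrightarrow> int p mod 4 = 3 \<and> int q mod 4 = 3"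
      by (simp only: even_mult_iff de_Morgan_disj)
    then show ?thesis unfolding qr_sign_def by (metis minus_one_power_iff)
  qed
  have "Legendre p q * Legendre q p = qr_sign (int p) (int q)"
    using Quadratic_Reciprocity[OF assms False] par by simp
  then have "Legendre p q * (Legendre q p) ^ 2 = qr_sign (int p) (int q) * Legendre q p"
    by (simp add: power2_eq_square)
  then show ?thesis using sq by simp
qed

text \<open>Both sides are multiplicative in each odd entry. Prime factors are split off from
  \<open>n\<close> against a fixed prime above, and then from \<open>m\<close> against all of
  \<open>n\<close>.\<close>

theorem kronecker_reciprocity:
  assumes "m > 0" "odd m" "n > 0" "odd n"
  shows "kronecker m n = qr_sign m n * kronecker n m"
proof -
  have prime_case: "kronecker (int p) n = qr_sign (int p) n * kronecker n (int p)"
    if p: "prime p" "p > 2" and n: "n > 0" "odd n" for p n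
    using n
  proof (induction n rule: kronecker_induct)
    case one
    then show ?case using p by (simp add: kronecker_1_left prime_gt_0_nat qr_sign_def)
  next
    case (step q m)
    have q: "q > 2" using step(1,6) by (intro prime_neq_2_gt) auto
    have o: "odd (int q)" "odd m" using step by auto
    have "Legendre (int p) (int q) = qr_sign (int p) (int q) * Legendre (int q) (int p)"
      using Legendre_reciprocity p step q by blast
    then have "kronecker (int p) (int q) = qr_sign (int q) (int p) * kronecker (int q) (int p)"
      using p q step(1) by (simp add: kronecker_prime kron_prime_def qr_sign_commute)
    moreover have "kronecker (int p) m = qr_sign m (int p) * kronecker m (int p)"
      using step(5) o by (simp add: qr_sign_commute)
    moreover have "kronecker (int p) (int q * m) = kronecker (int p) (int q) * kronecker (int p) m"
      using q step by (intro kronecker_mult_right) auto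
    moreover have "kronecker (int q * m) (int p) = kronecker (int q) (int p) * kronecker m (int p)"
      using p by (intro kronecker_mult_left) auto
    moreover have "qr_sign (int p) (int q * m) = qr_sign (int q) (int p) * qr_sign m (int p)"
      using o by (subst qr_sign_commute) (rule qr_sign_mult_left)
    ultimately show ?case by (metis mult.assoc mult.left_commute)
  qed
  show ?thesis using assms(1,2)
  proof (induction m rule: kronecker_induct)
    case one
    then show ?case using assms by (simp add: kronecker_1_left qr_sign_def)
  next
    case (step p m)
    have p: "p > 2" using step by (intro prime_neq_2_gt) auto
    have o: "odd (int p)" "odd m" using step by auto
    have "kronecker (int p * m) n = kronecker (int p) n * kronecker m n"
      using assms by (intro kronecker_mult_left)
    also have "\<dots> = qr_sign (int p) n * qr_sign m n * (kronecker n (int p) * kronecker n m)"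
      using prime_case[OF step(1) p assms(3,4)] step(5) o by (metis mult.assoc mult.left_commute)
    also have "\<dots> = qr_sign (int p * m) n * kronecker n (int p * m)"
      using o p step(2) by (simp only: qr_sign_mult_left[OF o] kronecker_mult_right of_nat_0_less_iff)
    finally show ?case .
  qed
qed

lemma Legendre_minus_one:
  assumes "prime p" "p > 2"
  shows "Legendre (-1) (int p) = (if int p mod 4 = 1 then 1 else -1)"
proof (rule cong_small_signs)
  have o: "odd p" using assms prime_odd_nat by auto
  have "(if int p mod 4 = 1 then 1 else -1) = ((-1)::int) ^ ((p - 1) div 2)"
  proof -
    have "even ((p - 1) div 2) \<longleftrightarrow> p mod 4 = 1" using o by presburger
    moreover have "int p mod 4 = 1 \<longleftrightarrow> p mod 4 = 1" by presburger
    ultimately show ?thesis by (metis minus_one_power_iff)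
  qed
  then show "[Legendre (-1) (int p) = (if int p mod 4 = 1 then 1 else -1)] (mod int p)"
    using euler_criterion[OF assms, of "-1"] by simp
qed (use assms Legendre_values[of "-1" "int p"] in auto)

lemma kronecker_minus_one:
  assumes "n > 0" "odd n"
  shows "kronecker (-1) n = (if n mod 4 = 1 then 1 else -1)"
  using assms
proof (induction n rule: kronecker_induct)
  case (step p m)
  have p: "p > 2" using step by (intro prime_neq_2_gt) auto
  have o: "odd (int p)" "odd m" using step by auto
  have ab: "int p * m mod 4 = x * y mod 4" if "int p mod 4 = x" "m mod 4 = y" for x y
    using that by (metis mod_mult_eq)
  have "kronecker (-1) (int p * m)
      = (if int p mod 4 = 1 then 1 else -1) * (if m mod 4 = 1 then 1 else -1)"
    using step p o by (simp add: kronecker_mult_right kronecker_prime kron_prime_def Legendre_minus_one)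
  also have "\<dots> = (if int p * m mod 4 = 1 then 1 else -1)"
    using odd_mod_4[OF o(1)] odd_mod_4[OF o(2)] by - (elim disjE; frule (1) ab; simp)
  finally show ?case .
qed simp

text \<open>Since $2 \equiv -(n-2)$ modulo $n$, odd reciprocity relates $(2/n)$ to $(2/(n-2))$.\<close>
lemma kronecker_two:
  assumes "n > 0" "odd n"
  shows "kronecker 2 n = kron2 n"
proof -
  have "kronecker 2 (2 * int j + 1) = kron2 (2 * int j + 1)" for j
  proof (induction j)
    case 0
    then show ?case by (simp add: kron2_def)
  next
    case (Suc j)
    define n where "n = 2 * int j + 3"
    have n: "n > 0" "odd n" "n - 2 > 0" "odd (n - 2)" by (auto simp: n_def)
    have "kronecker 2 n = kronecker ((-1) * (n - 2)) n"
      by (rule kronecker_cong) (use n in \<open>auto simp: cong_iff_dvd_diff\<close>)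
    also have "\<dots> = kronecker (-1) n * kronecker (n - 2) n"
      using n by (intro kronecker_mult_left) auto
    also have "kronecker (n - 2) n = qr_sign (n - 2) n * kronecker n (n - 2)"
      using n by (intro kronecker_reciprocity) auto
    also have "kronecker n (n - 2) = kronecker 2 (n - 2)"
      by (rule kronecker_cong) (use n in \<open>auto simp: cong_iff_dvd_diff\<close>)
    also have "kronecker 2 (n - 2) = kron2 (n - 2)"
      using Suc by (simp add: n_def add.commute)
    \<comment> \<open>Two consecutive odd numbers are never both 3 modulo 4.\<close>
    also have "qr_sign (n - 2) n = 1" unfolding qr_sign_def using n by presburger
    also have "kronecker (-1) n = (if n mod 4 = 1 then 1 else -1)"
      using n by (intro kronecker_minus_one) auto
    also have "(if n mod 4 = 1 then 1 else -1) * (1 * kron2 (n - 2)) = kron2 n"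
    proof -
      have "(n - 2) mod 8 = 1 \<longleftrightarrow> n mod 8 = 3" "(n - 2) mod 8 = 7 \<longleftrightarrow> n mod 8 = 1"
        by presburger+
      then have "kron2 (n - 2) = (if n mod 8 = 1 \<or> n mod 8 = 3 then 1 else -1)"
        using n(4) by (simp only: kron2_def if_False disj_commute)
      moreover have "kron2 n = (if n mod 8 = 1 \<or> n mod 8 = 7 then 1 else -1)"
        using n(2) by (simp only: kron2_def if_False)
      moreover have "n mod 4 = 1 \<longleftrightarrow> n mod 8 = 1 \<or> n mod 8 = 5" by presburger
      ultimately show ?thesis using odd_mod_8[OF n(2)] by - (elim disjE; simp)
    qed
    finally show ?case by (simp add: n_def algebra_simps)
  qed
  from this[of "nat ((n - 1) div 2)"] show ?thesis using assms by simp
qed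

section \<open>Dedekind sums\<close>

lemma coprime_of_det:
  assumes "a * d - b * c = (1::int)"
  shows "coprime d c"
proof (rule coprimeI)
  fix e assume e: "e dvd d" "e dvd c"
  have "e dvd a * d - b * c" by (rule dvd_diff[OF dvd_mult[OF e(1)] dvd_mult[OF e(2)]])
  then show "is_unit e" using assms by simp
qed

lemma bij_betw_mult_mod:
  assumes "(k::int) > 0" "coprime h k"
  shows "bij_betw (\<lambda>x. h * x mod k) {0..<k} {0..<k}"
proof -
  have inj: "inj_on (\<lambda>x. h * x mod k) {0..<k}"
  proof (rule inj_onI)
    fix x y assume xy: "x \<in> {0..<k}" "y \<in> {0..<k}" "h * x mod k = h * y mod k"
    then have "[h * x = h * y] (mod k)" by (simp add: cong_def)
    then have "[x = y] (mod k)" using assms(2) by (simp add: cong_mult_lcancel)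
    then show "x = y" using xy by (simp add: cong_def)
  qed
  moreover have "(\<lambda>x. h * x mod k) ` {0..<k} \<subseteq> {0..<k}" using assms(1) by auto
  ultimately show ?thesis
    by (simp add: bij_betw_def endo_inj_surj)
qed

lemma sum_mult_mod:
  assumes "(k::int) > 0" "coprime h k"
  shows "(\<Sum>x\<in>{0..<k}. g (h * x mod k)) = (\<Sum>x\<in>{0..<k}. g x)"
  using sum.reindex_bij_betw[OF bij_betw_mult_mod[OF assms], of g] .

lemma int_interval_conv_nat: "k \<ge> 0 \<Longrightarrow> {0..<k} = int ` {..<nat k}"
  by (force simp: image_iff Bex_def intro: exI[of _ "nat _"])

lemma int_le_div_iff: "k > 0 \<Longrightarrow> q \<le> x div k \<longleftrightarrow> q * k \<le> (x::int)"
proof -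
  assume k: "k > 0"
  have x: "x = (x div k) * k + x mod k" "0 \<le> x mod k" "x mod k < k" using k by auto
  show ?thesis
  proof
    assume "q \<le> x div k"
    then have "q * k \<le> (x div k) * k" using k by simp
    then show "q * k \<le> x" using x by linarith
  next
    assume q: "q * k \<le> x"
    show "q \<le> x div k"
    proof (rule ccontr)
      assume "\<not> q \<le> x div k"
      then have "(x div k + 1) * k \<le> q * k" using k by (intro mult_right_mono) auto
      then show False using x q by (simp add: distrib_right)
    qed
  qed
qed

lemma int_div_less_iff: "k > 0 \<Longrightarrow> x div k < q \<longleftrightarrow> (x::int) < q * k"
  using int_le_div_iff[of k q x] by linarith

lemma dvd_small_int: "0 \<le> x \<Longrightarrow> x < k \<Longrightarrow> k dvd x \<longleftrightarrow> x = (0::int)"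
  by (auto dest: zdvd_imp_le simp: le_less)

lemma odd_int_4_cases: "odd (h::int) \<Longrightarrow> \<exists>i. h = 4 * i + 1 \<or> h = 4 * i + 3"
  by presburger

lemma odd_square_mod_8: "odd (h::int) \<Longrightarrow> [h\<^sup>2 = 1] (mod 8)"
proof -
  assume "odd h"
  have sq: "h\<^sup>2 mod 8 = x\<^sup>2 mod 8" if "h mod 8 = x" for x
    using that by (metis power_mod)
  show ?thesis unfolding cong_def using odd_mod_8[OF \<open>odd h\<close>]
    by - (elim disjE; drule sq; simp)
qed

lemma not_dvd_3_square: "\<not> 3 dvd (h::int) \<Longrightarrow> [h\<^sup>2 = 1] (mod 3)"
proof -
  assume "\<not> 3 dvd h"
  then have "h mod 3 = 1 \<or> h mod 3 = 2" by presburger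
  moreover have sq: "h\<^sup>2 mod 3 = x\<^sup>2 mod 3" if "h mod 3 = x" for x
    using that by (metis power_mod)
  ultimately show ?thesis unfolding cong_def
    by - (elim disjE; drule sq; simp)
qed

section \<open>Floor sums and the reciprocity law\<close>

lemma sum_int_interval:
  assumes "k \<ge> (0::int)"
  shows "2 * (\<Sum>x\<in>{0..<k}. x) = k * (k - 1)"
proof -
  have "2 * (\<Sum>x<n. int x) = int n * (int n - 1)" for n
    by (induction n) (auto simp: algebra_simps)
  from this[of "nat k"] show ?thesis using assms
    by (simp add: int_interval_conv_nat sum.reindex)
qed

lemma sum_squares_int_interval:
  assumes "k \<ge> (0::int)"
  shows "6 * (\<Sum>x\<in>{0..<k}. x\<^sup>2) = (k - 1) * k * (2 * k - 1)"
proof -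
  have "6 * (\<Sum>x<n. (int x)\<^sup>2) = (int n - 1) * int n * (2 * int n - 1)" for n
    by (induction n) (auto simp: algebra_simps power2_eq_square)
  from this[of "nat k"] show ?thesis using assms
    by (simp add: int_interval_conv_nat sum.reindex)
qed

text \<open>The residues of \<open>h * x\<close> modulo \<open>k\<close> are a permutation of the
  \<open>x\<close>, so their sum is known; comparing it with the sum of the \<open>h * x\<close>
  isolates the quotients.\<close>

lemma sum_mult_div:
  assumes "(k::int) > 0" "coprime h k"
  shows "2 * (\<Sum>x\<in>{0..<k}. h * x div k) = (h - 1) * (k - 1)"
proof -
  let ?q = "\<Sum>x\<in>{0..<k}. h * x div k" and ?s = "\<Sum>x\<in>{0..<k}. x"
  have "?s = (\<Sum>x\<in>{0..<k}. h * x mod k)"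
    using sum_mult_mod[OF assms, of "\<lambda>x. x"] by simp
  also have "\<dots> = (\<Sum>x\<in>{0..<k}. h * x - k * (h * x div k))"
    by (intro sum.cong refl) (simp add: minus_mult_div_eq_mod)
  also have "\<dots> = h * ?s - k * ?q" by (simp add: sum_subtractf sum_distrib_left)
  finally have "2 * k * ?q = (h - 1) * (2 * ?s)" by (simp add: algebra_simps)
  also have "2 * ?s = k * (k - 1)" using assms by (intro sum_int_interval) simp
  finally have "k * (2 * ?q) = k * ((h - 1) * (k - 1))" by (simp add: algebra_simps)
  then show ?thesis using assms(1) by simp
qed

text \<open>This is 12 k s(h,k) for coprime h and k > 0, with the sawtooth product expanded into
  floor sums. It is visibly an integer, so congruences modulo 3 and 8 can be stated for it.\<close>

definition ded :: "int \<Rightarrow> int \<Rightarrow> int" where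
  "ded h k = 2 * h * (k - 1) * (2 * k - 1) - 12 * (\<Sum>x\<in>{0..<k}. x * (h * x div k)) - 3 * k * (k - 1)"

lemma saw_of_int_divide:
  assumes "k > 0"
  shows "saw (of_int x / of_int k)
     = (if k dvd x then 0 else of_int (x mod k) / of_int k - 1/2)"
proof -
  have 1: "(of_int x / of_int k :: real) \<in> \<int> \<longleftrightarrow> k dvd x"
    using assms by (metis less_irrefl of_int_div_of_int_in_Ints_iff)
  have "(of_int x :: real) = of_int k * of_int (x div k) + of_int (x mod k)"
    by (metis mult_div_mod_eq of_int_add of_int_mult)
  then have "of_int x / of_int k - of_int (x div k) = (of_int (x mod k) / of_int k :: real)"
    using assms by (simp add: field_simps)
  then show ?thesis unfolding saw_def 1 by (auto simp: floor_divide_of_int_eq)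
qed

lemma dsum_eq_ded:
  assumes "k > 0" "coprime h k"
  shows "12 * of_int k * dsum h k = of_int (ded h k)"
proof -
  let ?I = "{0..<k}"
  define m where "m x = h * x mod k" for x
  have dvd: "k dvd h * x \<longleftrightarrow> x = 0" if "x \<in> ?I" for x
    using that assms dvd_small_int[of x k] by (simp add: coprime_dvd_mult_right_iff coprime_commute)
  \<comment> \<open>Off x = 0 both sawtooth values are affine in the residues. At 0 they vanish,
    while the affine formula gives 3 k; the subtracted term repairs this.\<close>
  have "12 * of_int k * (saw (of_int x / of_int k) * saw (of_int (h * x) / of_int k))
     = of_int ((2 * x - k) * (2 * m x - k) * 3) / of_int k - (if x = 0 then 3 * of_int k else 0)"
    if x: "x \<in> ?I" for x
  proof -
    have "k dvd x \<longleftrightarrow> x = 0" using x dvd_small_int[of x k] by simp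
    then show ?thesis using x assms(1)
      unfolding saw_of_int_divide[OF assms(1)] dvd[OF x] m_def
      by (auto simp: field_simps)
  qed
  then have "12 * of_int k * dsum h k = (\<Sum>x\<in>?I. of_int ((2 * x - k) * (2 * m x - k) * 3) / of_int k - (if x = 0 then 3 * of_int k else 0))"
    unfolding dsum_def sum_distrib_left by (intro sum.cong) auto
  also have "\<dots> = of_int (\<Sum>x\<in>?I. (2 * x - k) * (2 * m x - k) * 3) / of_int k - 3 * of_int k"
    using assms(1) by (simp add: sum_subtractf sum_divide_distrib)
  also have "(\<Sum>x\<in>?I. (2 * x - k) * (2 * m x - k) * 3) = k * (ded h k + 3 * k)"
  proof -
    let ?s = "\<Sum>x\<in>?I. x" and ?sq = "\<Sum>x\<in>?I. x\<^sup>2" and ?S = "\<Sum>x\<in>?I. x * (h * x div k)"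
    have "(\<Sum>x\<in>?I. (2 * x - k) * (2 * m x - k) * 3)
        = (\<Sum>x\<in>?I. 12 * (x * m x) - 6 * k * x - 6 * k * m x + 3 * k * k)"
      by (intro sum.cong refl) (simp add: algebra_simps)
    also have "\<dots> = 12 * (\<Sum>x\<in>?I. x * m x) - 6 * k * ?s - 6 * k * (\<Sum>x\<in>?I. m x) + k * (3 * k * k)"
      using assms(1) by (simp add: sum_subtractf sum.distrib flip: sum_distrib_left)
    also have "(\<Sum>x\<in>?I. m x) = ?s"
      using sum_mult_mod[OF assms, of "\<lambda>x. x"] by (simp add: m_def)
    also have "(\<Sum>x\<in>?I. x * m x) = (\<Sum>x\<in>?I. h * x\<^sup>2 - k * (x * (h * x div k)))"
      by (intro sum.cong refl)
         (simp add: m_def minus_mult_div_eq_mod [symmetric] algebra_simps power2_eq_square)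
    also have "\<dots> = h * ?sq - k * ?S" by (simp add: sum_subtractf sum_distrib_left)
    finally have "(\<Sum>x\<in>?I. (2 * x - k) * (2 * m x - k) * 3)
      = 2 * h * (6 * ?sq) - 12 * k * ?S - 6 * k * (2 * ?s) + 3 * k * k * k"
      by (simp add: algebra_simps)
    also have "6 * ?sq = (k - 1) * k * (2 * k - 1)"
      using assms by (intro sum_squares_int_interval) simp
    also have "2 * ?s = k * (k - 1)" using assms by (intro sum_int_interval) simp
    finally show ?thesis unfolding ded_def by (simp add: algebra_simps)
  qed
  finally show ?thesis using assms(1) by (simp add: field_simps)
qed

text \<open>The quotient \<open>h * x div k\<close> counts the j \<ge> 1 with
  \<open>j * k \<le> h * x\<close>, that is, lattice points below a line. Summed in the other order,
  each height j collects the x beyond \<open>k * j div h\<close>, which is an elementary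
  sum.\<close>

lemma two_sum_mult_div:
  assumes "h > 0" "k > 0" "coprime h (k::int)"
  shows "2 * (\<Sum>x\<in>{0..<k}. x * (h * x div k))
       = (\<Sum>j\<in>{0..<h}. k * (k - 1) - (k * j div h) * (k * j div h + 1)) - k * (k - 1)"
proof -
  have eq: "x * (h * x div k) = (\<Sum>j\<in>{1..<h}. if j * k \<le> h * x then x else 0)"
    if x: "x \<in> {0..<k}" for x
  proof -
    have "h * x div k < h" using x assms by (simp add: int_div_less_iff)
    have "{j \<in> {1..<h}. j * k \<le> h * x} = {1..h * x div k}"
      using assms(2) \<open>h * x div k < h\<close> by (auto simp flip: int_le_div_iff)
    then have "(\<Sum>j\<in>{1..<h}. if j * k \<le> h * x then x else 0) = (\<Sum>j\<in>{1..h * x div k}. x)"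
      by (subst sum.inter_filter[symmetric]) simp_all
    then show ?thesis using x assms by (simp add: pos_imp_zdiv_nonneg_iff)
  qed
  have inner: "2 * (\<Sum>x\<in>{0..<k}. if j * k \<le> h * x then x else 0)
      = k * (k - 1) - (k * j div h) * (k * j div h + 1)"
    if j: "j \<in> {1..<h}" for j
  proof -
    define q where "q = k * j div h"
    have q: "0 \<le> q" "q < k" using j assms unfolding q_def
      by (auto simp: pos_imp_zdiv_nonneg_iff int_div_less_iff)
    \<comment> \<open>For 0 < j < h no lattice point lies on the line, as h and k are coprime; so
      the weak inequality may be exchanged for a strict one.\<close>
    have nd: "\<not> h dvd k * j" using j assms dvd_small_int[of j h]
      by (simp add: coprime_dvd_mult_right_iff)
    have "j * k \<le> h * x \<longleftrightarrow> q < x" for x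
    proof -
      have "j * k \<noteq> h * x" using nd by (metis dvd_triv_left mult.commute)
      then have "j * k \<le> h * x \<longleftrightarrow> k * j < x * h" by (auto simp: mult.commute)
      also have "\<dots> \<longleftrightarrow> q < x" unfolding q_def using assms(1) by (simp add: int_div_less_iff)
      finally show ?thesis .
    qed
    then have "(\<Sum>x\<in>{0..<k}. if j * k \<le> h * x then x else 0) = (\<Sum>x\<in>{x\<in>{0..<k}. q < x}. x)"
      by (subst sum.inter_filter) simp_all
    also have "{x\<in>{0..<k}. q < x} = {0..<k} - {0..<q + 1}" using q by auto
    also have "(\<Sum>x\<in>{0..<k} - {0..<q + 1}. x) = (\<Sum>x\<in>{0..<k}. x) - (\<Sum>x\<in>{0..<q + 1}. x)"
      using q by (intro sum_diff) auto
    finally show ?thesis using sum_int_interval[of k] sum_int_interval[of "q + 1"] q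
      by (simp add: q_def algebra_simps)
  qed
  have "2 * (\<Sum>x\<in>{0..<k}. x * (h * x div k))
     = 2 * (\<Sum>x\<in>{0..<k}. \<Sum>j\<in>{1..<h}. if j * k \<le> h * x then x else 0)"
    by (simp add: eq)
  also have "\<dots> = (\<Sum>j\<in>{1..<h}. 2 * (\<Sum>x\<in>{0..<k}. if j * k \<le> h * x then x else 0))"
    by (subst sum.swap) (simp add: sum_distrib_left)
  also have "\<dots> = (\<Sum>j\<in>{1..<h}. k * (k - 1) - (k * j div h) * (k * j div h + 1))"
    by (intro sum.cong refl inner)
  \<comment> \<open>The term j = 0 equals \<open>k * (k - 1)\<close>; adding and subtracting it
    makes the range a full residue system modulo h.\<close>
  also have "{0..<h} = insert 0 {1..<h}" using assms by auto
  then have "(\<Sum>j\<in>{1..<h}. k * (k - 1) - (k * j div h) * (k * j div h + 1))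
     = (\<Sum>j\<in>{0..<h}. k * (k - 1) - (k * j div h) * (k * j div h + 1)) - k * (k - 1)"
    by simp
  finally show ?thesis .
qed

text \<open>The lattice count expresses S through the square sum B and through C. The residues
  \<open>k * j mod h\<close> permute the interval, so their squares give a second relation, between
  B and A. Eliminating B leaves Dedekind's law with its denominators cleared.\<close>

theorem ded_reciprocity:
  assumes "h > 0" "k > 0" "coprime h k"
  shows "h * ded h k + k * ded k h = h\<^sup>2 + k\<^sup>2 + 1 - 3 * h * k"
proof -
  define q where "q j = k * j div h" for j
  define A B C Q S where "A = (\<Sum>j\<in>{0..<h}. j * q j)" and "B = (\<Sum>j\<in>{0..<h}. (q j)\<^sup>2)"
    and "C = (\<Sum>j\<in>{0..<h}. q j)" and "Q = (\<Sum>j\<in>{0..<h}. j\<^sup>2)"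
    and "S = (\<Sum>x\<in>{0..<k}. x * (h * x div k))"
  have cop: "coprime k h" using assms(3) by (simp add: coprime_commute)
  have C: "2 * C = (k - 1) * (h - 1)"
    using sum_mult_div[OF assms(1) cop] by (simp add: C_def q_def)
  have Q: "6 * Q = (h - 1) * h * (2 * h - 1)"
    using sum_squares_int_interval[of h] assms(1) by (simp add: Q_def)
  have "Q = (\<Sum>j\<in>{0..<h}. (k * j mod h)\<^sup>2)"
    using sum_mult_mod[OF assms(1) cop, of "\<lambda>x. x\<^sup>2"] by (simp add: Q_def)
  also have "\<dots> = (\<Sum>j\<in>{0..<h}. k\<^sup>2 * j\<^sup>2 - 2 * h * k * (j * q j) + h\<^sup>2 * (q j)\<^sup>2)"
    by (intro sum.cong refl)
       (simp add: q_def minus_mult_div_eq_mod [symmetric] algebra_simps power2_eq_square)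
  also have "\<dots> = k\<^sup>2 * Q - 2 * h * k * A + h\<^sup>2 * B"
    by (simp add: sum.distrib sum_subtractf Q_def A_def B_def sum_distrib_left)
  finally have QA: "Q = k\<^sup>2 * Q - 2 * h * k * A + h\<^sup>2 * B" .
  have "2 * S = (\<Sum>j\<in>{0..<h}. k * (k - 1) - q j * (q j + 1)) - k * (k - 1)"
    using two_sum_mult_div[OF assms] by (simp add: S_def q_def)
  also have "(\<Sum>j\<in>{0..<h}. k * (k - 1) - q j * (q j + 1)) = (\<Sum>j\<in>{0..<h}. k * (k - 1) - (q j)\<^sup>2 - q j)"
    by (intro sum.cong refl) (simp add: algebra_simps power2_eq_square)
  also have "\<dots> = h * (k * (k - 1)) - B - C"
    using assms(1) by (simp add: sum_subtractf B_def C_def)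
  finally have S: "2 * S = h * (k * (k - 1)) - B - C - k * (k - 1)" .
  have hk: "ded h k = 2 * h * (k - 1) * (2 * k - 1) - 12 * S - 3 * k * (k - 1)"
    by (simp add: ded_def S_def)
  have kh: "ded k h = 2 * k * (h - 1) * (2 * h - 1) - 12 * A - 3 * h * (h - 1)"
    by (simp add: ded_def A_def q_def)
  \<comment> \<open>The relation between A and B involves \<open>h\<^sup>2 * B\<close>, so
    everything is multiplied by h, which is cancelled at the end.\<close>
  have "h * (h * ded h k + k * ded k h) = h * (h\<^sup>2 + k\<^sup>2 + 1 - 3 * h * k)"
  proof -
    have 1: "12 * h\<^sup>2 * S = 6 * h\<^sup>2 * (h * (k * (k - 1)) - k * (k - 1)) - 6 * (h\<^sup>2 * B) - 3 * h\<^sup>2 * (2 * C)"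
    proof -
      have "12 * h\<^sup>2 * S = 6 * h\<^sup>2 * (2 * S)" by simp
      then show ?thesis unfolding S by (simp add: algebra_simps)
    qed
    have 2: "6 * (h\<^sup>2 * B) = 6 * Q - k\<^sup>2 * (6 * Q) + 12 * h * k * A"
    proof -
      have "6 * (h\<^sup>2 * B) - (6 * Q - k\<^sup>2 * (6 * Q) + 12 * h * k * A)
          = 6 * ((k\<^sup>2 * Q - 2 * h * k * A + h\<^sup>2 * B) - Q)"
        by (simp add: algebra_simps)
      then show ?thesis using QA by simp
    qed
    have "h * (h * ded h k + k * ded k h)
       = 2 * h * h\<^sup>2 * (k - 1) * (2 * k - 1) - 12 * h\<^sup>2 * S - 3 * h\<^sup>2 * k * (k - 1)
         + h * k * (2 * k * (h - 1) * (2 * h - 1) - 12 * A - 3 * h * (h - 1))"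
      unfolding hk kh by (simp add: algebra_simps power2_eq_square)
    then show ?thesis unfolding 1 2 C Q by (simp add: algebra_simps power2_eq_square)
  qed
  then show ?thesis using assms(1) by simp
qed

section \<open>Dedekind sums modulo 3 and modulo 8\<close>

lemma saw_minus: "saw (- x) = - saw x"
proof (cases "x \<in> \<int>")
  case False
  then have "of_int \<lfloor>x\<rfloor> \<noteq> x" by (metis Ints_of_int)
  then have "\<lfloor>- x\<rfloor> = - \<lfloor>x\<rfloor> - 1" by linarith
  then show ?thesis using False by (simp add: saw_def)
qed (simp add: saw_def)

lemma dsum_minus: "dsum (- h) k = - dsum h k"
  unfolding dsum_def by (simp add: saw_minus sum_negf)

lemma dsum_cong:
  assumes "k > 0" "[h = h'] (mod k)"
  shows "dsum h k = dsum h' k"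
proof -
  have "[h * x = h' * x] (mod k)" for x using assms(2) by (rule cong_scalar_right)
  then have "k dvd h * x \<longleftrightarrow> k dvd h' * x" "h * x mod k = h' * x mod k" for x
    by (auto simp: cong_def dvd_eq_mod_eq_0)
  then have "saw (of_int (h * x) / of_int k) = saw (of_int (h' * x) / of_int k)" for x
    by (simp only: saw_of_int_divide[OF assms(1)])
  then show ?thesis unfolding dsum_def by simp
qed

lemma ded_cong:
  assumes "k > 0" "[h = h'] (mod k)" "coprime h k"
  shows "ded h k = ded h' k"
proof -
  have "coprime h' k" using assms(2,3) cong_imp_coprime by blast
  then have "real_of_int (ded h k) = of_int (ded h' k)"
    using dsum_eq_ded[OF assms(1)] assms dsum_cong[OF assms(1,2)] by metis
  then show ?thesis by simp
qed

lemma ded_minus: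
  assumes "k > 0" "coprime h k"
  shows "ded (- h) k = - ded h k"
proof -
  have "real_of_int (ded (- h) k) = of_int (- ded h k)"
    using dsum_eq_ded[OF assms(1)] assms dsum_minus[of h k]
    by (metis coprime_minus_left_iff mult_minus_right of_int_minus)
  then show ?thesis by linarith
qed

lemma ded_dvd_3:
  assumes "\<not> 3 dvd k"
  shows "3 dvd ded h k"
proof -
  have "3 dvd (k - 1) * (2 * k - 1)"
  proof -
    have "3 dvd k - 1 \<or> 3 dvd 2 * k - 1" using assms by presburger
    then show ?thesis by auto
  qed
  then have "3 dvd 2 * h * ((k - 1) * (2 * k - 1))" by (rule dvd_mult)
  moreover have "ded h k = 2 * h * ((k - 1) * (2 * k - 1))
     - 3 * (4 * (\<Sum>x\<in>{0..<k}. x * (h * x div k)) + k * (k - 1))"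
    by (simp add: ded_def algebra_simps)
  ultimately show ?thesis by (metis dvd_diff dvd_triv_left)
qed

text \<open>The induction is Euclidean: h is reduced modulo k, an even residue is replaced by the
  negative of its complement, and for odd h < k both reciprocity laws, for Dedekind sums and for
  Kronecker symbols, swap the entries.\<close>

theorem ded_mod_8:
  assumes "k > 0" "odd k" "coprime h k"
  shows "[ded h k = k + 1 - 2 * kronecker h k] (mod 8)"
  using assms
proof (induction "nat k" arbitrary: h k rule: less_induct)
  case (less k h)
  note k = less.prems
  have odd_case: "[ded h k = k + 1 - 2 * kronecker h k] (mod 8)"
    if h: "0 < h" "h < k" "odd h" "coprime h k" for h
  proof -
    define J where "J = kronecker k h"
    have cop: "coprime k h" using h by (simp add: coprime_commute)
    have J: "J = 1 \<or> J = -1" using kronecker_sign[OF h(1) cop] by (auto simp: J_def)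
    have IH: "[ded k h = h + 1 - 2 * J] (mod 8)"
      unfolding J_def using less.hyps[of h k] h k cop by simp
    have sq: "[h\<^sup>2 = 1] (mod 8)" "[k\<^sup>2 = 1] (mod 8)"
      using odd_square_mod_8 h k by auto
    obtain y where y: "ded k h = h + 1 - 2 * J + 8 * y"
      using IH by (metis cong_iff_lin cong_sym)
    obtain u where u: "h\<^sup>2 = 1 + 8 * u" using sq(1) by (metis cong_iff_lin cong_sym)
    obtain v where v: "k\<^sup>2 = 1 + 8 * v" using sq(2) by (metis cong_iff_lin cong_sym)
    \<comment> \<open>Modulo 8 the odd h is its own inverse, so multiplying the reciprocity law by h
      isolates \<open>ded h k\<close>; u, v and y record the multiples of 8 dropped from
      \<open>h\<^sup>2\<close>, \<open>k\<^sup>2\<close> and \<open>ded k h\<close>.\<close>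
    have "ded h k - (3 * h - 4 * k - h * k + 2 * J * (h * k)
        + 8 * (h * u + h * v - 3 * u * k - h * k * y - u * ded h k - u * k))
      = h * (h * ded h k + k * ded k h - (h\<^sup>2 + k\<^sup>2 + 1 - 3 * h * k))
        - (h\<^sup>2 - (1 + 8 * u)) * (ded h k - h + 4 * k)
        - h * k * (ded k h - (h + 1 - 2 * J + 8 * y)) + h * (k\<^sup>2 - (1 + 8 * v))"
      by (simp add: algebra_simps power2_eq_square)
    also have "\<dots> = 0"
    proof -
      have z: "h * ded h k + k * ded k h - (h\<^sup>2 + k\<^sup>2 + 1 - 3 * h * k) = 0"
        "h\<^sup>2 - (1 + 8 * u) = 0" "ded k h - (h + 1 - 2 * J + 8 * y) = 0" "k\<^sup>2 - (1 + 8 * v) = 0"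
        using ded_reciprocity[OF h(1) k(1) h(4)] y u v by linarith+
      show ?thesis unfolding z by simp
    qed
    finally have "ded h k = 3 * h - 4 * k - h * k + 2 * J * (h * k)
        + 8 * (h * u + h * v - 3 * u * k - h * k * y - u * ded h k - u * k)" by simp
    moreover define E where "E = h * u + h * v - 3 * u * k - h * k * y - u * ded h k - u * k"
    ultimately have X: "ded h k = 3 * h - 4 * k - h * k + 2 * J * (h * k) + 8 * E" by simp
    have rec: "kronecker h k = qr_sign h k * J"
      unfolding J_def using h k by (intro kronecker_reciprocity) auto
    obtain i where i: "h = 4 * i + 1 \<or> h = 4 * i + 3" using odd_int_4_cases[OF h(3)] by blast
    obtain j where j: "k = 4 * j + 1 \<or> k = 4 * j + 3" using odd_int_4_cases[OF k(2)] by blast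
    \<comment> \<open>The product \<open>i * j\<close> is the only nonlinear quantity left; once it
      is named, each case of residues modulo 4 is linear arithmetic.\<close>
    define z where "z = i * j"
    have s: "(4 * n + 1) mod 4 = 1" "(4 * n + 3) mod 4 = 3" for n :: int by presburger+
    have "8 dvd 3 * h - 4 * k - h * k + 2 * J * (h * k) + 8 * E - (k + 1 - 2 * (qr_sign h k * J))"
      using i
    proof
      assume h1: "h = 4 * i + 1"
      show ?thesis using j
      proof
        assume k1: "k = 4 * j + 1"
        have "h * k = 16 * z + 4 * i + 4 * j + 1" "qr_sign h k = 1"
          by (simp_all add: h1 k1 z_def algebra_simps qr_sign_def s)
        then show ?thesis using J unfolding \<open>h * k = _\<close> h1 k1 \<open>qr_sign h k = _\<close>[unfolded h1 k1]
          by (elim disjE; simp; presburger)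
      next
        assume k1: "k = 4 * j + 3"
        have "h * k = 16 * z + 12 * i + 4 * j + 3" "qr_sign h k = 1"
          by (simp_all add: h1 k1 z_def algebra_simps qr_sign_def s)
        then show ?thesis using J unfolding \<open>h * k = _\<close> h1 k1 \<open>qr_sign h k = _\<close>[unfolded h1 k1]
          by (elim disjE; simp; presburger)
      qed
    next
      assume h1: "h = 4 * i + 3"
      show ?thesis using j
      proof
        assume k1: "k = 4 * j + 1"
        have "h * k = 16 * z + 4 * i + 12 * j + 3" "qr_sign h k = 1"
          by (simp_all add: h1 k1 z_def algebra_simps qr_sign_def s)
        then show ?thesis using J unfolding \<open>h * k = _\<close> h1 k1 \<open>qr_sign h k = _\<close>[unfolded h1 k1]
          by (elim disjE; simp; presburger)
      next
        assume k1: "k = 4 * j + 3"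
        have "h * k = 16 * z + 12 * i + 12 * j + 9" "qr_sign h k = -1"
          by (simp_all add: h1 k1 z_def algebra_simps qr_sign_def s)
        then show ?thesis using J unfolding \<open>h * k = _\<close> h1 k1 \<open>qr_sign h k = _\<close>[unfolded h1 k1]
          by (elim disjE; simp; presburger)
      qed
    qed
    then show ?thesis unfolding rec X cong_iff_dvd_diff .
  qed
  show ?case
  proof (cases "k = 1")
    case True
    moreover have "{0..<1::int} = {0}" by auto
    ultimately show ?thesis by (simp add: ded_def)
  next
    case False
    define h0 where "h0 = h mod k"
    have cg: "[h = h0] (mod k)" by (simp add: h0_def)
    have cop: "coprime h0 k" using cg k(3) cong_imp_coprime by blast
    have "h0 \<noteq> 0" using cop False k(1) by auto
    then have h0: "0 < h0" "h0 < k"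
      using k(1) pos_mod_sign[of k h] pos_mod_bound[of k h] unfolding h0_def by linarith+
    have eq: "ded h k = ded h0 k" "kronecker h k = kronecker h0 k"
      using ded_cong[OF k(1) cg k(3)] kronecker_cong[OF k(1,2) cg] by auto
    show ?thesis
    proof (cases "odd h0")
      case True
      then show ?thesis using odd_case[OF h0 _ cop] eq by simp
    next
      case False
      \<comment> \<open>As k is odd, this complement of an even residue is odd, so the case already
        proved applies to it.\<close>
      define h1 where "h1 = k - h0"
      have cg1: "[h0 = - h1] (mod k)" by (simp add: h1_def cong_iff_dvd_diff)
      have cop1: "coprime h1 k" using cop unfolding h1_def
        by (metis coprime_commute coprime_diff_one_left_nat coprime_minus_right_iff diff_minus_eq_add
          gcd_diff2 coprime_iff_gcd_eq_1 gcd.commute)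
      have h1: "0 < h1" "h1 < k" "odd h1" using h0 False k by (auto simp: h1_def)
      have "ded h0 k = - ded h1 k"
        using ded_cong[OF k(1) cg1 cop] ded_minus[OF k(1) cop1] by simp
      moreover have "kronecker h0 k = kronecker (-1) k * kronecker h1 k"
        using kronecker_cong[OF k(1,2) cg1] kronecker_mult_left[OF k(1), of "-1" h1] by simp
      moreover have "kronecker h1 k = 1 \<or> kronecker h1 k = -1"
        using kronecker_sign[OF k(1) cop1] by auto
      moreover note odd_case[OF h1 cop1] kronecker_minus_one[OF k(1,2)] odd_mod_4[OF k(2)]
      ultimately show ?thesis unfolding eq cong_iff_dvd_diff
        by (elim disjE; simp; presburger)
    qed
  qed
qed

text \<open>By reciprocity the value is both U/c and V/d with integers U and V, and since c and d
  are coprime it is an integer P. The congruence modulo 8 is read off from d P = V.\<close>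

theorem Psi_congruences:
  assumes "a * d - b * c = 1" "c > 0" "d > 0" "odd d"
  obtains P :: int where "Psi a b c d = of_int P"
    "[d * P = b - c + d + 1 - 2 * kronecker c d] (mod 8)"
    "[P = (a + d) * c - b * d * (c\<^sup>2 - 1)] (mod 3)"
proof -
  have cop': "coprime d c" by (rule coprime_of_det[OF assms(1)])
  then have cop: "coprime c d" by (simp add: coprime_commute)
  define U V where "U = a + d - 3 * c - ded d c" and "V = b - c + ded c d"
  \<comment> \<open>If U = c P and V = d P, then the determinant condition gives a V - b U = P, so
    this is the only candidate.\<close>
  define P where "P = a * V - b * U"
  have cPsi: "of_int c * Psi a b c d = of_int U"
    using dsum_eq_ded[OF assms(2) cop'] assms(2)
    by (simp add: Psi_def U_def dsum_minus field_simps)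
  have UV: "d * U = c * V"
  proof -
    have "c * ded c d + d * ded d c = c\<^sup>2 + d\<^sup>2 + 1 - 3 * c * d"
      by (rule ded_reciprocity[OF assms(2,3) cop])
    moreover have "d * U - c * V = (a * d - b * c - 1)
       - (c * ded c d + d * ded d c - (c\<^sup>2 + d\<^sup>2 + 1 - 3 * c * d))"
      unfolding U_def V_def by (simp add: algebra_simps power2_eq_square)
    ultimately show ?thesis using assms(1) by simp
  qed
  have cP: "c * P = U"
  proof -
    have "c * P = a * (c * V) - b * c * U" by (simp add: P_def algebra_simps)
    also have "\<dots> = a * (d * U) - b * c * U" by (simp only: UV)
    also have "\<dots> = (a * d - b * c) * U" by (simp add: algebra_simps)
    finally show ?thesis using assms(1) by simp
  qed
  have dP: "d * P = V"
  proof -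
    have "d * P = a * d * V - b * (d * U)" by (simp add: P_def algebra_simps)
    also have "\<dots> = a * d * V - b * (c * V)" by (simp only: UV)
    also have "\<dots> = (a * d - b * c) * V" by (simp add: algebra_simps)
    finally show ?thesis using assms(1) by simp
  qed
  have "of_int c * Psi a b c d = of_int c * of_int P" using cPsi cP by (metis of_int_mult)
  then have "Psi a b c d = of_int P" using assms(2) by simp
  moreover have "[d * P = b - c + d + 1 - 2 * kronecker c d] (mod 8)"
  proof -
    have "[b - c + ded c d = b - c + (d + 1 - 2 * kronecker c d)] (mod 8)"
      using ded_mod_8[OF assms(3,4) cop] by (intro cong_add cong_refl)
    then show ?thesis unfolding dP V_def by (simp add: algebra_simps)
  qed
  moreover have "[P = (a + d) * c - b * d * (c\<^sup>2 - 1)] (mod 3)"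
  \<comment> \<open>A square prime to 3 is 1 modulo 3: for c prime to 3, P is congruent to c (c P) =
    c U; if 3 divides c, then P is congruent to d (d P) = d V. In each case 3 divides the Dedekind
    term, and the stated formula merges both values.\<close>
  proof (cases "3 dvd c")
    case False
    then obtain e where e: "ded d c = 3 * e" using ded_dvd_3 by blast
    from not_dvd_3_square[OF False] obtain f where f: "c\<^sup>2 = 1 + 3 * f" by (metis cong_iff_lin cong_sym)
    have "P - ((a + d) * c - b * d * (c\<^sup>2 - 1)) - 3 * (- c\<^sup>2 - e * c - f * P + b * d * f)
        = c * (c * P - (a + d - 3 * c - 3 * e)) + (b * d - P) * (c\<^sup>2 - (1 + 3 * f))"
      by (simp add: algebra_simps power2_eq_square)
    also have "\<dots> = 0" using cP e f unfolding U_def by simp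
    finally have "P - ((a + d) * c - b * d * (c\<^sup>2 - 1)) = 3 * (- c\<^sup>2 - e * c - f * P + b * d * f)"
      by simp
    then show ?thesis by (simp add: cong_iff_dvd_diff)
  next
    case True
    then obtain g where g: "c = 3 * g" by blast
    have nd: "\<not> 3 dvd d" using coprime_common_divisor[OF cop True] by auto
    obtain e where e: "ded c d = 3 * e" using ded_dvd_3[OF nd] by blast
    from not_dvd_3_square[OF nd] obtain f where f: "d\<^sup>2 = 1 + 3 * f" by (metis cong_iff_lin cong_sym)
    have "P - ((a + d) * c - b * d * (c\<^sup>2 - 1))
          - 3 * (- g * d + e * d - f * P - (a + d) * g + b * d * 3 * g\<^sup>2)
        = d * (d * P - (b - c + 3 * e)) - P * (d\<^sup>2 - (1 + 3 * f))"
      unfolding g by (simp add: algebra_simps power2_eq_square)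
    also have "\<dots> = 0" using dP e f unfolding V_def by simp
    finally have "P - ((a + d) * c - b * d * (c\<^sup>2 - 1))
        = 3 * (- g * d + e * d - f * P - (a + d) * g + b * d * 3 * g\<^sup>2)"
      by simp
    then show ?thesis by (simp add: cong_iff_dvd_diff)
  qed
  ultimately show ?thesis using that by blast
qed

section \<open>Fourier expansion of eta-quotients\<close>

definition euler_prod :: "complex \<Rightarrow> complex" where
  "euler_prod q = (\<Prod>n. 1 - q ^ Suc n)"

lemma convergent_euler_prod:
  assumes "norm (q::complex) < 1"
  shows "convergent_prod (\<lambda>n. 1 - q ^ Suc n)"
proof -
  have "summable (\<lambda>n. norm q * norm q ^ n)" using assms by (intro summable_mult summable_geometric) simp
  then have "abs_convergent_prod (\<lambda>n. 1 - q ^ Suc n)"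
    unfolding abs_convergent_prod_conv_summable by (simp add: norm_mult norm_power)
  then show ?thesis by (rule abs_convergent_prod_imp_convergent_prod)
qed

lemma power_Suc_neq_1:
  assumes "norm (q::complex) < 1"
  shows "1 - q ^ Suc n \<noteq> 0"
proof
  assume "1 - q ^ Suc n = 0"
  then have "norm q ^ Suc n = 1" by (metis eq_iff_diff_eq_0 norm_one norm_power)
  moreover have "norm q ^ Suc n < 1" using assms by (metis norm_ge_zero power_less_one_iff zero_less_Suc)
  ultimately show False by simp
qed

lemma euler_prod_nonzero: "norm q < 1 \<Longrightarrow> euler_prod q \<noteq> 0"
  unfolding euler_prod_def by (intro prodinf_nonzero convergent_euler_prod power_Suc_neq_1)

lemma euler_prod_0: "euler_prod 0 = 1"
  unfolding euler_prod_def by simp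

text \<open>The n-th factor differs from 1 by at most \<open>R ^ Suc n\<close>, so the Weierstrass
  test applies to the product on the closed disc.\<close>

lemma uniform_limit_euler_prod:
  assumes "0 \<le> R" "R < 1"
  shows "uniform_limit (cball 0 R) (\<lambda>N q. \<Prod>n<N. 1 - q ^ Suc n) euler_prod sequentially"
proof -
  have "uniformly_convergent_on (cball 0 R) (\<lambda>N q. \<Prod>n<N. 1 - q ^ Suc n :: complex)"
  proof (rule uniformly_convergent_on_prod')
    show "uniformly_convergent_on (cball 0 R) (\<lambda>N q. \<Sum>n<N. norm (1 - q ^ Suc n - 1 :: complex))"
    proof (rule Weierstrass_m_test')
      fix n and q :: complex assume "q \<in> cball 0 R"
      then have "norm q ^ Suc n \<le> R ^ Suc n" by (intro power_mono) auto
      then show "norm (norm (1 - q ^ Suc n - 1)) \<le> R ^ Suc n" by (simp add: norm_mult norm_power)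
    next
      have "summable (\<lambda>n. R * R ^ n)" using assms by (intro summable_mult summable_geometric) simp
      then show "summable (\<lambda>n. R ^ Suc n)" by simp
    qed
  qed (auto intro!: continuous_intros)
  then have ul: "uniform_limit (cball 0 R) (\<lambda>N q. \<Prod>n<N. 1 - q ^ Suc n)
     (\<lambda>q. lim (\<lambda>N. \<Prod>n<N. 1 - q ^ Suc n :: complex)) sequentially"
    by (simp only: uniformly_convergent_uniform_limit_iff)
  have "lim (\<lambda>N. \<Prod>n<N. 1 - q ^ Suc n) = euler_prod q" if "q \<in> cball 0 R" for q
  proof -
    have "norm q < 1" using that assms by auto
    then have "(\<lambda>N. \<Prod>n\<le>N. 1 - q ^ Suc n) \<longlonglongrightarrow> euler_prod q"
      unfolding euler_prod_def by (intro convergent_prod_LIMSEQ convergent_euler_prod)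
    then have "(\<lambda>N. \<Prod>n<N. 1 - q ^ Suc n) \<longlonglongrightarrow> euler_prod q"
      by (simp only: LIMSEQ_lessThan_iff_atMost)
    then show ?thesis by (rule limI)
  qed
  then show ?thesis using ul by (subst (asm) uniform_limit_cong') auto
qed

lemma holomorphic_euler_prod: "euler_prod holomorphic_on ball 0 1"
proof (rule holomorphic_uniform_sequence)
  show "(\<lambda>q::complex. \<Prod>n<N. 1 - q ^ Suc n) holomorphic_on ball 0 1" for N
    by (intro holomorphic_intros)
  fix q :: complex assume q: "q \<in> ball 0 1"
  define R where "R = (1 + norm q) / 2"
  have R: "0 \<le> R" "R < 1" "norm q < R" using q by (auto simp: R_def)
  have sub: "cball q (R - norm q) \<subseteq> cball 0 R"
  proof
    fix w assume "w \<in> cball q (R - norm q)"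
    then have "norm (w - q) \<le> R - norm q" by (simp add: dist_norm norm_minus_commute)
    then show "w \<in> cball 0 R" using norm_triangle_ineq[of "w - q" q] by simp
  qed
  show "\<exists>d>0. cball q d \<subseteq> ball 0 1 \<and>
     uniform_limit (cball q d) (\<lambda>N q. \<Prod>n<N. 1 - q ^ Suc n) euler_prod sequentially"
  proof (intro exI conjI)
    show "R - norm q > 0" using R by simp
    show "cball q (R - norm q) \<subseteq> ball 0 1" using sub R by force
    show "uniform_limit (cball q (R - norm q)) (\<lambda>N q. \<Prod>n<N. 1 - q ^ Suc n) euler_prod sequentially"
      by (rule uniform_limit_on_subset[OF uniform_limit_euler_prod sub]) (use R in auto)
  qed
qed auto

text \<open>The eta-quotient without its fractional power of q. It is single-valued in q and, for
  indices n > 0, holomorphic on the unit disc, so it has a Taylor series at q = 0.\<close>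

definition eta_quot_prod :: "(nat \<Rightarrow> int) \<Rightarrow> complex \<Rightarrow> complex" where
  "eta_quot_prod r q = (\<Prod>n\<in>supp r. euler_prod (q ^ n) powi r n)"

lemma eta_eq: "eta \<tau> = exp (2 * pi * \<i> * \<tau> / 24) * euler_prod (exp (2 * pi * \<i> * \<tau>))"
proof -
  have "exp (2 * pi * \<i> * of_nat (Suc n) * \<tau>) = exp (2 * pi * \<i> * \<tau>) ^ Suc n" for n
    by (subst exp_of_nat_mult [symmetric]) (simp add: mult_ac)
  then show ?thesis unfolding eta_def euler_prod_def by simp
qed

lemma HH_norm_less_1: "\<tau> \<in> HH \<Longrightarrow> norm (exp (2 * pi * \<i> * \<tau>)) < 1"
  by (simp add: HH_def norm_exp_eq_Re)

lemma exp_powi_int: "exp z powi n = exp (of_int n * (z::complex))"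
  by (simp add: exp_power_int mult.commute)

lemma eta_quot_eq:
  "eta_quot r \<tau> = exp (2 * pi * \<i> * (of_int (xN r) / 24) * \<tau>) * eta_quot_prod r (exp (2 * pi * \<i> * \<tau>))"
proof (cases "finite (supp r)")
  case fin: True
  have "eta (of_nat n * \<tau>) powi r n = exp (of_int (int n * r n) * (2 * pi * \<i> * \<tau> / 24)) *
      (euler_prod (exp (2 * pi * \<i> * \<tau>) ^ n) powi r n)" for n
  proof -
    have "exp (2 * pi * \<i> * (of_nat n * \<tau>)) = exp (2 * pi * \<i> * \<tau>) ^ n"
      by (subst exp_of_nat_mult [symmetric]) (simp add: mult_ac)
    then show ?thesis
      by (simp add: eta_eq power_int_mult_distrib exp_powi_int mult_ac)
  qed
  then have "eta_quot r \<tau> = (\<Prod>n\<in>supp r. exp (of_int (int n * r n) * (2 * pi * \<i> * \<tau> / 24))) *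
     eta_quot_prod r (exp (2 * pi * \<i> * \<tau>))"
    unfolding eta_quot_def eta_quot_prod_def by (simp add: prod.distrib)
  also have "(\<Prod>n\<in>supp r. exp (of_int (int n * r n) * (2 * pi * \<i> * \<tau> / 24)))
      = exp (\<Sum>n\<in>supp r. of_int (int n * r n) * (2 * pi * \<i> * \<tau> / 24))"
    by (rule exp_sum[OF fin, symmetric])
  also have "(\<Sum>n\<in>supp r. of_int (int n * r n) * (2 * pi * \<i> * \<tau> / 24))
      = of_int (xN r) * (2 * pi * \<i> * \<tau> / 24)"
    unfolding xN_def of_int_sum sum_distrib_right ..
  also have "\<dots> = 2 * pi * \<i> * (of_int (xN r) / 24) * \<tau>" by simp
  finally show ?thesis .
qed (simp add: eta_quot_def eta_quot_prod_def xN_def)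

lemma norm_power_less_1: "norm (q::complex) < 1 \<Longrightarrow> n > 0 \<Longrightarrow> norm (q ^ n) < 1"
  by (metis norm_ge_zero norm_power power_less_one_iff)

lemma eta_quot_prod_nonzero:
  assumes "finite (supp r)" "0 \<notin> supp r" "norm q < 1"
  shows "eta_quot_prod r q \<noteq> 0"
proof -
  have "euler_prod (q ^ n) powi r n \<noteq> 0" if "n \<in> supp r" for n
  proof -
    have "n > 0" using that assms(2) by (cases n) auto
    then show ?thesis using euler_prod_nonzero[OF norm_power_less_1[OF assms(3)], of n] by simp
  qed
  then show ?thesis using assms(1) by (simp add: eta_quot_prod_def)
qed

lemma holomorphic_eta_quot_prod:
  assumes "0 \<notin> supp r"
  shows "eta_quot_prod r holomorphic_on ball 0 1"
  unfolding eta_quot_prod_def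
proof (intro holomorphic_intros)
  fix n assume "n \<in> supp r"
  then have n: "n > 0" using assms by (cases n) auto
  then show "r n \<ge> 0 \<or> (\<forall>q\<in>ball 0 1. euler_prod (q ^ n) \<noteq> 0)"
    using euler_prod_nonzero norm_power_less_1 by auto
  have "euler_prod \<circ> (\<lambda>q. q ^ n) holomorphic_on ball 0 1"
    by (rule holomorphic_on_compose_gen[OF _ holomorphic_euler_prod])
       (use n norm_power_less_1 in \<open>auto intro!: holomorphic_intros\<close>)
  then show "(\<lambda>q. euler_prod (q ^ n)) holomorphic_on ball 0 1" by (simp add: comp_def)
qed

lemma eta_quot_prod_0:
  assumes "0 \<notin> supp r"
  shows "eta_quot_prod r 0 = 1"
proof -
  have "euler_prod (0 ^ n) powi r n = 1" if "n \<in> supp r" for n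
  proof -
    have "n > 0" using that assms by (cases n) auto
    then show ?thesis by (simp only: zero_power euler_prod_0 power_int_1_left)
  qed
  then show ?thesis by (simp add: eta_quot_prod_def)
qed

lemma eta_quot_nonzero:
  assumes "finite (supp r)" "0 \<notin> supp r" "\<tau> \<in> HH"
  shows "eta_quot r \<tau> \<noteq> 0"
  using eta_quot_prod_nonzero[OF assms(1,2) HH_norm_less_1[OF assms(3)]] by (simp add: eta_quot_eq)

lemma eta_quot_add_int:
  "eta_quot r (\<tau> + of_int m) = ee (of_int (xN r * m) / 24) * eta_quot r \<tau>"
proof -
  have "exp (2 * pi * \<i> * (\<tau> + of_int m)) = exp (2 * pi * \<i> * \<tau>)"
  proof -
    have "2 * pi * \<i> * (\<tau> + of_int m) = 2 * pi * \<i> * \<tau> + 2 * of_int m * pi * \<i>"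
      by (simp add: algebra_simps)
    moreover have "exp (2 * of_int m * pi * \<i>) = 1"
      by (auto simp: exp_eq_1 intro: exI[of _ m])
    ultimately show ?thesis by (simp add: exp_add)
  qed
  moreover have "exp (2 * pi * \<i> * (of_int (xN r) / 24) * (\<tau> + of_int m))
      = ee (of_int (xN r * m) / 24) * exp (2 * pi * \<i> * (of_int (xN r) / 24) * \<tau>)"
    unfolding ee_def distrib_left exp_add by (simp add: mult_ac)
  ultimately show ?thesis unfolding eta_quot_eq by simp
qed

text \<open>The coefficient of f at the exponent x_N/24 + m, obtained as a Taylor coefficient;
  \<open>cf_eq\<close> identifies it with the integral that defines \<open>cf\<close>.\<close>

definition pcoeff :: "(nat \<Rightarrow> int) \<Rightarrow> nat \<Rightarrow> complex" where
  "pcoeff r m = (deriv ^^ m) (eta_quot_prod r) 0 / fact m"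

lemma pcoeff_0: "0 \<notin> supp r \<Longrightarrow> pcoeff r 0 = 1"
  by (simp add: pcoeff_def eta_quot_prod_0)

lemma pcoeff_sums:
  assumes "0 \<notin> supp r" "norm q < 1"
  shows "(\<lambda>m. pcoeff r m * q ^ m) sums eta_quot_prod r q"
  using holomorphic_power_series[OF holomorphic_eta_quot_prod[OF assms(1)], of q] assms(2)
  by (simp add: pcoeff_def)

lemma pcoeff_abs_summable:
  assumes "0 \<notin> supp r" "0 \<le> R" "R < 1"
  shows "summable (\<lambda>m. norm (pcoeff r m) * R ^ m)"
proof -
  \<comment> \<open>Any radius strictly between R and 1 would do: convergence there gives absolute
    convergence at R.\<close>
  define S where "S = (1 + R) / 2"
  have "summable (\<lambda>m. pcoeff r m * complex_of_real S ^ m)"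
  proof (rule sums_summable[OF pcoeff_sums[OF assms(1)]])
    show "norm (complex_of_real S) < 1" unfolding norm_of_real using assms by (auto simp: S_def)
  qed
  then have "summable (\<lambda>m. norm (pcoeff r m * complex_of_real R ^ m))"
    by (rule powser_insidea) (use assms in \<open>auto simp: S_def simp del: of_real_add of_real_divide\<close>)
  then show ?thesis using assms by (simp add: norm_mult norm_power)
qed

section \<open>Fourier coefficients as mean values\<close>

lemma ee_add: "ee (x + y) = ee x * ee y"
  by (simp add: ee_def distrib_left exp_add)

lemma ee_of_int: "ee (of_int m) = 1"
  unfolding ee_def by (auto simp: exp_eq_1 intro: exI[of _ m])

lemma norm_ee [simp]: "norm (ee x) = 1"
  by (simp add: ee_def norm_exp_eq_Re)

lemma integral_ee:
  assumes "L > 0" "L * w \<in> \<int>"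
  shows "((\<lambda>t. ee (w * t)) has_integral (if w = 0 then of_real L else 0)) {0..L}"
proof (cases "w = 0")
  case True
  have "((\<lambda>t. 1::complex) has_integral Henstock_Kurzweil_Integration.content {0..L} *\<^sub>R 1) {0..L}"
    by (rule has_integral_const_real)
  then show ?thesis using True assms by (simp add: ee_def scaleR_conv_of_real)
next
  case False
  define F where "F t = ee (w * t) / (2 * pi * \<i> * w)" for t
  have "((\<lambda>t. ee (w * t)) has_integral F L - F 0) {0..L}"
  proof (rule fundamental_theorem_of_calculus)
    fix t assume "t \<in> {0..L}"
    have "((\<lambda>z. exp (2 * pi * \<i> * complex_of_real w * z) / (2 * pi * \<i> * w)) has_field_derivative
       exp (2 * pi * \<i> * complex_of_real w * complex_of_real t)) (at (complex_of_real t))"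
      using False by (auto intro!: derivative_eq_intros)
    from has_vector_derivative_real_field[OF this, of "{0..L}"]
    show "(F has_vector_derivative ee (w * t)) (at t within {0..L})"
      unfolding F_def ee_def by (simp add: mult_ac)
  qed (use assms in simp)
  moreover have "F L = F 0"
  proof -
    obtain m where m: "L * w = of_int m" using assms(2) by (auto elim: Ints_cases)
    then have "ee (w * L) = ee (w * 0)" using ee_of_int[of m] ee_of_int[of 0]
      by (simp add: mult.commute)
    then show ?thesis by (simp add: F_def)
  qed
  ultimately show ?thesis using False by simp
qed

text \<open>Absolute summability allows termwise integration. The frequencies need not be integers,
  but L times each of them is, so every term of nonzero frequency integrates to 0.\<close>

lemma integral_fourier_series:
  fixes c :: "nat \<Rightarrow> complex" and w :: "nat \<Rightarrow> real"
  assumes "L > 0" "\<And>m. L * w m \<in> \<int>" "summable (\<lambda>m. norm (c m))"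
    and "\<And>t. (\<lambda>m. c m * ee (w m * t)) sums g t"
  shows "(\<lambda>m. if w m = 0 then of_real L * c m else 0) sums integral {0..L} g"
proof -
  have ul: "uniform_limit {0..L} (\<lambda>n t. \<Sum>m<n. c m * ee (w m * t)) (\<lambda>t. \<Sum>m. c m * ee (w m * t)) sequentially"
    by (rule Weierstrass_m_test[OF _ assms(3)]) (simp add: norm_mult)
  have gs: "(\<Sum>m. c m * ee (w m * t)) = g t" for t using assms(4) by (simp add: sums_iff)
  have ul': "uniform_limit {0..L} (\<lambda>n t. \<Sum>m<n. c m * ee (w m * t)) g sequentially"
    using ul unfolding gs .
  have hi: "((\<lambda>t. \<Sum>m<n. c m * ee (w m * t)) has_integral (\<Sum>m<n. if w m = 0 then of_real L * c m else 0)) {0..L}" for n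
  proof (rule has_integral_sum)
    fix m assume "m \<in> {..<n}"
    have "((\<lambda>t. c m * ee (w m * t)) has_integral c m * (if w m = 0 then of_real L else 0)) {0..L}"
      by (intro has_integral_mult_right integral_ee assms)
    then show "((\<lambda>t. c m * ee (w m * t)) has_integral (if w m = 0 then of_real L * c m else 0)) {0..L}"
      by (simp add: mult.commute if_distrib cong: if_cong)
  qed simp
  have cont: "continuous_on {0..L} (\<lambda>t. \<Sum>m<n. c m * ee (w m * t))" for n
    unfolding ee_def by (intro continuous_intros)
  obtain I J where IJ: "\<And>n. ((\<lambda>t. \<Sum>m<n. c m * ee (w m * t)) has_integral I n) {0..L}"
      "(g has_integral J) {0..L}" "(I \<longlongrightarrow> J) sequentially"
    using uniform_limit_integral[OF ul' cont] by auto
  have "I n = (\<Sum>m<n. if w m = 0 then of_real L * c m else 0)" for n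
    using has_integral_unique[OF IJ(1) hi] .
  then have "(\<lambda>n. \<Sum>m<n. if w m = 0 then of_real L * c m else 0) \<longlonglongrightarrow> J"
    using IJ(3) by presburger
  moreover have "integral {0..L} g = J" using IJ(2) by (rule integral_unique)
  ultimately show ?thesis by (simp add: sums_def)
qed

text \<open>The mean value over a common period extracts coefficients of the (in general not
  1-periodic) function $f((a\tau+b)/d)$; \<open>\<rho>\<close> is $a/d$.\<close>
lemma eta_quot_mean:
  fixes \<rho> \<beta> n L :: real
  assumes "0 \<notin> supp r" "\<rho> > 0" "L > 0"
    and L: "\<And>m::nat. L * ((of_int (xN r) / 24 + real m) * \<rho> - n) \<in> \<int>"
  shows "integral {0..L} (\<lambda>t. eta_quot r (of_real \<rho> * (of_real t + \<i>) + of_real \<beta>)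
            * exp (- 2 * pi * \<i> * of_real n * (of_real t + \<i>)))
    = (if \<exists>m::nat. n / \<rho> = of_int (xN r) / 24 + real m
       then of_real L * (pcoeff r (THE m. n / \<rho> = of_int (xN r) / 24 + real m) * ee (n / \<rho> * \<beta>)) else 0)"
proof -
  define \<theta> where "\<theta> = real_of_int (xN r) / 24"
  define w where "w m = (\<theta> + real m) * \<rho> - n" for m :: nat
  \<comment> \<open>On the line of imaginary part 1 the m-th term carries the decay factor
    \<open>exp (- 2 * pi * w m)\<close> besides the phase contributed by \<beta>; at frequency 0
    this decay factor is 1.\<close>
  define c where "c m = pcoeff r m * (complex_of_real (exp (- 2 * pi * w m)) * ee ((\<theta> + real m) * \<beta>))" for m :: nat
  define g where "g t = eta_quot r (of_real \<rho> * (of_real t + \<i>) + of_real \<beta>)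
            * exp (- 2 * pi * \<i> * of_real n * (of_real t + \<i>))" for t :: real
  have sm: "summable (\<lambda>m. norm (c m))"
  proof -
    have "norm (c m) = exp (- 2 * pi * (\<theta> * \<rho> - n)) * (norm (pcoeff r m) * exp (- 2 * pi * \<rho>) ^ m)" for m
    proof -
      have e: "exp (- 2 * pi * w m) = exp (- 2 * pi * (\<theta> * \<rho> - n)) * exp (- 2 * pi * \<rho>) ^ m"
        by (simp add: w_def algebra_simps flip: exp_of_nat_mult exp_add)
      have "norm (c m) = norm (pcoeff r m) * exp (- 2 * pi * w m)"
        by (simp add: c_def norm_mult)
      then show ?thesis unfolding e by simp
    qed
    moreover have "summable (\<lambda>m. norm (pcoeff r m) * exp (- 2 * pi * \<rho>) ^ m)"
      using assms by (intro pcoeff_abs_summable) auto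
    ultimately show ?thesis by (simp add: summable_mult)
  qed
  have gs: "(\<lambda>m. c m * ee (w m * t)) sums g t" for t
  proof -
    define \<tau> where "\<tau> = of_real \<rho> * (of_real t + \<i>) + complex_of_real \<beta>"
    define E where "E = exp (2 * pi * \<i> * of_real \<theta> * \<tau>) * exp (- 2 * pi * \<i> * of_real n * (of_real t + \<i>))"
    have "Im \<tau> > 0" using assms by (simp add: \<tau>_def)
    then have "norm (exp (2 * pi * \<i> * \<tau>)) < 1" by (intro HH_norm_less_1) (simp add: HH_def)
    then have "(\<lambda>m. E * (pcoeff r m * exp (2 * pi * \<i> * \<tau>) ^ m)) sums (E * eta_quot_prod r (exp (2 * pi * \<i> * \<tau>)))"
      by (intro sums_mult pcoeff_sums assms)
    moreover have "E * eta_quot_prod r (exp (2 * pi * \<i> * \<tau>)) = g t"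
      unfolding g_def \<tau>_def[symmetric] eta_quot_eq E_def by (simp add: \<theta>_def)
    moreover have "E * (pcoeff r m * exp (2 * pi * \<i> * \<tau>) ^ m) = c m * ee (w m * t)" for m
    proof -
      have "E * exp (2 * pi * \<i> * \<tau>) ^ m = exp (2 * pi * \<i> * of_real (\<theta> + m) * \<tau> - 2 * pi * \<i> * of_real n * (of_real t + \<i>))"
        unfolding E_def by (simp add: algebra_simps flip: exp_of_nat_mult exp_add)
      also have "2 * pi * \<i> * of_real (\<theta> + m) * \<tau> - 2 * pi * \<i> * of_real n * (of_real t + \<i>)
         = complex_of_real (- 2 * pi * w m) + 2 * pi * \<i> * complex_of_real ((\<theta> + real m) * \<beta>)
           + 2 * pi * \<i> * complex_of_real (w m * t)"
        unfolding \<tau>_def w_def by (simp add: algebra_simps)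
      finally have X: "E * exp (2 * pi * \<i> * \<tau>) ^ m
         = exp (complex_of_real (- 2 * pi * w m) + 2 * pi * \<i> * complex_of_real ((\<theta> + real m) * \<beta>)
           + 2 * pi * \<i> * complex_of_real (w m * t))" .
      have "E * (pcoeff r m * exp (2 * pi * \<i> * \<tau>) ^ m) = pcoeff r m * (E * exp (2 * pi * \<i> * \<tau>) ^ m)"
        by (simp only: mult_ac)
      also have "\<dots> = c m * ee (w m * t)"
        unfolding X c_def ee_def exp_add exp_of_real by (simp only: mult_ac)
      finally show ?thesis .
    qed
    ultimately show ?thesis by simp
  qed
  have int: "L * w m \<in> \<int>" for m using L[of m] by (simp add: w_def \<theta>_def)
  have main: "(\<lambda>m. if w m = 0 then of_real L * c m else 0) sums integral {0..L} g"
    by (rule integral_fourier_series[OF assms(3) int sm gs])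
  have w0: "w m = 0 \<longleftrightarrow> n / \<rho> = \<theta> + real m" for m using assms(2) by (auto simp: w_def field_simps)
  show ?thesis
  proof (cases "\<exists>m::nat. n / \<rho> = \<theta> + real m")
    case True
    then obtain m0 where m0: "n / \<rho> = \<theta> + real m0" by blast
    have the: "(THE m. n / \<rho> = \<theta> + real m) = m0" using m0 by (intro the_equality) auto
    have "w m = 0 \<longleftrightarrow> m = m0" for m unfolding w0 using m0 by auto
    then have "(\<lambda>m. if m = m0 then of_real L * c m else 0) sums integral {0..L} g"
      using main by simp
    then have "integral {0..L} g = of_real L * c m0"
      using sums_single[of m0 "\<lambda>m. of_real L * c m"] sums_unique2 by blast
    also have "c m0 = pcoeff r m0 * ee (n / \<rho> * \<beta>)"
      using w0[of m0] m0 by (simp add: c_def)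
    finally show ?thesis using True the unfolding g_def \<theta>_def by simp
  next
    case False
    then have "w m \<noteq> 0" for m using w0 by blast
    then have "(\<lambda>m. 0) sums integral {0..L} g" using main by simp
    then have "integral {0..L} g = 0" using sums_zero sums_unique2 by blast
    then show ?thesis using False unfolding g_def \<theta>_def by simp
  qed
qed

text \<open>The defining integral is the mean value for \<rho> = L = 1 and \<beta> = 0. Besides
  computing the coefficients it shows that those with exponent below x_N/24 vanish.\<close>

lemma cf_eq:
  assumes "0 \<notin> supp r"
  shows "cf r x = (if \<exists>m::nat. x = of_int (xN r) / 24 + real m
                   then pcoeff r (THE m. x = of_int (xN r) / 24 + real m) else 0)"
proof (cases "\<exists>m::int. x = of_int (xN r) / 24 + of_int m")
  case True
  then obtain j :: int where j: "x = of_int (xN r) / 24 + of_int j" by blast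
  have "1 * ((of_int (xN r) / 24 + real m) * 1 - x) \<in> \<int>" for m
    by (simp add: j)
  from eta_quot_mean[OF assms, of 1 1 x 0, OF _ _ this] True
  show ?thesis by (simp add: cf_def ee_def mult_ac)
next
  case False
  then have "\<nexists>m::nat. x = of_int (xN r) / 24 + real m" by (metis of_int_of_nat_eq)
  then show ?thesis using False by (simp add: cf_def)
qed

lemma cf_xN: "0 \<notin> supp r \<Longrightarrow> cf r (of_int (xN r) / 24) = 1"
  by (subst cf_eq) (auto simp: pcoeff_0 intro: exI[of _ 0])

text \<open>Since \<open>cf\<close> vanishes off the exponents that occur, it absorbs the case
  distinction of the mean value.\<close>

lemma eta_quot_mean_cf:
  fixes \<rho> \<beta> n L :: real
  assumes "0 \<notin> supp r" "\<rho> > 0" "L > 0"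
    and L: "\<And>m::nat. L * ((of_int (xN r) / 24 + real m) * \<rho> - n) \<in> \<int>"
  shows "integral {0..L} (\<lambda>t. eta_quot r (of_real \<rho> * (of_real t + \<i>) + of_real \<beta>)
            * exp (- 2 * pi * \<i> * of_real n * (of_real t + \<i>)))
    = of_real L * (cf r (n / \<rho>) * ee (n / \<rho> * \<beta>))"
  by (subst eta_quot_mean[OF assms]) (auto simp: cf_eq[OF assms(1)])

section \<open>The character\<close>

lemma ee_0 [simp]: "ee 0 = 1"
  by (simp add: ee_def)

lemma ee_nonzero [simp]: "ee x \<noteq> 0"
  by (simp add: ee_def)

lemma ee_powi: "ee x powi n = ee (of_int n * x)"
  by (simp add: ee_def exp_powi_int mult_ac)

lemma ee_sum: "finite A \<Longrightarrow> ee (sum g A) = (\<Prod>i\<in>A. ee (g i))"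
  by (induction A rule: finite_induct) (auto simp: ee_add)

lemma ee_cong:
  assumes "[A = B] (mod m)" "m \<noteq> 0"
  shows "ee (of_int A / of_int m) = ee (of_int B / of_int m)"
proof -
  obtain k where k: "B = A + m * k" using assms(1) by (auto simp: cong_iff_lin)
  then have "of_int B / of_int m = (of_int A / of_int m + of_int k :: real)"
    using assms(2) by (simp add: field_simps)
  then show ?thesis by (simp add: ee_add ee_of_int)
qed

lemma ee_eq_1: "m dvd A \<Longrightarrow> m \<noteq> 0 \<Longrightarrow> ee (of_int A / of_int m) = 1"
  using ee_cong[of A 0 m] by (simp add: cong_0_iff)

lemma ee_half: "ee (1 / 2) = -1"
  by (simp add: ee_def)

text \<open>Partial fractions 1/24 = 3/8 - 1/3: a 24th root of unity splits into an 8th root and a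
  cube root, to which the congruences modulo 8 and 3 apply separately.\<close>

lemma ee_split_24: "ee (of_int P / 24) = ee (of_int (3 * P) / 8) * ee (of_int (- P) / 3)"
  unfolding ee_add[symmetric] by (simp add: field_simps)

text \<open>Petersson's formula for the multiplier of \<open>eta\<close>, split into its parts at 2 and at 3.\<close>
lemma ee_Psi:
  assumes "a * d - b * c = 1" "c > 0" "d > 0" "odd d"
  shows "ee (Psi a b c d / 24) = of_int (kronecker c d) * ee (of_int (d - 1) / 8)
     * ee (of_int (3 * d * (b - c)) / 8) * ee (- of_int ((a + d) * c - b * d * (c\<^sup>2 - 1)) / 3)"
proof -
  define J where "J = kronecker c d"
  obtain P :: int where P: "Psi a b c d = of_int P"
    "[d * P = b - c + d + 1 - 2 * J] (mod 8)"
    "[P = (a + d) * c - b * d * (c\<^sup>2 - 1)] (mod 3)"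
    using Psi_congruences[OF assms] unfolding J_def by blast
  have "coprime c d" using coprime_of_det[OF assms(1)] by (simp add: coprime_commute)
  then have J: "J = 1 \<or> J = -1" using kronecker_sign[OF assms(3)] by (auto simp: J_def)
  have 3: "ee (of_int (- P) / 3) = ee (- of_int ((a + d) * c - b * d * (c\<^sup>2 - 1)) / 3)"
    using ee_cong[OF cong_minus_minus_iff[THEN iffD2, OF P(3)]] by simp
  obtain i where i: "d = 2 * i + 1" using assms(4) by (auto elim: oddE)
  obtain u where u: "b - c + d + 1 - 2 * J = d * P + 8 * u" using P(2) by (auto simp: cong_iff_lin)
  obtain v where v: "1 = d\<^sup>2 + 8 * v" using odd_square_mod_8[OF assms(4)] by (auto simp: cong_iff_lin)
  \<comment> \<open>As d is its own inverse modulo 8, the value of d P determines P; u and v hold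
    the multiples of 8.\<close>
  have "3 * P = 3 * d * (b - c) + 3 * (1 + d - 2 * d * J) - 8 * (3 * v) - 8 * (3 * d * u) + 8 * 3 * v * P"
  proof -
    have "3 * P - (3 * d * (b - c) + 3 * (1 + d - 2 * d * J) - 8 * (3 * v) - 8 * (3 * d * u) + 8 * 3 * v * P)
      = 3 * (P - 1) * (1 - (d\<^sup>2 + 8 * v)) - 3 * d * (b - c + d + 1 - 2 * J - (d * P + 8 * u))"
      by (simp add: algebra_simps power2_eq_square)
    then show ?thesis using u v by simp
  qed
  then have c8: "[3 * P = 3 * d * (b - c) + 3 * (1 + d - 2 * d * J)] (mod 8)"
  proof -
    have "3 * P - (3 * d * (b - c) + 3 * (1 + d - 2 * d * J)) = 8 * (3 * v * P - 3 * v - 3 * d * u)"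
      using \<open>3 * P = _\<close> by (simp add: algebra_simps)
    then show ?thesis unfolding cong_iff_dvd_diff by (metis dvd_triv_left)
  qed
  have "ee (of_int (3 * P) / 8) = ee (of_int (3 * d * (b - c)) / 8) * ee (of_int (3 * (1 + d - 2 * d * J)) / 8)"
    using ee_cong[OF c8] by (simp add: ee_add[symmetric] add_divide_distrib)
  also have "ee (of_int (3 * (1 + d - 2 * d * J)) / 8) = of_int J * ee (of_int (d - 1) / 8)"
    using J
  proof
    assume J1: "J = 1"
    have "[3 * (1 + d - 2 * d * J) = d - 1] (mod 8)"
      unfolding J1 i cong_iff_dvd_diff by (simp add: algebra_simps)
    from ee_cong[OF this] show ?thesis by (simp add: J1)
  next
    assume J1: "J = -1"
    \<comment> \<open>The extra 4 is half a period, e(1/2) = -1, which is the symbol J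
      itself.\<close>
    have "[3 * (1 + d - 2 * d * J) = (d - 1) + 4] (mod 8)"
      unfolding J1 i cong_iff_dvd_diff by (simp add: algebra_simps)
    from ee_cong[OF this] have "ee (of_int (3 * (1 + d - 2 * d * J)) / 8) = ee (of_int (d - 1) / 8 + 1 / 2)"
      by (simp add: add_divide_distrib diff_divide_distrib)
    then show ?thesis by (simp add: J1 ee_add ee_half)
  qed
  finally show ?thesis unfolding P(1) ee_split_24 3 J_def by simp
qed

text \<open>An odd u is 1 or -1 modulo 4, and u v differs from v by 2 modulo 4 exactly when u is -1
  and v is odd. The product counts such n modulo 2. In this way the odd part of \<open>varpi\<close>
  modulo 4, and hence \<open>delta\<close>, enters the character.\<close>

lemma odd_sum_mod_4:
  assumes "finite A" "\<And>n. n \<in> A \<Longrightarrow> odd (u n)"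
  shows "[(\<Sum>n\<in>A. u n * v n)
        = (\<Sum>n\<in>A. v n) + 2 * (if (\<Prod>n\<in>A. u n ^ nat \<bar>v n\<bar>) mod 4 = 1 then 0 else 1)] (mod (4::int))"
  using assms
proof (induction A rule: finite_induct)
  case (insert m A)
  define P where "P = (\<Prod>n\<in>A. u n ^ nat \<bar>v n\<bar>)"
  define S where "S = (\<Sum>n\<in>A. v n)"
  define X where "X = (\<Sum>n\<in>A. u n * v n)"
  define U where "U = u m ^ nat \<bar>v m\<bar>"
  define \<sigma> where "\<sigma> x = (if x mod 4 = 1 then 0 else 1::int)" for x :: int
  have IH: "[X = S + 2 * \<sigma> P] (mod 4)"
    using insert unfolding P_def S_def X_def \<sigma>_def by simp
  have oP: "odd P" unfolding P_def using insert.hyps(1) insert.prems by (auto simp: even_prod_iff)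
  have ou: "odd (u m)" using insert.prems by simp
  have "[u m * v m = v m + 2 * (\<sigma> (U * P) - \<sigma> P)] (mod 4)"
  proof (cases "u m mod 4 = 1")
    case True
    then have u1: "[u m = 1] (mod 4)" by (simp add: cong_def)
    then have "[U = 1] (mod 4)" unfolding U_def using cong_pow by fastforce
    then have "[U * P = P] (mod 4)" by (metis cong_scalar_right mult_1)
    then have "\<sigma> (U * P) = \<sigma> P" by (simp add: \<sigma>_def cong_def)
    moreover have "[u m * v m = 1 * v m] (mod 4)" using u1 by (rule cong_scalar_right)
    ultimately show ?thesis by simp
  next
    case False
    then have "u m mod 4 = 3" using odd_mod_4[OF ou] by blast
    then have u1: "[u m = -1] (mod 4)" by (simp add: cong_def)
    then have U: "[U = (-1) ^ nat \<bar>v m\<bar>] (mod 4)" unfolding U_def by (rule cong_pow)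
    have uv: "[u m * v m = (-1) * v m] (mod 4)" using u1 by (rule cong_scalar_right)
    show ?thesis
    proof (cases "even (v m)")
      case True
      then have "[U = 1] (mod 4)" using U by (simp add: even_nat_iff)
      then have "[U * P = P] (mod 4)" by (metis cong_scalar_right mult_1)
      then have "\<sigma> (U * P) = \<sigma> P" by (simp add: \<sigma>_def cong_def)
      moreover have "[(-1) * v m = v m] (mod 4)" using True by (auto simp: cong_iff_dvd_diff elim!: evenE)
      ultimately show ?thesis using uv cong_trans by fastforce
    next
      case odd: False
      then have "[U = -1] (mod 4)" using U by (simp add: even_nat_iff)
      then have "[U * P = (-1) * P] (mod 4)" by (rule cong_scalar_right)
      then have UP: "U * P mod 4 = (- P) mod 4" by (simp add: cong_def)
      have "\<sigma> (U * P) = 1 - \<sigma> P" unfolding \<sigma>_def UP using oP by presburger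
      moreover have "[(-1) * v m = v m + 2 * (1 - 2 * \<sigma> P)] (mod 4)"
        using odd by (auto simp: \<sigma>_def cong_iff_dvd_diff elim!: oddE)
      ultimately show ?thesis using uv cong_trans by fastforce
    qed
  qed
  from cong_add[OF this IH] have "[u m * v m + X = v m + S + 2 * \<sigma> (U * P)] (mod 4)"
    by (simp add: algebra_simps)
  then show ?case using insert.hyps by (simp add: X_def S_def U_def P_def \<sigma>_def)
qed simp

text \<open>The second sum in the definition of \<open>mf\<close>: it is 24 times the order of f at
  the cusp 0, as \<open>xN\<close> is at infinity.\<close>

definition yN :: "(nat \<Rightarrow> int) \<Rightarrow> int" where
  "yN r = (\<Sum>n\<in>supp r. int (level r div n) * r n)"

locale eta_exponents =
  fixes r :: "nat \<Rightarrow> int"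
  assumes fin: "finite (supp r)" and zero_notin: "0 \<notin> supp r"
begin

abbreviation "N \<equiv> level r"

lemma N_pos: "N > 0"
  using fin zero_notin by (auto simp: level_def Lcm_0_iff intro!: gr0I)

lemma supp_dvd: "n \<in> supp r \<Longrightarrow> n dvd N"
  by (simp add: level_def dvd_Lcm)

lemma supp_pos: "n \<in> supp r \<Longrightarrow> n > 0"
  using zero_notin by (cases n) auto

lemma N_div_mult: "n \<in> supp r \<Longrightarrow> int n * int (N div n) = int N"
  using supp_dvd by (metis dvd_mult_div_cancel of_nat_mult)

lemma N_div_pos: "n \<in> supp r \<Longrightarrow> int (N div n) > 0"
  using supp_dvd[of n] N_pos supp_pos[of n] by (simp add: div_greater_zero_iff dvd_imp_le)

text \<open>Petersson's formula for the matrices (p, q n; (N/n) s', t) is multiplied over n with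
  exponents r_n. The exponents that arise are combinations of 1, n and N/n, so the sums collapse to
  \<open>wt2\<close>, \<open>xN\<close> and \<open>yN\<close>.\<close>

lemma chi_eq:
  assumes "p * t - q * s = 1" "s = int N * s'" "s' > 0" "t > 0" "odd t"
  shows "chi r p q s t 1 = (\<Prod>n\<in>supp r. of_int (kronecker (int (N div n) * s') t) powi r n)
     * ee (of_int (wt2 r * (t - 1)) / 8) * ee (of_int (3 * t * (q * xN r - s' * yN r)) / 8)
     * ee (- of_int ((p + t) * s' * yN r - q * t * s * s' * yN r + q * t * xN r) / 3)"
proof -
  define c where "c n = int (N div n) * s'" for n
  have sc: "s div int n = c n" "s = int n * c n" "c n > 0" if "n \<in> supp r" for n
  proof -
    show *: "s = int n * c n" using N_div_mult[OF that] assms(2) by (simp add: c_def mult.assoc[symmetric])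
    show "s div int n = c n" using supp_pos[OF that] by (simp add: *)
    show "c n > 0" using N_div_pos[OF that] assms(3) by (simp add: c_def)
  qed
  define E where "E n = real_of_int (t - 1) / 8 + of_int (3 * t * (q * int n - c n)) / 8
     + (- of_int ((p + t) * c n - q * int n * t * ((c n)\<^sup>2 - 1)) / 3)" for n
  have one: "ee (of_int (r n) * Psi p (q * int n) (c n) t / 24)
     = of_int (kronecker (c n) t) powi r n * ee (of_int (r n) * E n)" if n: "n \<in> supp r" for n
  proof -
    have "p * t - q * int n * c n = 1" using assms(1) sc(2)[OF n] by (simp add: mult.assoc)
    from ee_Psi[OF this sc(3)[OF n] assms(4,5)]
    have "ee (Psi p (q * int n) (c n) t / 24) = of_int (kronecker (c n) t) * ee (E n)"
      unfolding E_def ee_add by (simp only: mult.assoc)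
    then have "ee (Psi p (q * int n) (c n) t / 24) powi r n
       = of_int (kronecker (c n) t) powi r n * ee (E n) powi r n"
      by (simp add: power_int_mult_distrib)
    then show ?thesis by (simp add: ee_powi)
  qed
  have "chi r p q s t 1 = ee (\<Sum>n\<in>supp r. of_int (r n) * Psi p (q * int n) (c n) t / 24)"
    unfolding chi_def by (simp add: sc(1) sum_distrib_left mult_ac cong: sum.cong)
  also have "\<dots> = (\<Prod>n\<in>supp r. of_int (kronecker (c n) t) powi r n) * ee (\<Sum>n\<in>supp r. of_int (r n) * E n)"
    by (simp add: ee_sum[OF fin] prod.distrib one cong: prod.cong)
  also have "(\<Sum>n\<in>supp r. of_int (r n) * E n)
    = of_int (wt2 r * (t - 1)) / 8 + of_int (3 * t * (q * xN r - s' * yN r)) / 8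
     + (- of_int ((p + t) * s' * yN r - q * t * s * s' * yN r + q * t * xN r) / 3)"
  proof -
    have E: "of_int (r n) * E n = real_of_int (r n) * ((of_int t - 1) / 8)
       + of_int (int n * r n) * (3 * of_int t * of_int q / 8 - of_int q * of_int t / 3)
       + of_int (int (N div n) * r n) * (- 3 * of_int t * of_int s' / 8 - (of_int p + of_int t) * of_int s' / 3
           + of_int q * of_int t * of_int s * of_int s' / 3)" if n: "n \<in> supp r" for n
    proof -
      \<comment> \<open>This makes the quadratic term linear in N/n, as \<open>s\<close> does not
        depend on n.\<close>
      have "int n * (c n)\<^sup>2 = s * c n" using sc(2)[OF n] by (simp add: power2_eq_square)
      then have "q * int n * t * ((c n)\<^sup>2 - 1) = q * t * s * c n - q * t * int n"
        by (metis (no_types, opaque_lifting) mult.assoc mult.commute mult.right_neutral right_diff_distrib)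
      then have rn: "real_of_int (q * int n * t * ((c n)\<^sup>2 - 1))
         = of_int q * of_int t * of_int s * of_int (c n) - of_int q * of_int t * real n"
        by (metis of_int_diff of_int_mult of_int_of_nat_eq)
      have En: "E n = (of_int t - 1) / 8 + 3 * of_int t * (of_int q * real n - of_int (c n)) / 8
        - ((of_int p + of_int t) * of_int (c n) - (of_int q * of_int t * of_int s * of_int (c n) - of_int q * of_int t * real n)) / 3"
        unfolding E_def of_int_diff[of "(p + t) * c n"] rn by (simp add: field_simps)
      show ?thesis unfolding En by (simp add: c_def field_simps)
    qed
    have "(\<Sum>n\<in>supp r. of_int (r n) * E n) = real_of_int (wt2 r) * ((of_int t - 1) / 8)
       + of_int (xN r) * (3 * of_int t * of_int q / 8 - of_int q * of_int t / 3)
       + of_int (yN r) * (- 3 * of_int t * of_int s' / 8 - (of_int p + of_int t) * of_int s' / 3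
           + of_int q * of_int t * of_int s * of_int s' / 3)"
      unfolding wt2_def xN_def yN_def of_int_sum sum_distrib_right sum.distrib[symmetric]
      by (intro sum.cong refl E)
    then show ?thesis by (simp add: field_simps)
  qed
  finally show ?thesis unfolding ee_add c_def by (simp only: mult.assoc)
qed

section \<open>The 2-part and the odd part of \<open>varpi\<close>\<close>

definition odd_part :: "nat \<Rightarrow> int" where
  "odd_part n = int (N div n) div 2 ^ multiplicity 2 (int (N div n))"

lemma odd_part:
  assumes "n \<in> supp r"
  shows "int (N div n) = 2 ^ multiplicity 2 (int (N div n)) * odd_part n" "odd (odd_part n)" "odd_part n > 0"
    "odd_part n dvd int N"
proof -
  show 1: "int (N div n) = 2 ^ multiplicity 2 (int (N div n)) * odd_part n"
    unfolding odd_part_def by (simp add: multiplicity_dvd)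
  show "odd (odd_part n)"
    unfolding odd_part_def using N_div_pos[OF assms] by (intro multiplicity_decompose) auto
  have "2 ^ multiplicity 2 (int (N div n)) * odd_part n > 0" using N_div_pos[OF assms] 1 by linarith
  then show "odd_part n > 0" by (simp add: zero_less_mult_iff)
  have "odd_part n dvd int (N div n)" by (subst 1) simp
  then show "odd_part n dvd int N" using N_div_mult[OF assms] by (metis dvd_mult)
qed

text \<open>Together with \<open>E2\<close> this splits \<open>varpi\<close> into odd part and power
  of 2, factor by factor, so that congruences valid for each n carry over.\<close>

definition W where "W = (\<Prod>n\<in>supp r. odd_part n ^ nat \<bar>r n\<bar>)"
definition E2 where "E2 = (\<Sum>n\<in>supp r. multiplicity 2 (int (N div n)) * nat \<bar>r n\<bar>)"

lemma varpi_eq: "varpi r = 2 ^ E2 * W"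
proof -
  have "varpi r = (\<Prod>n\<in>supp r. (2 ^ multiplicity 2 (int (N div n)) * odd_part n) ^ nat \<bar>r n\<bar>)"
    unfolding varpi_def using odd_part(1) by (intro prod.cong) auto
  also have "\<dots> = (\<Prod>n\<in>supp r. 2 ^ (multiplicity 2 (int (N div n)) * nat \<bar>r n\<bar>)) * W"
    by (simp add: power_mult_distrib prod.distrib W_def power_mult)
  finally show ?thesis by (simp add: E2_def power_sum)
qed

lemma odd_W: "odd W" and W_pos: "W > 0"
proof -
  show "odd W" unfolding W_def using fin odd_part(2) by (auto simp: even_prod_iff)
  show "W > 0" unfolding W_def using odd_part(3) by (intro prod_pos) auto
qed

lemma multiplicity_varpi: "multiplicity 2 (varpi r) = E2"
  using multiplicity_decomposeI[OF varpi_eq] odd_W by simp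

lemma delta_eq: "delta r = (if W mod 4 = 1 then 0 else 1)"
  unfolding delta_def multiplicity_varpi by (simp add: varpi_eq)

text \<open>Twice k + \<delta>, the quantity that governs \<open>psi\<close>; doubling makes it an
  integer with meaningful residues modulo 4 and 8.\<close>

definition KK :: int where "KK = wt2 r + 2 * (if W mod 4 = 1 then 0 else 1)"

lemma KK_eq: "wt r + delta r = of_int KK / 2"
  by (simp add: wt_def delta_eq KK_def)

text \<open>When N is odd or twice an odd number, \<open>xN\<close> and \<open>yN\<close> can be
  compared with this sum of odd parts; the congruence then turns their divisibility into
  divisibility of \<open>KK\<close>.\<close>

lemma sum_odd_part_mod_4: "[(\<Sum>n\<in>supp r. odd_part n * r n) = KK] (mod 4)"
  using odd_sum_mod_4[OF fin, of odd_part r] odd_part(2)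
  unfolding KK_def wt2_def W_def by blast

text \<open>W need not divide N, but each of its factors \<open>odd_part n\<close> does, and the
  symbol over each of them is periodic.\<close>

lemma kronecker_W:
  assumes "[m = 1] (mod int N)"
  shows "kronecker m W = 1"
proof -
  have "kronecker m (odd_part n ^ nat \<bar>r n\<bar>) = 1" if "n \<in> supp r" for n
  proof -
    have "kronecker m (odd_part n) = kronecker 1 (odd_part n)"
      using odd_part[OF that] assms cong_dvd_modulus by (intro kronecker_cong) auto
    then show ?thesis using odd_part[OF that] by (simp add: kronecker_power_right kronecker_1_left)
  qed
  then show ?thesis unfolding W_def using odd_part(3) by (subst kronecker_prod_right) auto
qed

text \<open>The 2-part needs \<open>a t \<equiv> 1\<close> modulo 8; the odd part only uses \<open>a t \<equiv> 1\<close> modulo \<open>N\<close> and reciprocity.\<close>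
lemma kronecker_varpi:
  assumes "t > 0" "odd t" "[a * t = 1] (mod int N)" "odd a \<Longrightarrow> [a * t = 1] (mod 8)"
  shows "kronecker a (varpi r) * kronecker (varpi r) t = qr_sign W t"
proof -
  have "coprime (a * t) (int N)" using assms(3) by (metis cong_imp_coprime cong_sym coprime_1_left)
  then have co: "coprime a (int N)" "coprime t (int N)" by simp_all
  have two: "kronecker a 2 ^ E2 * kronecker 2 t ^ E2 = 1"
  proof (cases "E2 = 0")
    case False
    \<comment> \<open>A factor 2 in \<open>varpi\<close> makes N even, so a, being prime to N, is
      odd and the congruence modulo 8 becomes available.\<close>
    then obtain n where n: "n \<in> supp r" "multiplicity 2 (int (N div n)) > 0"
      unfolding E2_def by (metis (mono_tags, lifting) gr0I mult_is_0 sum.neutral)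
    then have "even (int (N div n))" by (metis not_dvd_imp_multiplicity_0 less_irrefl)
    then have "even (int N)" using N_div_mult[OF n(1)] by (metis dvd_mult)
    then have "odd a" using co(1) by (metis coprime_common_divisor odd_one)
    then have 8: "[a * t = 1] (mod 8)" by (rule assms(4))
    have "kronecker a 2 = kron2 a" using kronecker_prime[of 2 a] by (simp add: kron_prime_def)
    moreover have "kronecker 2 t = kron2 t" using assms by (intro kronecker_two)
    moreover have "kron2 a * kron2 t = 1"
    proof -
      have "kron2 (a * t) = 1" using 8 \<open>odd a\<close> assms(2) unfolding kron2_def cong_def by simp
      then show ?thesis by (simp add: kron2_mult)
    qed
    ultimately show ?thesis by (metis power_mult_distrib power_one)
  qed simp
  have "kronecker a (varpi r) = kronecker a 2 ^ E2 * kronecker a W"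
    using W_pos by (simp add: varpi_eq kronecker_mult_right kronecker_power_right)
  moreover have "kronecker (varpi r) t = kronecker 2 t ^ E2 * (qr_sign W t * kronecker t W)"
    using assms(1) kronecker_reciprocity[OF W_pos odd_W assms(1,2)]
    by (simp add: varpi_eq kronecker_mult_left kronecker_power_left)
  moreover have "kronecker a W * kronecker t W = 1"
    using kronecker_W[OF assms(3)] W_pos by (simp add: kronecker_mult_left)
  moreover have "kronecker a 2 ^ E2 * kronecker a W * (kronecker 2 t ^ E2 * (qr_sign W t * kronecker t W))
     = (kronecker a 2 ^ E2 * kronecker 2 t ^ E2) * (kronecker a W * kronecker t W) * qr_sign W t"
    by (simp only: mult_ac)
  ultimately show ?thesis using two by simp
qed

text \<open>\<open>delta\<close> is 1 exactly for W = 3 modulo 4, when the reciprocity sign becomes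
  the nontrivial character of t modulo 4.\<close>

lemma qr_sign_W:
  assumes "odd t"
  shows "of_int (qr_sign W t) = ee (delta r * (of_int t - 1) / 4)"
proof (cases "W mod 4 = 1")
  case True
  then show ?thesis by (simp add: qr_sign_def delta_eq)
next
  case False
  then have W3: "W mod 4 = 3" using odd_mod_4[OF odd_W] by blast
  show ?thesis
  proof (cases "t mod 4 = 1")
    case True
    then have "4 dvd t - 1" by presburger
    from ee_eq_1[OF this] show ?thesis using True W3 by (simp add: qr_sign_def delta_eq)
  next
    case False
    then have t3: "t mod 4 = 3" using odd_mod_4[OF assms] by blast
    then have "[t - 1 = 2] (mod 4)" by (simp add: cong_def mod_diff_left_eq[symmetric])
    from ee_cong[OF this] show ?thesis using t3 W3 ee_half by (simp add: qr_sign_def delta_eq)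
  qed
qed

text \<open>The symbols of the N/n are signs, so the exponents r_n and |r_n| have the same effect;
  this is how \<open>varpi\<close> with its absolute values arises. The factor s' is common to all n
  and collects the exponent 2k.\<close>

lemma prod_kronecker:
  assumes "t > 0" "coprime t (int N * s')"
  shows "(\<Prod>n\<in>supp r. (of_int (kronecker (int (N div n) * s') t) :: complex) powi r n)
    = of_int (kronecker (varpi r) t) * of_int (kronecker s' t) powi wt2 r"
proof -
  have co: "coprime t s'" "coprime t (int N)" using assms(2) by auto
  have ab: "z powi v = z ^ nat \<bar>v\<bar>" if "z = 1 \<or> z = -1" for z :: complex and v :: int
    using that by (cases "v \<ge> 0") (auto simp: power_int_def)
  have n: "(of_int (kronecker (int (N div n) * s') t) :: complex) powi r n
      = of_int (kronecker (int (N div n) ^ nat \<bar>r n\<bar>) t) * of_int (kronecker s' t) powi r n"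
    if "n \<in> supp r" for n
  proof -
    have "int (N div n) dvd int N" using N_div_mult[OF that] by (metis dvd_triv_right)
    then have "coprime (int (N div n)) t" using co(2) by (meson coprime_commute coprime_divisors dvd_refl)
    then have "kronecker (int (N div n)) t \<in> {-1, 1}" using assms(1) by (intro kronecker_sign)
    then have "(of_int (kronecker (int (N div n)) t) :: complex) powi r n
        = of_int (kronecker (int (N div n)) t) ^ nat \<bar>r n\<bar>" by (intro ab) auto
    then show ?thesis using assms(1)
      by (simp add: kronecker_mult_left power_int_mult_distrib kronecker_power_left)
  qed
  have s: "of_int (kronecker s' t) \<noteq> (0::complex)"
    using kronecker_sign[OF assms(1), of s'] co(1) by (auto simp: coprime_commute)
  have pw: "(\<Prod>n\<in>A. z powi r n) = z powi (\<Sum>n\<in>A. r n)" if "z \<noteq> 0" for z :: complex and A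
    using that by (induction A rule: infinite_finite_induct) (auto simp: power_int_add)
  show ?thesis
    unfolding wt2_def varpi_def pw[OF s, symmetric] kronecker_prod_left[OF assms(1)] of_int_prod
      prod.distrib[symmetric]
    by (intro prod.cong refl n)
qed

end

section \<open>The weights of the Hecke sum\<close>

lemma ee_eqI:
  assumes "x - y = of_int k"
  shows "ee x = ee y"
proof -
  have "ee x = ee (y + of_int k)" using assms by (simp add: algebra_simps)
  then show ?thesis by (simp add: ee_add ee_of_int)
qed

lemma dvd_24I: "8 dvd x \<Longrightarrow> 3 dvd x \<Longrightarrow> 24 dvd (x::int)"
  by presburger

lemma odd_coprime_8: "odd (x::int) \<Longrightarrow> coprime 8 x"
proof -
  assume "odd x"
  then have "coprime (2 ^ 3) x" by (subst coprime_power_left_iff) simp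
  then show ?thesis by simp
qed

lemma parity_sum_2:
  "x + y = (2::nat) \<Longrightarrow> (x = 0 \<longleftrightarrow> odd n) \<Longrightarrow> (y = 0 \<longleftrightarrow> odd j) \<Longrightarrow> even y \<longleftrightarrow> odd (n + j :: nat)"
  by presburger

text \<open>The congruence l = 1 modulo \<open>mf r\<close> is equivalent to the two divisibilities
  by 24, and these are the form in which it acts on the character.\<close>

locale eta_hecke = eta_exponents +
  fixes l :: nat
  assumes l_pos: "l > 0"
    and lx: "24 dvd (int l - 1) * xN r" and ly: "24 dvd (int l - 1) * yN r"
    and l_square: "odd (wt2 r) \<Longrightarrow> \<exists>s. l = s\<^sup>2"
begin

lemma lxy8: "8 dvd (int l - 1) * xN r" "8 dvd (int l - 1) * yN r"
  using lx ly by (auto intro: dvd_trans[of _ 24])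

lemma lxy3: "3 dvd (int l - 1) * xN r" "3 dvd (int l - 1) * yN r"
  using lx ly by (auto intro: dvd_trans[of _ 24])

text \<open>For even l the factor l - 1 is invertible modulo 8, so the condition falls on
  \<open>xN\<close> and \<open>yN\<close>. This makes up for divisors of l whose squares are not 1
  modulo 8.\<close>

lemma even_l:
  assumes "even l"
  shows "8 dvd xN r" "8 dvd yN r"
proof -
  have "odd (int l - 1)" using assms by simp
  then have co: "coprime 8 (int l - 1)" by (rule odd_coprime_8)
  show "8 dvd xN r" "8 dvd yN r" using lxy8 co by (simp_all add: coprime_dvd_mult_right_iff)
qed

lemma three_dvd_l:
  assumes "3 dvd l"
  shows "3 dvd xN r" "3 dvd yN r"
proof -
  have "prime (3::int)" by simp
  moreover have "\<not> 3 dvd int l - 1" using assms by presburger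
  ultimately show "3 dvd xN r" "3 dvd yN r" using lxy3 by (auto simp: prime_dvd_mult_iff)
qed

text \<open>A number prime to 6 has square 1 modulo 24. If 2 or 3 divides l, then \<open>xN\<close>
  itself supplies the factor 8 or 3.\<close>

lemma square_divisor:
  assumes "int a * int d = int l"
  shows "24 dvd ((int d)\<^sup>2 - 1) * xN r"
proof (rule dvd_24I)
  show "8 dvd ((int d)\<^sup>2 - 1) * xN r"
  proof (cases "even l")
    case True
    then show ?thesis using even_l by simp
  next
    case False
    then have "odd (int d)" using assms by (metis even_mult_iff even_of_nat)
    then show ?thesis using odd_square_mod_8 by (simp add: cong_iff_dvd_diff)
  qed
  show "3 dvd ((int d)\<^sup>2 - 1) * xN r"
  proof (cases "3 dvd l")
    case True
    then show ?thesis using three_dvd_l by simp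
  next
    case False
    then have "\<not> 3 dvd int d" using assms by (metis dvd_mult int_dvd_int_iff of_nat_numeral)
    then show ?thesis using not_dvd_3_square by (simp add: cong_iff_dvd_diff)
  qed
qed

text \<open>For odd N the odd parts are the N/n themselves, so \<open>KK\<close> agrees with
  \<open>yN\<close> modulo 4, and even l makes \<open>yN\<close> divisible by 8.\<close>

lemma KK_odd_N:
  assumes "even l" "odd N"
  shows "4 dvd KK"
proof -
  have "odd_part n = int (N div n)" if "n \<in> supp r" for n
  proof -
    have "odd (int (N div n))" using N_div_mult[OF that] assms(2) by (metis even_mult_iff even_of_nat)
    then show ?thesis by (simp add: odd_part_def not_dvd_imp_multiplicity_0)
  qed
  then have "(\<Sum>n\<in>supp r. odd_part n * r n) = yN r" unfolding yN_def by (intro sum.cong) auto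
  then have "[yN r = KK] (mod 4)" using sum_odd_part_mod_4 by simp
  moreover have "4 dvd yN r" using even_l(2)[OF assms(1)] by (auto intro: dvd_trans[of _ 8])
  ultimately show ?thesis by (metis cong_dvd_iff)
qed

text \<open>For N = 2 N' with N' odd, \<open>N' * n + N div n\<close> is 3 times the odd part of N/n
  modulo 8, whatever the parity of n. Hence N' x_N + y_N controls the sum of odd parts and with it
  \<open>KK\<close>.\<close>

lemma KK_N_2_mod_4:
  assumes "even l" "even N" "\<not> 4 dvd N"
  shows "4 dvd KK"
proof -
  obtain N' where N': "N = 2 * N'" using assms(2) by auto
  have oN': "odd N'" using assms(3) N' by auto
  have one: "[int N' * int n + int (N div n) = 3 * odd_part n] (mod 8)" if n: "n \<in> supp r" for n
  proof (cases "odd n")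
    case True
    define j where "j = int (N div n)"
    have nj: "int n * j = 2 * int N'" using N_div_mult[OF n] N' by (simp add: j_def)
    then have "even j" using True by (metis dvd_triv_left even_mult_iff even_of_nat)
    then obtain i where i: "j = 2 * i" by blast
    have ni: "int n * i = int N'" using nj i by simp
    then have oi: "odd i" using oN' by (metis even_mult_iff even_of_nat)
    have "multiplicity 2 j = 1" using i oi by (intro multiplicity_decomposeI[of _ _ _ i]) auto
    then have u: "odd_part n = i" by (simp add: odd_part_def j_def[symmetric] i)
    have "[(int n)\<^sup>2 * i + 2 * i = 1 * i + 2 * i] (mod 8)"
      using True odd_square_mod_8[of "int n"] by (intro cong_add cong_mult cong_refl) auto
    then show ?thesis unfolding u j_def[symmetric] i ni[symmetric]
      by (simp add: power2_eq_square algebra_simps)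
  next
    case False
    then obtain n' where n': "n = 2 * n'" by auto
    define j where "j = int (N div n)"
    have nj: "int n' * j = int N'" using N_div_mult[OF n] N' n' by (simp add: j_def)
    then have oj: "odd j" using oN' by (metis even_mult_iff even_of_nat)
    then have u: "odd_part n = j" by (simp add: odd_part_def j_def[symmetric] not_dvd_imp_multiplicity_0)
    have "odd (int n')" using nj oN' by (metis even_mult_iff even_of_nat)
    then have "[2 * (int n')\<^sup>2 * j + j = 2 * 1 * j + j] (mod 8)"
      using odd_square_mod_8[of "int n'"] by (intro cong_add cong_mult cong_refl) auto
    moreover have "int n = 2 * int n'" using n' by simp
    ultimately show ?thesis unfolding u j_def[symmetric] nj[symmetric]
      by (simp add: power2_eq_square algebra_simps)
  qed
  have "[(\<Sum>n\<in>supp r. (int N' * int n + int (N div n)) * r n) = (\<Sum>n\<in>supp r. 3 * odd_part n * r n)] (mod 8)"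
    by (intro cong_sum cong_scalar_right one)
  then have "[int N' * xN r + yN r = 3 * (\<Sum>n\<in>supp r. odd_part n * r n)] (mod 8)"
    by (simp add: xN_def yN_def sum.distrib sum_distrib_left algebra_simps)
  moreover have "8 dvd int N' * xN r + yN r" using even_l[OF assms(1)] by simp
  ultimately have "8 dvd 3 * (\<Sum>n\<in>supp r. odd_part n * r n)" by (metis cong_dvd_iff)
  then have "4 dvd (\<Sum>n\<in>supp r. odd_part n * r n)" by presburger
  then show ?thesis using sum_odd_part_mod_4 by (metis cong_dvd_iff)
qed

text \<open>If 4 divides N exactly, the 2-adic valuation of N/n is even just when exactly one of n
  and N/n is odd. Summation gives E2 = 2k + x_N + y_N modulo 2, and the last two are even.\<close>

lemma odd_E2:
  assumes "even l" "4 dvd N" "\<not> 8 dvd N" "odd (wt2 r)"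
  shows "odd E2"
proof -
  have m2: "multiplicity 2 (int N) = 2"
  proof -
    obtain i where i: "N = 4 * i" using assms(2) by auto
    then have "odd i" using assms(3) by auto
    then show ?thesis using i by (intro multiplicity_decomposeI[of _ _ _ "int i"]) auto
  qed
  have one: "[int (multiplicity 2 (int (N div n)) * nat \<bar>r n\<bar>)
       = r n + int n * r n + int (N div n) * r n] (mod 2)" if n: "n \<in> supp r" for n
  proof -
    have pos: "int n \<noteq> 0" "int (N div n) \<noteq> 0" using supp_pos[OF n] N_div_pos[OF n] by auto
    have "multiplicity 2 (int n) + multiplicity 2 (int (N div n)) = 2"
      using pos by (simp add: m2[unfolded N_div_mult[OF n, symmetric]] flip: prime_elem_multiplicity_mult_distrib)
    moreover have "multiplicity 2 (int n) = 0 \<longleftrightarrow> odd n" "multiplicity 2 (int (N div n)) = 0 \<longleftrightarrow> odd (N div n)"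
      using pos by (auto simp: multiplicity_eq_zero_iff)
    ultimately have "even (multiplicity 2 (int (N div n))) \<longleftrightarrow> odd (n + N div n)"
      by (rule parity_sum_2)
    moreover have "even (nat \<bar>r n\<bar>) \<longleftrightarrow> even (r n)" by (simp add: even_nat_iff)
    ultimately show ?thesis by (auto simp: cong_iff_dvd_diff)
  qed
  have "[int E2 = (\<Sum>n\<in>supp r. r n + int n * r n + int (N div n) * r n)] (mod 2)"
    unfolding E2_def of_nat_sum by (intro cong_sum one)
  also have "(\<Sum>n\<in>supp r. r n + int n * r n + int (N div n) * r n) = wt2 r + xN r + yN r"
    by (simp add: wt2_def xN_def yN_def sum.distrib)
  finally have "[int E2 = wt2 r + xN r + yN r] (mod 2)" .
  moreover have "even (xN r)" "even (yN r)" using even_l[OF assms(1)] by (auto intro: dvd_trans[of _ 8])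
  ultimately have "odd (int E2)" using assms(4) by (metis cong_dvd_iff even_add)
  then show ?thesis by simp
qed

text \<open>Consequently the factor of \<open>psi\<close> that depends on b is 1 for even l and N.
  Only when 4 divides N exactly and 2k is odd is the power of 2 in \<open>KK * N\<close> too small;
  there \<open>delta1\<close> is 1 and supplies the missing factor.\<close>

lemma KK_even_N:
  assumes "even l" "even N"
  shows "\<exists>k. of_int KK * real N * (1 + delta1 r l) = 8 * of_int k"
proof -
  define D :: int where "D = (if even l \<and> 4 dvd N \<and> odd (wt2 r) \<and> odd E2 then 1 else 0)"
  have D: "delta1 r l = of_int D" by (simp add: delta1_def multiplicity_varpi D_def)
  have "8 dvd KK * int N * (1 + D)"
  proof (cases "4 dvd N")
    case False
    then obtain i where i: "KK = 4 * i" using KK_N_2_mod_4[OF assms] by blast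
    obtain j where j: "N = 2 * j" using assms(2) by blast
    show ?thesis by (simp add: i j)
  next
    case True
    then obtain j where j: "N = 4 * j" by blast
    have par: "even KK \<longleftrightarrow> even (wt2 r)" by (simp add: KK_def)
    show ?thesis
    proof (cases "even (wt2 r)")
      case True
      then obtain i where "KK = 2 * i" using par by blast
      then show ?thesis by (simp add: j)
    next
      case odd: False
      show ?thesis
      proof (cases "8 dvd N")
        case True
        then have "8 dvd int N" by presburger
        then show ?thesis by simp
      next
        case False
        then have "D = 1" using odd_E2[OF assms(1) True False odd] assms(1) True odd by (simp add: D_def)
        then show ?thesis by (simp add: j)
      qed
    qed
  qed
  then obtain k where "KK * int N * (1 + D) = 8 * k" by blast
  then have "real_of_int (KK * int N * (1 + D)) = of_int (8 * k)" by simp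
  then show ?thesis unfolding D by auto
qed

text \<open>For odd l the exponents differ by KK (a - 1) (d + 1) / 8. This is an integer: for even
  \<open>KK\<close> all three factors are even, and for odd \<open>KK\<close> the number l is an odd
  square, so a d = 1 modulo 8.\<close>

lemma psi_odd:
  assumes "odd a" "a dvd l" "coprime a N"
  shows "psi r l 1 0 = psi r l a b * ee (of_int (KK * (int a - 1)) / 8)"
proof -
  define d where "d = l div a"
  have ad: "a * d = l" using assms(2) by (simp add: d_def)
  have rad: "real l = real a * real d" using ad by (metis of_nat_mult)
  show ?thesis
  proof (cases "odd l")
    case True
    have "8 dvd KK * ((int a - 1) * (int d + 1))"
    proof (cases "even KK")
      case ev: True
      have "odd d" using True ad by auto
      then obtain i j k where "KK = 2 * i" "int a - 1 = 2 * j" "int d + 1 = 2 * k"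
        using ev assms(1) by (metis dvdE even_diff odd_one even_of_nat even_plus_one_iff)
      then show ?thesis by simp
    next
      case False
      then have "odd (wt2 r)" by (simp add: KK_def)
      then obtain s where s: "l = s\<^sup>2" using l_square by blast
      have "odd (int s)" using True s by simp
      then have l8: "[int l = 1] (mod 8)" using odd_square_mod_8 s by simp
      have "[(int a)\<^sup>2 = 1] (mod 8)" using odd_square_mod_8 assms(1) by simp
      then obtain u where u: "(int a)\<^sup>2 = 1 + 8 * u" by (metis cong_iff_lin cong_sym)
      obtain v where v: "int a * int d = 1 + 8 * v" using l8 ad by (metis cong_iff_lin cong_sym of_nat_mult)
      \<comment> \<open>Multiplication by the odd a makes the product accessible, since a d and the
        square of a are both 1 modulo 8.\<close>
      have "int a * ((int a - 1) * (int d + 1)) = (int a - 1) * (int a * int d) + (int a)\<^sup>2 - int a"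
        by (simp add: algebra_simps power2_eq_square)
      also have "\<dots> = 8 * (int a * v - v + u)" unfolding u v by (simp add: algebra_simps)
      finally have "8 dvd int a * ((int a - 1) * (int d + 1))" by simp
      moreover have "coprime 8 (int a)" using assms(1) by (intro odd_coprime_8) simp
      ultimately have "8 dvd (int a - 1) * (int d + 1)" by (simp add: coprime_dvd_mult_right_iff)
      then show ?thesis by simp
    qed
    then obtain k where k0: "KK * ((int a - 1) * (int d + 1)) = 8 * k" by blast
    have "real_of_int (KK * ((int a - 1) * (int d + 1))) = of_int (8 * k)" by (simp only: k0)
    then have k: "real_of_int KK * ((real a - 1) * (real d + 1)) = 8 * of_int k" by simp
    have "psi r l a b * ee (of_int (KK * (int a - 1)) / 8)
        = ee (- (of_int KK / 2) / 4 * (real d - 1) + of_int KK / 2 * (real l - 1) * (real N - 1) / 4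
           + of_int (KK * (int a - 1)) / 8)"
      using True by (simp add: psi_def Let_def KK_eq d_def ee_add)
    also have "\<dots> = ee (- (of_int KK / 2) / 4 * (real l - 1) + of_int KK / 2 * (real l - 1) * (real N - 1) / 4)"
      by (rule ee_eqI[of _ _ k]) (use k rad in \<open>simp add: field_simps\<close>)
    also have "\<dots> = psi r l 1 0" using True by (simp add: psi_def Let_def KK_eq)
    finally show ?thesis by simp
  next
    case False
    then have ev: "even l" by simp
    show ?thesis
    proof (cases "even N")
      case True
      obtain k where k: "of_int KK * real N * (1 + delta1 r l) = 8 * of_int k"
        using KK_even_N[OF ev True] by blast
      have "psi r l a b * ee (of_int (KK * (int a - 1)) / 8)
         = ee (- (of_int KK / 2) / 4 * (real a - 1) - real N * (of_int KK / 2) * (1 + delta1 r l) / 4 * real b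
            + of_int (KK * (int a - 1)) / 8)"
        using ev True by (subst ee_add) (simp add: psi_def Let_def KK_eq)
      also have "\<dots> = ee (- of_int (k * int b))"
      proof (rule arg_cong[of _ _ ee])
        have "- (of_int KK / 2) / 4 * (real a - 1) - real N * (of_int KK / 2) * (1 + delta1 r l) / 4 * real b
            + of_int (KK * (int a - 1)) / 8 = - (of_int KK * real N * (1 + delta1 r l)) / 8 * real b"
          by (simp add: field_simps)
        then show "- (of_int KK / 2) / 4 * (real a - 1) - real N * (of_int KK / 2) * (1 + delta1 r l) / 4 * real b
            + of_int (KK * (int a - 1)) / 8 = - of_int (k * int b)" unfolding k by simp
      qed
      also have "\<dots> = 1" using ee_of_int[of "- (k * int b)"] by simp
      also have "1 = psi r l 1 0" using ev True by (simp add: psi_def Let_def)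
      finally show ?thesis by simp
    next
      case odd: False
      obtain i where i: "KK = 4 * i" using KK_odd_N[OF ev odd] by blast
      obtain j where j: "int a = 2 * j + 1" using assms(1) by (metis even_of_nat oddE)
      have "ee (of_int (KK * (int a - 1)) / of_int 8) = 1"
        by (rule ee_eq_1) (simp_all add: i j)
      then show ?thesis using ev odd by (simp add: psi_def Let_def)
    qed
  qed
qed

text \<open>Modulo g = gcd(a, d) the entry b may be replaced by b1, and s' is -1/B modulo t for B =
  N b1. As l is a square, so is a/g, and g may be replaced by a. What remains is the symbol (-B / a
  t), which is 1 because a t is 1 modulo 8 and modulo the odd part of B.\<close>

lemma half_integral_sign:
  assumes "odd (wt2 r)" "odd a" "int a * int d = int l" "coprime (int a) (int N * b1)"
    and "b1 = int b + int d * m" "b1 > 0" "s' > 0" "t > 0" "odd t"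
    and det: "int a * t - b1 * (int N * s') = 1" and "8 dvd s'"
  shows "kronecker (- int N * int b) (int (gcd a d)) * kronecker s' t = 1"
proof -
  define g where "g = gcd a d"
  define B where "B = int N * b1"
  have a0: "a > 0" "d > 0" using assms(3) l_pos by (auto intro!: gr0I)
  have g0: "g > 0" using a0 by (simp add: g_def)
  have og: "odd (int g)" using assms(2) g_def by (metis dvd_trans even_of_nat gcd_dvd1)
  have B0: "B > 0" using assms(6) N_pos by (simp add: B_def)
  have coB: "coprime (- B) (int a)" using assms(4) by (simp add: B_def coprime_commute)
  have dt: "int a * t = 1 + B * s'" using det by (simp add: B_def algebra_simps)
  have 1: "kronecker (- int N * int b) (int g) = kronecker (- B) (int g)"
  proof (rule kronecker_cong)
    have "int g dvd int d" by (simp add: g_def)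
    then have "int g dvd int N * int d * m" by simp
    moreover have "- int N * int b - (- B) = int N * int d * m"
      by (simp add: B_def assms(5) algebra_simps)
    ultimately show "[- int N * int b = - B] (mod int g)" by (simp add: cong_iff_dvd_diff)
  qed (use g0 og in auto)
  have 2: "kronecker (- B) (int a) = kronecker (- B) (int g)"
  proof -
    obtain a' d' where ad: "a = g * a'" "d = g * d'" "coprime a' d'"
      using gcd_coprime_exists[of a d] a0 unfolding g_def by (metis gcd_eq_0_iff mult.commute less_irrefl)
    have pos: "a' > 0" "d' > 0" using ad a0 by (auto intro!: gr0I)
    obtain s where s: "l = s\<^sup>2" using l_square[OF assms(1)] by blast
    have "a * d = s\<^sup>2" using assms(3) s by (metis of_nat_eq_iff of_nat_mult)
    then have e: "g\<^sup>2 * (a' * d') = s\<^sup>2" using ad by (simp add: power2_eq_square mult_ac)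
    then have "g\<^sup>2 dvd s\<^sup>2" by (metis dvd_triv_left)
    then have "g dvd s" by simp
    then obtain h where h: "s = g * h" by blast
    \<comment> \<open>The coprime cofactors a' and d' have a square product, so a' is a
      square.\<close>
    have "a' * d' = h\<^sup>2" using e g0 by (simp add: h power_mult_distrib)
    then have "is_nth_power 2 (a' * d')" by (auto simp: is_nth_power_def)
    then have "is_nth_power 2 a'"
      using is_nth_power_mult_coprime_natD[OF ad(3)] pos by blast
    then obtain u where u: "a' = u\<^sup>2" by (auto simp: is_nth_power_def)
    have u0: "u > 0" using pos u by (auto intro!: gr0I)
    have "coprime (- B) (int u)" using coB unfolding ad(1) u by (simp add: power2_eq_square)
    then have "kronecker (- B) (int u) \<in> {-1, 1}" using u0 by (intro kronecker_sign) auto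
    then have "kronecker (- B) (int u) * kronecker (- B) (int u) = 1" by auto
    moreover have "int a = int g * (int u * int u)" by (simp add: ad(1) u power2_eq_square)
    ultimately show ?thesis using g0 u0 by (simp add: kronecker_mult_right)
  qed
  have "int a * t - s' * B = 1" using dt by (simp add: mult.commute)
  from coprime_of_det[OF this] have cot: "coprime (- B) t" by (simp add: coprime_commute)
  have 3: "kronecker s' t = kronecker (- B) t"
  proof -
    have "kronecker ((- B) * s') t = kronecker 1 t"
    proof (rule kronecker_cong)
      have "- B * s' - 1 = t * (- int a)" using dt by (simp add: algebra_simps)
      then show "[- B * s' = 1] (mod t)" unfolding cong_iff_dvd_diff by (metis dvd_triv_left)
    qed (use assms in auto)
    then have "kronecker (- B) t * kronecker s' t = 1"
      using kronecker_mult_left[OF assms(8), of "- B" s'] kronecker_1_left[OF assms(8)] by simp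
    moreover have "kronecker (- B) t \<in> {-1,1}" using cot assms(8) by (intro kronecker_sign)
    ultimately show ?thesis by auto
  qed
  have "kronecker (- B) (int a) * kronecker (- B) t = 1"
  proof -
    define M where "M = int a * t"
    have M0: "M > 0" "odd M" using a0 assms(2,8,9) by (auto simp: M_def)
    obtain i where i: "s' = 8 * i" using assms(11) by blast
    have M8: "M = 1 + 8 * (B * i)" using dt i by (simp add: M_def)
    then have M84: "M mod 4 = 1" "M mod 8 = 1" by presburger+
    define e where "e = multiplicity 2 B"
    define B' where "B' = B div 2 ^ e"
    have B': "B = 2 ^ e * B'" "odd B'"
      unfolding B'_def e_def using B0 multiplicity_decompose[of B 2] by (auto simp: multiplicity_dvd)
    have B'0: "B' > 0" using B' B0 by (simp add: zero_less_mult_iff)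
    \<comment> \<open>Three pieces, three laws: M = 1 modulo 4 settles the sign, M = 1 modulo 8 the
      powers of 2, and reciprocity with M = 1 modulo B' the odd part.\<close>
    have "kronecker (- B) M = kronecker (-1) M * (kronecker 2 M ^ e * kronecker B' M)"
      using M0 kronecker_mult_left[OF M0(1), of "-1" B] by (simp add: B' kronecker_mult_left kronecker_power_left)
    also have "kronecker (-1) M = 1" using kronecker_minus_one[OF M0] M84 by simp
    also have "kronecker 2 M = 1" using kronecker_two[OF M0] M0 M84 by (simp add: kron2_def)
    also have "kronecker B' M = qr_sign B' M * kronecker M B'"
      by (rule kronecker_reciprocity[OF B'0 B'(2) M0])
    also have "qr_sign B' M = 1" using M84 by (simp add: qr_sign_def)
    also have "kronecker M B' = kronecker 1 B'"
    proof (rule kronecker_cong)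
      have "M - 1 = B' * (2 ^ e * s')" using dt B' by (simp add: M_def)
      then show "[M = 1] (mod B')" unfolding cong_iff_dvd_diff by (metis dvd_triv_left)
    qed (use B'0 B' in auto)
    also have "\<dots> = 1" using B'0 by (rule kronecker_1_left)
    finally have "kronecker (- B) M = 1" by simp
    then show ?thesis using a0 assms(8) by (simp add: M_def kronecker_mult_right)
  qed
  then show ?thesis using 1 2 3 by (simp add: g_def)
qed

text \<open>Of e(b d (n/l - x_N/24)) only the part without n is kept: the rest, e(n b/a), arises
  from the shift by b/d when Fourier coefficients are taken.\<close>

definition wgt :: "nat \<Rightarrow> nat \<Rightarrow> complex" where
  "wgt a b = of_int (kronecker (int a) (varpi r))
     * of_int (kronecker (- int N * int b) (int (gcd a (l div a)))) powi wt2 r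
     * ee (- (real b * real (l div a) * of_int (xN r) / 24)) * psi r l a b"

lemma wgt_1_0: "wgt 1 0 = psi r l 1 0"
proof -
  have "varpi r > 0" using W_pos by (simp add: varpi_eq)
  then show ?thesis by (simp add: wgt_def kronecker_1_left)
qed

text \<open>The character identity behind (1, 0; 0, l) (a, b1; N s', t) = (1, 0; N s' d, 1) (1, m;
  0, 1) (a, b; 0, d); the translation by m contributes the last factor on the left. The two sides
  are compared separately as cube roots of unity, as 8th roots, as Kronecker signs and through
  \<open>psi\<close>.\<close>

lemma weight_relation:
  assumes ad: "a * d = l" and co: "coprime a N" "coprime (int a) b1"
    and b1: "b1 = int b + int d * m" "b1 > 0" and s': "s' > 0" and t: "t > 0" "odd t"
    and det: "int a * t - b1 * (int N * s') = 1"
    and s8: "odd a \<Longrightarrow> 8 dvd s'" and s3: "\<not> 3 dvd a \<Longrightarrow> 3 dvd s'"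
  shows "wgt 1 0 * chi r 1 0 (int N * (s' * int d)) 1 1 * ee (of_int (xN r * m) / 24)
       = wgt a b * chi r (int a) b1 (int N * s') t 1"
proof -
  define x y where "x = xN r" and "y = yN r"
  have a0: "a > 0" "d > 0" using ad l_pos by (auto intro!: gr0I)
  have adl: "int a * int d = int l" using ad by (metis of_nat_mult)
  have ld: "l div a = d" using ad a0 by auto
  have al: "a dvd l" using ad by auto
  have at8: "[int a * t = 1] (mod 8)" if odd_a: "odd a"
  proof -
    obtain i where "s' = 8 * i" using s8[OF odd_a] by blast
    then have "int a * t - 1 = 8 * (b1 * int N * i)" using det by (simp add: algebra_simps)
    then show ?thesis unfolding cong_iff_dvd_diff by (metis dvd_triv_left)
  qed
  have atN: "[int a * t = 1] (mod int N)"
  proof -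
    have "int a * t - 1 = int N * (b1 * s')" using det by (simp add: algebra_simps)
    then show ?thesis unfolding cong_iff_dvd_diff by (metis dvd_triv_left)
  qed
  have cot: "coprime t (int N * s')" by (rule coprime_of_det[OF det])
  have chi1: "chi r 1 0 (int N * (s' * int d)) 1 1
      = ee (of_int (- 3 * s' * int d * y) / 8) * ee (- of_int (2 * s' * int d * y) / 3)"
    using a0 s' by (subst chi_eq[OF _ refl]) (simp_all add: y_def mult_ac)
  define Z where "Z = (int a + t) * s' * y - b1 * t * (int N * s') * s' * y + b1 * t * x"
  have chi2: "chi r (int a) b1 (int N * s') t 1
      = of_int (kronecker (varpi r) t) * of_int (kronecker s' t) powi wt2 r
     * ee (of_int (wt2 r * (t - 1)) / 8) * ee (of_int (3 * t * (b1 * x - s' * y)) / 8) * ee (- of_int Z / 3)"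
    unfolding chi_eq[OF det refl s' t] prod_kronecker[OF t(1) cot] Z_def x_def y_def ..
  \<comment> \<open>Substituting b = b1 - d m leaves the error (d^2 - 1) x m / 24, an integer by
    \<open>square_divisor\<close>.\<close>
  have bd: "ee (- (real b * real d * of_int x / 24)) * ee (- (of_int (x * m) / 24))
      = ee (of_int (- 3 * b1 * int d * x) / 8) * ee (of_int (b1 * int d * x) / 3)"
  proof -
    obtain k where k: "((int d)\<^sup>2 - 1) * x = 24 * k" using square_divisor[OF adl] unfolding x_def by blast
    have "of_int (((int d)\<^sup>2 - 1) * x) = real_of_int (24 * k)" unfolding k ..
    then have k': "((real d)\<^sup>2 - 1) * of_int x = 24 * of_int k" by simp
    have "- (real b * real d * of_int x / 24) - of_int x * of_int m / 24
        = of_int (- (b1 * int d * x)) / 24 + (((real d)\<^sup>2 - 1) * of_int x) * of_int m / 24"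
      by (simp add: b1(1) field_simps power2_eq_square)
    then have "- (real b * real d * of_int x / 24) + - (of_int (x * m) / 24) - of_int (- (b1 * int d * x)) / 24
        = of_int (k * m)" unfolding k' by simp
    then have "ee (- (real b * real d * of_int x / 24) + - (of_int (x * m) / 24)) = ee (of_int (- (b1 * int d * x)) / 24)"
      by (rule ee_eqI)
    then show ?thesis unfolding ee_split_24 ee_add by (simp add: mult_ac)
  qed
  \<comment> \<open>If 3 divides a, then it divides x and y. Otherwise 3 divides s' and a t = 1
    modulo 3, so a (d - t) x = (l - 1) x = 0 modulo 3.\<close>
  have part3: "ee (of_int (b1 * int d * x) / 3) * ee (- of_int Z / 3) = ee (- of_int (2 * s' * int d * y) / 3)"
  proof -
    have "3 dvd b1 * int d * x - Z + 2 * s' * int d * y"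
    proof (cases "3 dvd a")
      case True
      then have "3 dvd l" using al by (rule dvd_trans)
      then have "3 dvd x" "3 dvd y" using three_dvd_l by (simp_all add: x_def y_def)
      then show ?thesis unfolding Z_def by simp
    next
      case False
      then obtain i where i: "s' = 3 * i" using s3 by blast
      obtain k where k: "(int l - 1) * x = 3 * k" using lxy3 unfolding x_def by blast
      have at: "int a * t = 1 + 3 * (b1 * int N * i)" using det i by (simp add: algebra_simps)
      have "int a * (b1 * int d * x - b1 * t * x) = b1 * x * (int a * int d) - b1 * x * (int a * t)"
        by (simp add: algebra_simps)
      also have "\<dots> = b1 * ((int l - 1) * x) - 3 * (b1 * x * (b1 * int N * i))"
        unfolding adl at by (simp add: algebra_simps)
      also have "\<dots> = 3 * (b1 * k - b1 * x * (b1 * int N * i))" unfolding k by (simp add: algebra_simps)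
      finally have "3 dvd int a * (b1 * int d * x - b1 * t * x)" by simp
      moreover have "\<not> 3 dvd int a" using False by presburger
      moreover have "prime (3::int)" by simp
      ultimately have "3 dvd b1 * int d * x - b1 * t * x" by (metis prime_dvd_mult_iff)
      moreover have "b1 * int d * x - Z + 2 * s' * int d * y = (b1 * int d * x - b1 * t * x)
        + 3 * (- (int a + t) * i * y + b1 * t * (int N * s') * i * y + 2 * i * int d * y)"
        unfolding Z_def i by (simp add: algebra_simps)
      ultimately show ?thesis by (metis dvd_add dvd_triv_left)
    qed
    then obtain k where k: "b1 * int d * x - Z + 2 * s' * int d * y = 3 * k" by blast
    have "real_of_int (b1 * int d * x) / 3 + - of_int Z / 3 - - of_int (2 * s' * int d * y) / 3
       = of_int (b1 * int d * x - Z + 2 * s' * int d * y) / 3" by simp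
    also have "\<dots> = of_int k" unfolding k by simp
    finally show ?thesis unfolding ee_add[symmetric] by (rule ee_eqI)
  qed
  \<comment> \<open>Exchanging t and d costs nothing: for odd a, a (t - d) x = (1 - l) x = 0 modulo
    8 and 8 divides s', while even a makes x and y divisible by 8.\<close>
  have part8: "ee (of_int (- 3 * b1 * int d * x) / 8) * ee (of_int (3 * t * (b1 * x - s' * y)) / 8)
      = ee (of_int (- 3 * s' * int d * y) / 8)"
  proof -
    have "8 dvd (t - int d) * (b1 * x - s' * y)"
    proof (cases "even a")
      case True
      then have "even l" using al by (rule dvd_trans)
      then have "8 dvd x" "8 dvd y" using even_l by (simp_all add: x_def y_def)
      then show ?thesis by simp
    next
      case False
      obtain i where i: "s' = 8 * i" using s8 False by blast
      obtain k where k: "(int l - 1) * x = 8 * k" using lxy8 unfolding x_def by blast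
      obtain j where j: "int a * t = 1 + 8 * j" using at8[OF False] by (metis cong_iff_lin cong_sym)
      have "int a * ((t - int d) * x) = (int a * t) * x - (int a * int d) * x" by (simp add: algebra_simps)
      also have "\<dots> = 8 * (j * x - k)" unfolding j adl using k by (simp add: algebra_simps)
      finally have "8 dvd int a * ((t - int d) * x)" by simp
      moreover have "coprime 8 (int a)" using False by (intro odd_coprime_8) simp
      ultimately have "8 dvd (t - int d) * x" by (simp add: coprime_dvd_mult_right_iff)
      then obtain z where z: "(t - int d) * x = 8 * z" by blast
      have "(t - int d) * (b1 * x - s' * y) = b1 * ((t - int d) * x) - 8 * ((t - int d) * i * y)"
        unfolding i by (simp add: algebra_simps)
      also have "\<dots> = 8 * (b1 * z - (t - int d) * i * y)" unfolding z by (simp add: algebra_simps)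
      finally show ?thesis by simp
    qed
    then obtain k where k: "(t - int d) * (b1 * x - s' * y) = 8 * k" by blast
    have "real_of_int (- 3 * b1 * int d * x) / 8 + of_int (3 * t * (b1 * x - s' * y)) / 8 - of_int (- 3 * s' * int d * y) / 8
       = of_int (3 * ((t - int d) * (b1 * x - s' * y))) / 8"
      by (simp add: field_simps)
    also have "\<dots> = of_int (3 * k)" unfolding k by simp
    finally show ?thesis unfolding ee_add[symmetric] by (rule ee_eqI)
  qed
  have sign1: "of_int (kronecker (int a) (varpi r)) * of_int (kronecker (varpi r) t) = ee (delta r * (of_int t - 1) / 4)"
    using kronecker_varpi[OF t atN] at8 qr_sign_W[OF t(2)] by (metis even_of_nat of_int_mult)
  define G where "G = of_int (kronecker (- int N * int b) (int (gcd a d))) * (of_int (kronecker s' t) :: complex)"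
  have sign2: "G powi wt2 r = 1"
  \<comment> \<open>For even 2k it is enough that G is a sign; for odd 2k, G itself must be 1, which
    is where the square l is used.\<close>
  proof (cases "even (wt2 r)")
    case True
    have "kronecker s' t \<in> {-1, 1}" using cot t by (intro kronecker_sign) (auto simp: coprime_commute)
    moreover have "kronecker (- int N * int b) (int (gcd a d)) \<in> {-1, 1}"
    proof (intro kronecker_sign coprimeI)
      fix e assume e: "e dvd - int N * int b" "e dvd int (gcd a d)"
      then have "e dvd int a" "e dvd int d" by (meson dvd_trans gcd_dvd1 gcd_dvd2 int_dvd_int_iff)+
      have "- int N * b1 = - int N * int b - int d * (int N * m)" by (simp add: b1 algebra_simps)
      moreover have "e dvd int d * (int N * m)" using \<open>e dvd int d\<close> by simp
      ultimately have "e dvd int N * b1" using e(1) by (metis dvd_diff dvd_minus_iff mult_minus_left)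
      moreover have "coprime (int a) (int N * b1)" using co by simp
      ultimately show "is_unit e" using \<open>e dvd int a\<close> coprime_common_divisor by blast
    qed (use a0 in auto)
    ultimately have "G = 1 \<or> G = -1" unfolding G_def by auto
    then show ?thesis using True by (auto simp: power_int_minus_left)
  next
    case odd: False
    \<comment> \<open>An even a would make l even and N odd, hence \<open>KK\<close> divisible by 4,
      although \<open>KK\<close> has the parity of 2k.\<close>
    have "odd a"
    proof
      assume "even a"
      then have "even l" "odd N" using al co(1) by (auto dest: dvd_trans coprime_common_divisor)
      then have "even KK" using KK_odd_N by (meson dvd_trans even_numeral dvd_triv_left)
      then show False using odd by (simp add: KK_def)
    qed
    have "kronecker (- int N * int b) (int (gcd a d)) * kronecker s' t = 1"
      by (rule half_integral_sign[OF odd \<open>odd a\<close> adl _ b1 s' t det s8[OF \<open>odd a\<close>]]) (use co in simp)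
    then have "G = 1" unfolding G_def by (metis of_int_1 of_int_mult)
    then show ?thesis by simp
  qed
  \<comment> \<open>The exponents from \<open>delta\<close> and from the weight add up to KK (t - 1)
    / 8. For odd a, t = a modulo 8 and \<open>psi_odd\<close> applies; for even a, 4 divides
    \<open>KK\<close>.\<close>
  have psi: "psi r l 1 0 = psi r l a b * (ee (delta r * (of_int t - 1) / 4) * ee (of_int (wt2 r * (t - 1)) / 8))"
  proof -
    have K: "ee (delta r * (of_int t - 1) / 4) * ee (of_int (wt2 r * (t - 1)) / 8) = ee (of_int (KK * (t - 1)) / 8)"
    proof -
      have d: "delta r = (of_int KK - of_int (wt2 r)) / 2" using KK_eq by (simp add: wt_def field_simps)
      have "delta r * (of_int t - 1) / 4 + of_int (wt2 r * (t - 1)) / 8 = of_int (KK * (t - 1)) / 8"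
        unfolding d by (simp add: field_simps)
      then show ?thesis unfolding ee_add[symmetric] by (rule arg_cong)
    qed
    show ?thesis
    proof (cases "even a")
      case True
      then have "even l" "odd N" using al co(1) by (auto dest: dvd_trans coprime_common_divisor)
      then obtain i where i: "KK = 4 * i" using KK_odd_N by blast
      obtain j where j: "t = 2 * j + 1" using t(2) by (rule oddE)
      have "ee (of_int (KK * (t - 1)) / of_int 8) = 1" by (rule ee_eq_1) (simp_all add: i j)
      then show ?thesis unfolding K using \<open>even l\<close> \<open>odd N\<close> by (simp add: psi_def Let_def)
    next
      case False
      obtain j where j: "int a * t = 1 + 8 * j" using at8[OF False] by (metis cong_iff_lin cong_sym)
      have "[(int a)\<^sup>2 = 1] (mod 8)" using odd_square_mod_8 False by simp
      then obtain u where u: "(int a)\<^sup>2 = 1 + 8 * u" by (metis cong_iff_lin cong_sym)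
      have "int a * (int a - t) = (int a)\<^sup>2 - int a * t" by (simp add: algebra_simps power2_eq_square)
      also have "\<dots> = 8 * (u - j)" unfolding u j by simp
      finally have "8 dvd int a * (int a - t)" by simp
      moreover have "coprime 8 (int a)" using False by (intro odd_coprime_8) simp
      ultimately have "8 dvd int a - t" by (simp add: coprime_dvd_mult_right_iff)
      then have "8 dvd KK * (int a - t)" by simp
      then have "[KK * (int a - 1) = KK * (t - 1)] (mod 8)"
        unfolding cong_iff_dvd_diff by (simp add: algebra_simps)
      from ee_cong[OF this] have "ee (of_int (KK * (int a - 1)) / 8) = ee (of_int (KK * (t - 1)) / 8)" by simp
      then show ?thesis unfolding K using psi_odd[OF _ al co(1), of b] False by simp
    qed
  qed
  have inv: "ee (of_int (x * m) / 24) * ee (- (of_int (x * m) / 24)) = 1"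
    unfolding ee_add[symmetric] by simp
  have "wgt a b * chi r (int a) b1 (int N * s') t 1 * ee (- (of_int (x * m) / 24))
     = (of_int (kronecker (int a) (varpi r)) * of_int (kronecker (varpi r) t))
       * G powi wt2 r * psi r l a b * ee (of_int (wt2 r * (t - 1)) / 8)
       * (ee (- (real b * real d * of_int x / 24)) * ee (- (of_int (x * m) / 24)))
       * ee (of_int (3 * t * (b1 * x - s' * y)) / 8) * ee (- of_int Z / 3)"
    unfolding wgt_def ld chi2 G_def power_int_mult_distrib x_def by (simp only: mult_ac)
  also have "\<dots> = psi r l a b * (ee (delta r * (of_int t - 1) / 4) * ee (of_int (wt2 r * (t - 1)) / 8))
      * (ee (of_int (- 3 * b1 * int d * x) / 8) * ee (of_int (3 * t * (b1 * x - s' * y)) / 8))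
      * (ee (of_int (b1 * int d * x) / 3) * ee (- of_int Z / 3))"
    unfolding sign1 sign2 bd by (simp only: mult_ac mult_1_left)
  also have "\<dots> = wgt 1 0 * chi r 1 0 (int N * (s' * int d)) 1 1"
    unfolding psi[symmetric] part8 part3 chi1 wgt_1_0 by (simp only: mult_ac)
  finally have "wgt a b * chi r (int a) b1 (int N * s') t 1 * ee (- (of_int (x * m) / 24)) * ee (of_int (x * m) / 24)
     = wgt 1 0 * chi r 1 0 (int N * (s' * int d)) 1 1 * ee (of_int (x * m) / 24)" by simp
  then show ?thesis using inv unfolding x_def by (simp only: mult.assoc mult.commute[of "ee (- _)"] mult_1_right)
qed

text \<open>Conjugation by diag(1, l) relates the two matrices. It moves a factor l between the
  coefficients of x_N and y_N, so the exponents differ by multiples of (l - 1) x_N and (l - 1) y_N.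
  The sign changes by (l/t) to the power 2k, and l is a square when 2k is odd.\<close>

lemma chi_stabilizer:
  assumes det: "p * t - int l * q * (int N * s') = 1" and s': "s' > 0" and t: "t > 0" "odd t"
  shows "chi r p q (int N * (int l * s')) t 1 = chi r p (int l * q) (int N * s') t 1"
proof -
  define x y where "x = xN r" and "y = yN r"
  have ls: "int l * s' > 0" using l_pos s' by simp
  have det': "p * t - q * (int N * (int l * s')) = 1" using det by (simp add: mult_ac)
  have co: "coprime t (int N * (int l * s'))" by (rule coprime_of_det[OF det'])
  then have cos: "coprime t (int N * s')" and col: "coprime (int l) t" by (auto simp: coprime_commute)
  have sgn: "of_int (kronecker (int l * s') t) powi wt2 r = (of_int (kronecker s' t) :: complex) powi wt2 r"
  proof -
    have kl: "kronecker (int l) t \<in> {-1, 1}" using t(1) col by (rule kronecker_sign)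
    have "(of_int (kronecker (int l) t) :: complex) powi wt2 r = 1"
    proof (cases "even (wt2 r)")
      case True
      then show ?thesis using kl by (auto simp: power_int_minus_left)
    next
      case False
      then obtain s where s: "l = s\<^sup>2" using l_square by blast
      then have "kronecker (int l) t = kronecker (int s) t ^ 2" using t by (simp add: kronecker_power_left)
      then have "kronecker (int l) t = 1" using kl by (auto simp: power2_eq_square)
         (metis zero_le_square le_minus_one_simps(1) not_le zero_less_one neg_0_le_iff_le)
      then show ?thesis by simp
    qed
    then show ?thesis using t by (simp add: kronecker_mult_left power_int_mult_distrib)
  qed
  obtain k where k: "(int l - 1) * x = 24 * k" using lx unfolding x_def by blast
  obtain j where j: "(int l - 1) * y = 24 * j" using ly unfolding y_def by blast
  have 8: "ee (of_int (3 * t * (q * x - int l * s' * y)) / 8) = ee (of_int (3 * t * (int l * q * x - s' * y)) / 8)"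
  proof (rule ee_cong[where m = 8, simplified])
    have "3 * t * (q * x - int l * s' * y) - 3 * t * (int l * q * x - s' * y)
       = - 3 * t * q * ((int l - 1) * x) - 3 * t * s' * ((int l - 1) * y)" by (simp add: algebra_simps)
    also have "\<dots> = 8 * (- 9 * t * q * k - 9 * t * s' * j)" unfolding k j by simp
    finally show "[3 * t * (q * x - int l * s' * y) = 3 * t * (int l * q * x - s' * y)] (mod 8)"
      unfolding cong_iff_dvd_diff by simp
  qed
  define Z1 where "Z1 = (p + t) * (int l * s') * y - q * t * (int N * (int l * s')) * (int l * s') * y + q * t * x"
  define Z2 where "Z2 = (p + t) * s' * y - int l * q * t * (int N * s') * s' * y + int l * q * t * x"
  have 3: "ee (- of_int Z1 / 3) = ee (- of_int Z2 / 3)"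
  proof -
    have "Z1 - Z2 = ((p + t) * s' - q * t * int N * int l * s' * s') * ((int l - 1) * y) - q * t * ((int l - 1) * x)"
      unfolding Z1_def Z2_def by (simp add: algebra_simps)
    also have "\<dots> = 3 * (((p + t) * s' - q * t * int N * int l * s' * s') * 8 * j - q * t * 8 * k)"
      unfolding k j by simp
    finally have "[Z1 = Z2] (mod 3)" unfolding cong_iff_dvd_diff by (metis dvd_triv_left)
    from ee_cong[OF cong_minus_minus_iff[THEN iffD2, OF this]] show ?thesis by simp
  qed
  show ?thesis
    unfolding chi_eq[OF det' refl ls t] chi_eq[OF det refl s' t] prod_kronecker[OF t(1) co]
      prod_kronecker[OF t(1) cos] sgn 8[unfolded x_def y_def] 3[unfolded Z1_def Z2_def x_def y_def] ..
qed

end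

section \<open>The action of integral matrices\<close>

type_synonym mat2 = "int \<times> int \<times> int \<times> int"

fun mm :: "mat2 \<Rightarrow> mat2 \<Rightarrow> mat2" where
  "mm (a, b, c, d) (a', b', c', d') = (a * a' + b * c', a * b' + b * d', c * a' + d * c', c * b' + d * d')"

fun det2 :: "mat2 \<Rightarrow> int" where
  "det2 (a, b, c, d) = a * d - b * c"

fun adj2 :: "mat2 \<Rightarrow> mat2" where
  "adj2 (a, b, c, d) = (d, - b, - c, a)"

fun act :: "mat2 \<Rightarrow> complex \<Rightarrow> complex" where
  "act (a, b, c, d) \<tau> = (of_int a * \<tau> + of_int b) / (of_int c * \<tau> + of_int d)"

definition G0 :: "nat \<Rightarrow> mat2 set" where
  "G0 n = {(a, b, c, d). a * d - b * c = 1 \<and> int n dvd c}"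

lemma mm_assoc: "mm (mm A B) C = mm A (mm B C)"
  by (cases A; cases B; cases C) (simp add: algebra_simps)

lemma det2_mm: "det2 (mm A B) = det2 A * det2 B"
  by (cases A; cases B) (simp add: algebra_simps)

lemma det2_G0: "M \<in> G0 n \<Longrightarrow> det2 M = 1"
  by (auto simp: G0_def)

lemma G0_mm: "A \<in> G0 n \<Longrightarrow> B \<in> G0 n \<Longrightarrow> mm A B \<in> G0 n"
  using det2_mm[of A B] by (cases A; cases B) (auto simp: G0_def)

lemma G0_adj: "A \<in> G0 n \<Longrightarrow> adj2 A \<in> G0 n"
  by (cases A) (auto simp: G0_def algebra_simps)

lemma mm_one: "mm A (1, 0, 0, 1) = A" "mm (1, 0, 0, 1) A = A"
  by (cases A; simp)+

lemma mm_adj: "det2 A = 1 \<Longrightarrow> mm A (adj2 A) = (1, 0, 0, 1)" "det2 A = 1 \<Longrightarrow> mm (adj2 A) A = (1, 0, 0, 1)"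
  by (cases A; auto simp: algebra_simps)+

lemma mm_adj_cancel:
  assumes "det2 A = 1"
  shows "mm (mm B A) (adj2 A) = B" "mm (mm B (adj2 A)) A = B" "mm (adj2 A) (mm A B) = B" "mm A (mm (adj2 A) B) = B"
  using mm_adj[OF assms] by (simp_all add: mm_assoc mm_one flip: mm_assoc[of _ _ B])

lemma denom_nonzero:
  assumes "\<tau> \<in> HH" "c \<noteq> 0 \<or> d \<noteq> 0"
  shows "of_int c * \<tau> + of_int d \<noteq> 0"
proof
  assume 0: "of_int c * \<tau> + of_int d = 0"
  then have "Im (of_int c * \<tau> + of_int d) = 0" by simp
  then have "c = 0" using assms(1) by (simp add: HH_def)
  then show False using 0 assms(2) by simp
qed

lemma act_in_HH:
  assumes "\<tau> \<in> HH" "det2 M > 0"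
  shows "act M \<tau> \<in> HH"
proof -
  obtain a b c d where M: "M = (a, b, c, d)" by (cases M)
  have "of_int c * \<tau> + of_int d \<noteq> 0"
    by (rule denom_nonzero) (use assms M in auto)
  then have "(Re (of_int c * \<tau> + of_int d))\<^sup>2 + (Im (of_int c * \<tau> + of_int d))\<^sup>2 > 0"
    by (simp add: complex_eq_iff sum_power2_gt_zero_iff)
  moreover have "Im (act M \<tau>) = of_int (det2 M) * Im \<tau> /
      ((Re (of_int c * \<tau> + of_int d))\<^sup>2 + (Im (of_int c * \<tau> + of_int d))\<^sup>2)"
    by (simp add: M Im_divide algebra_simps)
  moreover have "of_int (det2 M) * Im \<tau> > 0" using assms by (simp add: HH_def)
  ultimately show ?thesis by (simp add: HH_def)
qed

lemma act_mm:
  assumes "\<tau> \<in> HH" "det2 A > 0" "det2 B > 0"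
  shows "act (mm A B) \<tau> = act A (act B \<tau>)"
proof -
  obtain a b c d where A: "A = (a, b, c, d)" by (cases A)
  obtain a' b' c' d' where B: "B = (a', b', c', d')" by (cases B)
  define w where "w = of_int c' * \<tau> + of_int d'"
  define z where "z = of_int a' * \<tau> + of_int b'"
  have w: "w \<noteq> 0" unfolding w_def by (rule denom_nonzero) (use assms B in auto)
  have "of_int c * (z / w) + of_int d \<noteq> 0"
  proof -
    have "c \<noteq> 0 \<or> d \<noteq> 0" using assms(2) A by auto
    from denom_nonzero[OF act_in_HH[OF assms(1,3)] this] show ?thesis by (simp add: B z_def w_def)
  qed
  then have v: "of_int c * z + of_int d * w \<noteq> 0" using w by (simp add: field_simps)
  have "act A (act B \<tau>) = (of_int a * (z / w) + of_int b) / (of_int c * (z / w) + of_int d)"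
    by (simp add: A B z_def w_def)
  also have "\<dots> = (of_int a * z + of_int b * w) / (of_int c * z + of_int d * w)"
    using w v by (simp add: divide_simps)
  also have "\<dots> = act (mm A B) \<tau>"
    unfolding A B z_def w_def by (simp add: algebra_simps)
  finally show ?thesis by simp
qed

text \<open>Positive scaling preserves the argument and hence the principal branch; this is the one
  multiplicative rule for \<open>csqrt\<close> on which the proof relies.\<close>

lemma csqrt_mult_of_real:
  assumes "x > 0"
  shows "csqrt (of_real x * z) = of_real (sqrt x) * csqrt z"
proof (rule csqrt_unique)
  show "(of_real (sqrt x) * csqrt z)\<^sup>2 = of_real x * z"
    using assms by (simp add: power_mult_distrib flip: of_real_power)
  show "0 < Re (of_real (sqrt x) * csqrt z) \<or>
        Re (of_real (sqrt x) * csqrt z) = 0 \<and> 0 \<le> Im (of_real (sqrt x) * csqrt z)"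
    using csqrt_principal[of z] assms by auto
qed

lemma sqrt_powi: "x > 0 \<Longrightarrow> sqrt x powi n = x powr (of_int n / 2)"
proof -
  assume x: "x > 0"
  then have "sqrt x powi n = sqrt x powr of_int n" by (simp add: powr_real_of_int')
  also have "\<dots> = (x powr (1/2)) powr of_int n" using x by (simp add: powr_half_sqrt)
  also have "\<dots> = x powr (of_int n / 2)" by (simp add: powr_powr)
  finally show ?thesis .
qed

lemma chi_nonzero: "chi r a b c d 1 \<noteq> 0"
  by (simp add: chi_def)

text \<open>The shift m is the product of the primes that divide a but not b. A prime of a that
  divides b does not divide d m, by primitivity; any other prime of a divides m but not b. Neither
  kind divides b + d m.\<close>

lemma coprime_shift_exists:
  fixes a b d :: nat
  assumes "a > 0" "d > 0" "gcd (gcd a b) d = 1"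
  obtains m :: nat where "m > 0" "coprime a (b + d * m)"
proof -
  define m where "m = \<Prod>{p. prime p \<and> p dvd a \<and> \<not> p dvd b}"
  have fin: "finite {p. prime p \<and> p dvd a \<and> \<not> p dvd b}"
    by (rule finite_subset[OF _ finite_divisors_nat[OF assms(1)]]) auto
  have m0: "m > 0" unfolding m_def by (intro prod_pos) (auto simp: prime_gt_0_nat)
  have pm: "p dvd m \<longleftrightarrow> p dvd a \<and> \<not> p dvd b" if p: "prime p" for p
  proof
    assume "p dvd m"
    then obtain q where q: "prime q" "q dvd a" "\<not> q dvd b" "p dvd q"
      unfolding m_def using fin p by (auto simp: prime_dvd_prod_iff)
    then show "p dvd a \<and> \<not> p dvd b" using p primes_dvd_imp_eq by blast
  next
    assume "p dvd a \<and> \<not> p dvd b"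
    then show "p dvd m" unfolding m_def using fin p by (intro dvd_prodI) auto
  qed
  have "coprime a (b + d * m)"
  proof (rule ccontr)
    assume "\<not> coprime a (b + d * m)"
    then have "gcd a (b + d * m) \<noteq> 1" using coprime_iff_gcd_eq_1 by blast
    from prime_factor_nat[OF this] obtain p where "prime p" "p dvd gcd a (b + d * m)" by blast
    then have p: "prime p" "p dvd a" "p dvd b + d * m" by simp_all
    show False
    proof (cases "p dvd b")
      case True
      then have "p dvd d * m" using p(3) by (simp add: dvd_add_right_iff)
      then have "p dvd d" using pm[OF p(1)] True p(1) by (simp add: prime_dvd_mult_iff)
      then have "p dvd gcd (gcd a b) d" using True p(2) by simp
      then show False using assms(3) p(1) by (metis nat_dvd_1_iff_1 not_prime_1)
    next
      case False
      then have "p dvd m" using pm p by blast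
      then show False using p(3) False by (metis dvd_add_left_iff dvd_mult)
    qed
  qed
  then show ?thesis using that m0 by blast
qed

text \<open>The auxiliary divisibilities of \<open>s'\<close> make the multiplier of \<open>(a, b1; N s', t)\<close> easy to evaluate.\<close>
lemma bottom_row_exists:
  fixes a b1 n :: int
  assumes "a > 0" "b1 > 0" "n > 0" "coprime a b1" "coprime a n"
  obtains s' t where "s' > 0" "t > 0" "odd t" "a * t - b1 * (n * s') = 1"
    "odd a \<Longrightarrow> 8 dvd s'" "\<not> 3 dvd a \<Longrightarrow> 3 dvd s'"
proof -
  define M :: int where "M = (if odd a then 8 else 1) * (if 3 dvd a then 1 else 3)"
  have M0: "M > 0" by (simp add: M_def)
  have "coprime a 8" if "odd a" using odd_coprime_8[OF that] by (simp add: coprime_commute)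
  moreover have "coprime a 3" if "\<not> 3 dvd a"
    using that prime_imp_coprime[of "3::int" a] by (simp add: coprime_commute)
  ultimately have "coprime a M" by (simp add: M_def)
  define B where "B = b1 * n * M"
  have B: "B > 0" "coprime a B" using assms M0 \<open>coprime a M\<close> by (auto simp: B_def)
  obtain x where x: "[B * x = 1] (mod a)"
    using cong_solve_coprime_int[of B a] B(2) by (auto simp: coprime_commute)
  \<comment> \<open>The congruence asks for B s0 = -1 modulo a. Adding a keeps s0 positive when the
    residue is 0, which happens for a = 1.\<close>
  define s0 where "s0 = (- x) mod a + a"
  have s0: "s0 > 0" using assms(1) by (simp add: s0_def add_nonneg_pos)
  have "[s0 = - x] (mod a)" by (simp add: s0_def cong_def)
  then have "[B * s0 = B * (- x)] (mod a)" by (rule cong_scalar_left)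
  also have "B * (- x) = - (B * x)" by simp
  also have "[- (B * x) = - 1] (mod a)" using x by (simp add: cong_minus_minus_iff)
  finally have "a dvd B * s0 + 1" by (simp add: cong_iff_dvd_diff)
  then obtain t0 where t0: "B * s0 + 1 = a * t0" by blast
  have "\<exists>s1 t. s1 > 0 \<and> odd t \<and> B * s1 + 1 = a * t"
  proof (cases "odd t0")
    case True
    then show ?thesis using s0 t0 by blast
  next
    case False
    \<comment> \<open>For even t0 the number B s0 + 1 is even, so B is odd; shifting s0 by a then
      shifts t0 by B and flips its parity.\<close>
    have "odd B"
    proof
      assume "even B"
      then have "odd (a * t0)" using t0 by (metis even_mult_iff even_plus_one_iff)
      then show False using False by simp
    qed
    then have "odd (t0 + B)" using False by simp
    moreover have "B * (s0 + a) + 1 = a * (t0 + B)" using t0 by (simp add: algebra_simps)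
    ultimately show ?thesis using s0 assms(1) by (metis add_pos_pos)
  qed
  then obtain s1 t where st: "s1 > 0" "odd t" "B * s1 + 1 = a * t" by blast
  have "B * s1 > 0" using B st by simp
  then have "a * t > 0" using st(3) by linarith
  then have "t > 0" using assms(1) by (simp add: zero_less_mult_iff)
  moreover have "a * t - b1 * (n * (M * s1)) = 1" using st(3) by (simp add: B_def algebra_simps)
  moreover have "M * s1 > 0" using M0 st by simp
  moreover have "odd a \<Longrightarrow> 8 dvd M * s1" "\<not> 3 dvd a \<Longrightarrow> 3 dvd M * s1" by (simp_all add: M_def)
  ultimately show ?thesis using that st(2) by blast
qed

locale eta_hecke_form = eta_hecke +
  assumes transforms_f: "transforms r (eta_quot r)"
begin

abbreviation "f \<equiv> eta_quot r"

lemma f_nonzero: "\<tau> \<in> HH \<Longrightarrow> f \<tau> \<noteq> 0"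
  using eta_quot_nonzero[OF fin zero_notin] .

lemma f_act:
  assumes "(p, q, s, t) \<in> G0 N" "\<tau> \<in> HH"
  shows "f (act (p, q, s, t) \<tau>) = chi r p q s t 1 * csqrt (of_int s * \<tau> + of_int t) powi wt2 r * f \<tau>"
proof -
  have "slash r f p q s t 1 \<tau> = chi r p q s t 1 * f \<tau>"
    using transforms_f assms unfolding transforms_def G0_def by blast
  moreover have "csqrt (of_int s * \<tau> + of_int t) \<noteq> 0"
  proof -
    have "s \<noteq> 0 \<or> t \<noteq> 0" using assms(1) by (auto simp: G0_def)
    from denom_nonzero[OF assms(2) this] show ?thesis by simp
  qed
  ultimately show ?thesis by (simp add: slash_def power_int_minus field_simps)
qed

definition H :: "complex \<Rightarrow> complex" where
  "H \<tau> = f (\<tau> / of_nat l) / f \<tau>"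

lemma div_l_in_HH: "\<tau> \<in> HH \<Longrightarrow> \<tau> / of_nat l \<in> HH"
  using l_pos by (simp add: HH_def)

text \<open>The automorphy factors at \<tau> and at \<tau>/l are the same root
  \<open>csqrt w\<close>, so they cancel in the quotient, and \<open>chi_stabilizer\<close> cancels
  the characters.\<close>

lemma H_stabilizer_aux:
  assumes "(p, int l * q, int N * s', t) \<in> G0 N" "s' > 0" "t > 0" "odd t" "\<tau> \<in> HH"
  shows "H (act (p, int l * q, int N * s', t) \<tau>) = H \<tau>"
proof -
  define w where "w = of_int (int N * s') * \<tau> + of_int t"
  have w: "w \<noteq> 0" unfolding w_def using denom_nonzero[OF assms(5), of "int N * s'" t] assms(3) by simp
  have det: "p * t - int l * q * (int N * s') = 1" using assms(1) by (simp add: G0_def)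
  have g: "(p, q, int N * (int l * s'), t) \<in> G0 N" using det by (simp add: G0_def mult_ac)
  have l0: "(of_nat l :: complex) \<noteq> 0" using l_pos by simp
  have "act (p, int l * q, int N * s', t) \<tau> / of_nat l = act (p, q, int N * (int l * s'), t) (\<tau> / of_nat l)"
    using l0 by (simp add: field_simps)
  moreover have "of_int (int N * (int l * s')) * (\<tau> / of_nat l) + of_int t = w"
    using l0 by (simp add: w_def field_simps)
  ultimately have 1: "f (act (p, int l * q, int N * s', t) \<tau> / of_nat l)
      = chi r p q (int N * (int l * s')) t 1 * csqrt w powi wt2 r * f (\<tau> / of_nat l)"
    using f_act[OF g div_l_in_HH[OF assms(5)]] by (simp only:)
  have 2: "f (act (p, int l * q, int N * s', t) \<tau>)
      = chi r p (int l * q) (int N * s') t 1 * csqrt w powi wt2 r * f \<tau>"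
    using f_act[OF assms(1,5)] by (simp only: w_def)
  show ?thesis unfolding H_def 1 2 chi_stabilizer[OF det assms(2-4)]
    using w chi_nonzero[of r p "int l * q" "int N * s'" t] by simp
qed

lemma H_translate: "H (\<tau> + of_int (int l * m)) = H \<tau>"
proof -
  have "(\<tau> + of_int (int l * m)) / of_nat l = \<tau> / of_nat l + of_int m"
    using l_pos by (simp add: field_simps)
  then have "H (\<tau> + of_int (int l * m))
     = ee (of_int (xN r * m) / 24) * f (\<tau> / of_nat l) / (ee (of_int (xN r * (int l * m)) / 24) * f \<tau>)"
    unfolding H_def by (simp only: eta_quot_add_int)
  moreover have "ee (of_int (xN r * m) / of_int 24) = ee (of_int (xN r * (int l * m)) / of_int 24)"
  proof (rule ee_cong)
    have "xN r * m - xN r * (int l * m) = - m * ((int l - 1) * xN r)" by (simp add: algebra_simps)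
    then show "[xN r * m = xN r * (int l * m)] (mod 24)"
      unfolding cong_iff_dvd_diff using lx by simp
  qed simp
  ultimately show ?thesis by (simp add: H_def)
qed

text \<open>The restrictions on the bottom row are removed by translations through multiples of l,
  under which H is invariant, and by passing to the negative matrix; for s = 0 the matrix is itself
  such a translation.\<close>

lemma H_stabilizer:
  assumes "(p, int l * q, s, t) \<in> G0 N" "\<tau> \<in> HH"
  shows "H (act (p, int l * q, s, t) \<tau>) = H \<tau>"
proof -
  have pos: "H (act (p, int l * q, s, t) \<tau>) = H \<tau>"
    if g: "(p, int l * q, s, t) \<in> G0 N" and s: "s > 0" and \<tau>: "\<tau> \<in> HH" for p q s t \<tau>
  proof -
    have det: "p * t - int l * q * s = 1" using g by (simp add: G0_def)
    obtain s' where s': "s = int N * s'" using g by (auto simp: G0_def)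
    have s'0: "s' > 0" using s N_pos by (simp add: s' zero_less_mult_iff)
    define m0 where "m0 = \<bar>t\<bar> + 1"
    have ls: "s * int l \<ge> 1" using s l_pos by (simp add: int_one_le_iff_zero_less)
    have big: "t + s * int l * m > 0" if "m \<ge> m0" for m
    proof -
      have "1 * m \<le> s * int l * m" using ls that by (intro mult_right_mono) (auto simp: m0_def)
      then show ?thesis using that unfolding m0_def by linarith
    qed
    \<comment> \<open>If \<open>s * l\<close> is even, the determinant makes t odd and every m
      works; otherwise consecutive m alternate in parity.\<close>
    have "\<exists>m\<ge>m0. odd (t + s * int l * m)"
    proof (cases "odd (t + s * int l * m0)")
      case True
      then show ?thesis by blast
    next
      case False
      have "odd (s * int l)"
      proof
        assume ev: "even (s * int l)"
        then have "even t" using False by simp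
        moreover have "even (int l * q * s)" using ev by auto
        ultimately have "even (p * t - int l * q * s)" by simp
        then show False unfolding det by simp
      qed
      then have "odd (t + s * int l * (m0 + 1))" using False by (auto simp: distrib_left)
      then show ?thesis by (intro exI[of _ "m0 + 1"]) simp
    qed
    then obtain m where m: "m \<ge> m0" "odd (t + s * int l * m)" by blast
    have g': "(p, int l * (q + p * m), int N * s', t + s * int l * m) \<in> G0 N"
      using det by (simp add: G0_def s' algebra_simps)
    define \<sigma> where "\<sigma> = \<tau> - of_int (int l * m)"
    have \<sigma>: "\<sigma> \<in> HH" using \<tau> by (simp add: HH_def \<sigma>_def)
    have "act (p, int l * q, s, t) \<tau> = act (p, int l * (q + p * m), int N * s', t + s * int l * m) \<sigma>"
      by (simp add: \<sigma>_def s' algebra_simps)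
    also have "H \<dots> = H \<sigma>"
      by (rule H_stabilizer_aux[OF g' s'0 big[OF m(1)] m(2) \<sigma>])
    also have "\<dots> = H \<tau>" using H_translate[of \<sigma> m] by (simp add: \<sigma>_def)
    finally show ?thesis .
  qed
  have det: "p * t - int l * q * s = 1" using assms(1) by (simp add: G0_def)
  consider "s > 0" | "s < 0" | "s = 0" by linarith
  then show ?thesis
  proof cases
    case 1
    then show ?thesis using pos assms by blast
  next
    case 2
    have g: "(- p, int l * (- q), - s, - t) \<in> G0 N" using assms(1) by (simp add: G0_def)
    have "act (p, int l * q, s, t) \<tau> = act (- p, int l * (- q), - s, - t) \<tau>"
    proof -
      have "(of_int (- p) * \<tau> + of_int (int l * (- q))) = - (of_int p * \<tau> + of_int (int l * q))"
        "(of_int (- s) * \<tau> + of_int (- t)) = - (of_int s * \<tau> + of_int t)" by simp_all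
      then show ?thesis unfolding act.simps by (simp only: minus_divide_divide)
    qed
    then show ?thesis using pos[OF g _ assms(2)] 2 by simp
  next
    case 3
    then have "p * t = 1" using det by simp
    then have "p = 1 \<and> t = 1 \<or> p = -1 \<and> t = -1" by (simp add: zmult_eq_1_iff)
    then have "act (p, int l * q, s, t) \<tau> = \<tau> + of_int (int l * (q * p))"
      using 3 by auto
    then show ?thesis by (simp only: H_translate)
  qed
qed

definition K :: "nat \<Rightarrow> nat \<Rightarrow> complex \<Rightarrow> complex" where
  "K a b \<tau> = wgt a b * of_real (real (l div a) powr (- wt r))
     * f ((of_nat a * \<tau> + of_nat b) / of_nat (l div a)) / f \<tau>"

lemma K_1_0: "K 1 0 \<tau> = wgt 1 0 * of_real (real l powr (- wt r)) * H \<tau>"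
  by (simp add: K_def H_def)

definition IDX :: "(nat \<times> nat) set" where
  "IDX = {(a, b). a dvd l \<and> coprime a N \<and> b < l div a \<and> gcd (gcd a b) (l div a) = 1}"

definition rep :: "nat \<Rightarrow> nat \<Rightarrow> mat2" where
  "rep a b = (int a, int b, 0, int (l div a))"

text \<open>Take \<gamma> = (a, b1; N s', t), where b1 = b + d m is prime to a. Then \<gamma>' is
  (1, 0; N s' d, 1) times the translation by m, so f at \<gamma> \<tau> / l is evaluated by one
  transformation law and one translation.\<close>

lemma K_orbit:
  assumes "(a, b) \<in> IDX"
  obtains \<gamma> \<gamma>' where "\<gamma> \<in> G0 N" "\<gamma>' \<in> G0 N" "mm (1, 0, 0, int l) \<gamma> = mm \<gamma>' (rep a b)"
    "\<And>\<tau>. \<tau> \<in> HH \<Longrightarrow> K 1 0 (act \<gamma> \<tau>) = K a b \<tau>"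
proof -
  define d where "d = l div a"
  have ad: "a * d = l" and co: "coprime a N" and g1: "gcd (gcd a b) d = 1"
    using assms by (auto simp: IDX_def d_def)
  have a0: "a > 0" "d > 0" using ad l_pos by (auto intro!: gr0I)
  obtain m where m: "m > 0" "coprime a (b + d * m)"
    using coprime_shift_exists[OF a0 g1] by blast
  define b1 where "b1 = int b + int d * int m"
  have b1: "b1 > 0" "coprime (int a) b1"
  proof -
    show "b1 > 0" using a0 m(1) by (simp add: b1_def add_nonneg_pos)
    have "b1 = int (b + d * m)" by (simp add: b1_def)
    then show "coprime (int a) b1" using m(2) by (metis coprime_int_iff)
  qed
  obtain s' t where st: "s' > 0" "t > 0" "odd t" "int a * t - b1 * (int N * s') = 1"
    "odd (int a) \<Longrightarrow> 8 dvd s'" "\<not> 3 dvd int a \<Longrightarrow> 3 dvd s'"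
    using bottom_row_exists[of "int a" b1 "int N"] a0 b1 N_pos co by auto
  define s where "s = int N * s'"
  have wr: "wgt 1 0 * chi r 1 0 (int N * (s' * int d)) 1 1 * ee (of_int (xN r * int m) / 24)
       = wgt a b * chi r (int a) b1 (int N * s') t 1"
  proof (rule weight_relation[OF ad co b1(2) b1_def b1(1) st(1-4)])
    show "odd a \<Longrightarrow> 8 dvd s'" using st(5) by simp
    show "\<not> 3 dvd a \<Longrightarrow> 3 dvd s'" using st(6) by (metis int_dvd_int_iff of_nat_numeral)
  qed
  have s0: "s > 0" using st(1) N_pos by (simp add: s_def)
  have det: "int a * t = 1 + b1 * s" using st(4) by (simp add: s_def)
  have adi: "int a * int d = int l" using ad by (metis of_nat_mult)
  have g: "(int a, b1, s, t) \<in> G0 N" using st(4) by (simp add: G0_def s_def)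
  have g': "(1, int m, s * int d, 1 + s * int d * int m) \<in> G0 N" by (simp add: G0_def s_def)
  have eq: "mm (1, 0, 0, int l) (int a, b1, s, t) = mm (1, int m, s * int d, 1 + s * int d * int m) (rep a b)"
  proof -
    have "int l * s = s * int d * int a" by (simp add: adi[symmetric])
    moreover have "int l * t = s * int d * int b + (1 + s * int d * int m) * int d"
    proof -
      have "int l * t = int d * (int a * t)" by (simp add: adi[symmetric])
      then show ?thesis unfolding det b1_def by (simp add: algebra_simps)
    qed
    ultimately show ?thesis by (simp add: rep_def d_def[symmetric] b1_def)
  qed
  have Keq: "K 1 0 (act (int a, b1, s, t) \<tau>) = K a b \<tau>" if \<tau>: "\<tau> \<in> HH" for \<tau>
  proof -
    define w where "w = of_int s * \<tau> + of_int t"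
    have w: "w \<noteq> 0" unfolding w_def using denom_nonzero[OF \<tau>, of s t] s0 by simp
    define \<sigma> where "\<sigma> = (of_nat a * \<tau> + of_int b1) / of_nat d"
    define \<rho> where "\<rho> = (of_nat a * \<tau> + of_nat b) / of_nat d"
    have nz: "(of_nat d :: complex) \<noteq> 0" "(of_nat a :: complex) \<noteq> 0" using a0 by auto
    have \<sigma>\<rho>: "\<sigma> = \<rho> + of_int (int m)" using nz by (simp add: \<sigma>_def \<rho>_def b1_def field_simps)
    have \<sigma>: "\<sigma> \<in> HH" using \<tau> a0 by (simp add: HH_def \<sigma>_def)
    \<comment> \<open>By the determinant condition the automorphy factor of (1, 0; s d, 1) at
      \<sigma> is a times that of \<gamma> at \<tau>; as a is positive, the square root
      splits.\<close>
    have den: "of_int (s * int d) * \<sigma> + of_int 1 = of_nat a * w"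
    proof -
      have "of_int (int a * t) = (of_int (1 + b1 * s) :: complex)" unfolding det ..
      then have d': "of_nat a * of_int t = 1 + of_int b1 * (of_int s :: complex)" by simp
      have "of_int (s * int d) * \<sigma> + of_int 1 = of_int s * (of_nat a * \<tau> + of_int b1) + 1"
        using nz by (simp add: \<sigma>_def)
      also have "\<dots> = of_nat a * w" unfolding w_def distrib_left d' by (simp add: algebra_simps)
      finally show ?thesis .
    qed
    have lad: "(of_nat l :: complex) = of_nat a * of_nat d" using ad by (metis of_nat_mult)
    have z1: "act (int a, b1, s, t) \<tau> / of_nat l = act (1, 0, s * int d, 1) \<sigma>"
    proof -
      have "act (1, 0, s * int d, 1) \<sigma> = \<sigma> / (of_nat a * w)" using den by simp
      also have "\<dots> = act (int a, b1, s, t) \<tau> / of_nat l"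
        unfolding lad by (simp add: \<sigma>_def w_def mult_ac)
      finally show ?thesis by simp
    qed
    have g1: "(1, 0, s * int d, 1) \<in> G0 N" by (simp add: G0_def s_def)
    have cs: "csqrt (of_nat a * w) powi wt2 r = of_real (real a powr wt r) * csqrt w powi wt2 r"
    proof -
      have "csqrt (of_nat a * w) = of_real (sqrt (real a)) * csqrt w"
        using csqrt_mult_of_real[of "real a" w] a0 by simp
      then show ?thesis using sqrt_powi[of "real a" "wt2 r"] a0
        by (simp add: power_int_mult_distrib wt_def flip: of_real_power_int)
    qed
    have f1: "f (act (int a, b1, s, t) \<tau> / of_nat l)
       = chi r 1 0 (s * int d) 1 1 * (of_real (real a powr wt r) * csqrt w powi wt2 r)
         * (ee (of_int (xN r * int m) / 24) * f \<rho>)"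
      unfolding z1 f_act[OF g1 \<sigma>] den cs unfolding \<sigma>\<rho> eta_quot_add_int ..
    have f2: "f (act (int a, b1, s, t) \<tau>) = chi r (int a) b1 s t 1 * csqrt w powi wt2 r * f \<tau>"
      using f_act[OF g \<tau>] by (simp only: w_def)
    have wr': "wgt 1 0 * chi r 1 0 (s * int d) 1 1 * ee (of_int (xN r * int m) / 24)
       = wgt a b * chi r (int a) b1 s t 1" using wr by (simp add: s_def mult.assoc)
    \<comment> \<open>The power of a released by the square root turns the normalization of (1, 0;
      0, l) into that of (a, b; 0, d), because l = a d.\<close>
    have pw: "real l powr (- wt r) * real a powr wt r = real d powr (- wt r)"
    proof -
      have "real l = real a * real d" using ad by (metis of_nat_mult)
      then show ?thesis using a0 by (simp add: powr_mult powr_minus field_simps)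
    qed
    have "K 1 0 (act (int a, b1, s, t) \<tau>)
       = (wgt 1 0 * chi r 1 0 (s * int d) 1 1 * ee (of_int (xN r * int m) / 24))
          * of_real (real l powr (- wt r) * real a powr wt r) * f \<rho> / (chi r (int a) b1 s t 1 * f \<tau>)"
      unfolding K_1_0 H_def f1 f2 using w by simp
    also have "\<dots> = wgt a b * of_real (real d powr (- wt r)) * f \<rho> / f \<tau>"
      unfolding wr' pw using chi_nonzero[of r "int a" b1 s t] by simp
    also have "\<dots> = K a b \<tau>" by (simp add: K_def \<rho>_def d_def)
    finally show ?thesis .
  qed
  show ?thesis by (rule that[OF g g' eq Keq])
qed

lemma det2_rep: "a dvd l \<Longrightarrow> det2 (rep a b) = int l"
  by (simp add: rep_def flip: of_nat_mult)

text \<open>Both representatives are pulled back to (1, 0; 0, l) by \<open>K_orbit\<close>. The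
  transition matrix \<delta> then satisfies diag(1, l) \<delta> = \<epsilon> diag(1, l), so its
  upper right entry is divisible by l and \<open>H_stabilizer\<close> applies.\<close>

lemma K_step:
  assumes A: "(a, b) \<in> IDX" and A': "(a', b') \<in> IDX" and \<gamma>: "\<gamma> \<in> G0 N" "\<gamma>' \<in> G0 N"
    and eq: "mm (rep a b) \<gamma> = mm \<gamma>' (rep a' b')" and \<tau>: "\<tau> \<in> HH"
  shows "K a b (act \<gamma> \<tau>) = K a' b' \<tau>"
proof -
  obtain g0 g1 where g: "g0 \<in> G0 N" "g1 \<in> G0 N" "mm (1, 0, 0, int l) g0 = mm g1 (rep a b)"
    and Kg: "\<And>\<tau>. \<tau> \<in> HH \<Longrightarrow> K 1 0 (act g0 \<tau>) = K a b \<tau>"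
    using K_orbit[OF A] by blast
  obtain h0 h1 where h: "h0 \<in> G0 N" "h1 \<in> G0 N" "mm (1, 0, 0, int l) h0 = mm h1 (rep a' b')"
    and Kh: "\<And>\<tau>. \<tau> \<in> HH \<Longrightarrow> K 1 0 (act h0 \<tau>) = K a' b' \<tau>"
    using K_orbit[OF A'] by blast
  define \<delta> where "\<delta> = mm (mm g0 \<gamma>) (adj2 h0)"
  define \<epsilon> where "\<epsilon> = mm (mm g1 \<gamma>') (adj2 h1)"
  have \<delta>: "\<delta> \<in> G0 N" unfolding \<delta>_def using g h \<gamma> by (intro G0_mm G0_adj)
  note dets = det2_G0[OF h(1)] det2_G0[OF h(2)] det2_G0[OF g(1)] det2_G0[OF \<gamma>(1)]
  have "rep a' b' = mm (adj2 h1) (mm (1, 0, 0, int l) h0)"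
    unfolding h(3) using mm_adj_cancel(3)[OF dets(2)] by simp
  then have "mm (1, 0, 0, int l) \<delta> = mm (mm (mm g1 \<gamma>') (mm (adj2 h1) (mm (1, 0, 0, int l) h0))) (adj2 h0)"
    unfolding \<delta>_def mm_assoc[symmetric] g(3) by (simp only: mm_assoc eq) 
  also have "\<dots> = mm \<epsilon> (1, 0, 0, int l)"
    using mm_adj_cancel(1)[OF dets(1)] by (simp add: \<epsilon>_def flip: mm_assoc)
  finally have eq2: "mm (1, 0, 0, int l) \<delta> = mm \<epsilon> (1, 0, 0, int l)" .
  obtain p q s t where d4: "\<delta> = (p, q, s, t)" by (cases \<delta>)
  obtain p' q' s' t' where e4: "\<epsilon> = (p', q', s', t')" by (cases \<epsilon>)
  have q: "q = int l * q'" using eq2 by (simp add: d4 e4 mult.commute)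
  have h\<tau>: "act h0 \<tau> \<in> HH" "act \<gamma> \<tau> \<in> HH" using act_in_HH[OF \<tau>] dets by auto
  have "K 1 0 (act \<delta> (act h0 \<tau>)) = K 1 0 (act h0 \<tau>)"
    unfolding K_1_0 d4 q using H_stabilizer[of p q' s t "act h0 \<tau>"] \<delta> h\<tau>(1) by (simp add: d4 q)
  moreover have "act \<delta> (act h0 \<tau>) = act g0 (act \<gamma> \<tau>)"
  proof -
    have "act \<delta> (act h0 \<tau>) = act (mm \<delta> h0) \<tau>"
      using \<tau> dets det2_G0[OF \<delta>] by (simp add: act_mm)
    also have "mm \<delta> h0 = mm g0 \<gamma>" unfolding \<delta>_def using mm_adj_cancel(2)[OF dets(1)] by simp
    also have "act (mm g0 \<gamma>) \<tau> = act g0 (act \<gamma> \<tau>)" using \<tau> dets by (simp add: act_mm)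
    finally show ?thesis .
  qed
  ultimately show ?thesis using Kg[OF h\<tau>(2)] Kh[OF \<tau>] by simp
qed

end

section \<open>The Hecke sum as a modular form\<close>

text \<open>Bezout coefficients of the first column clear its lower entry, and division with
  remainder reduces the upper right one. The equations for the first column serve to control the
  lower left entry of the unimodular factor.\<close>

lemma hermite_form:
  fixes P Q R S :: int
  assumes "P * S - Q * R = L" "L > 0"
  obtains p q s t b d where "p * t - q * s = 1" "gcd P R > 0" "d > 0" "gcd P R * d = L" "0 \<le> b" "b < d"
    "mm (p, q, s, t) (gcd P R, b, 0, d) = (P, Q, R, S)" "p * gcd P R = P" "s * gcd P R = R"
proof -
  define a where "a = gcd P R"
  have "P \<noteq> 0 \<or> R \<noteq> 0" using assms by auto
  then have a0: "a > 0" by (simp add: a_def)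
  obtain p s where p: "P = p * a" and s: "R = s * a" using a_def by (metis dvdE gcd_dvd1 gcd_dvd2 mult.commute)
  obtain v u' where "v * P + u' * R = a" using bezout_int[of P R] unfolding a_def by blast
  then have "a * (v * p + u' * s) = a * 1" unfolding p s by (simp add: algebra_simps)
  then have bz: "v * p + u' * s = 1" using a0 by simp
  define u where "u = - u'"
  have pv: "p * v - s * u = 1" using bz by (simp add: u_def algebra_simps)
  \<comment> \<open>The second column after multiplication by the inverse of (p, u; s, v).\<close>
  define B D where "B = v * Q - u * S" and "D = p * S - s * Q"
  have aD: "a * D = L" using assms(1) unfolding D_def p s by (simp add: algebra_simps)
  then have D0: "D > 0" using a0 assms(2) by (metis zero_less_mult_pos)
  define b k where "b = B mod D" and "k = B div D"
  have Bk: "B = b + k * D" by (simp add: b_def k_def)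
  have 1: "p * b + (p * k + u) * D = Q"
  proof -
    have "p * b + (p * k + u) * D = p * B + u * D" unfolding Bk by (simp add: algebra_simps)
    also have "\<dots> = (p * v - s * u) * Q" unfolding B_def D_def by (simp add: algebra_simps)
    finally show ?thesis using pv by simp
  qed
  have 2: "s * b + (s * k + v) * D = S"
  proof -
    have "s * b + (s * k + v) * D = s * B + v * D" unfolding Bk by (simp add: algebra_simps)
    also have "\<dots> = (p * v - s * u) * S" unfolding B_def D_def by (simp add: algebra_simps)
    finally show ?thesis using pv by simp
  qed
  have M: "mm (p, p * k + u, s, s * k + v) (gcd P R, b, 0, D) = (P, Q, R, S)"
    unfolding a_def[symmetric] mm.simps using 1 2 p s by simp
  have det: "p * (s * k + v) - (p * k + u) * s = 1" using pv by (simp add: algebra_simps)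
  have b: "0 \<le> b" "b < D" using D0 by (simp_all add: b_def)
  show ?thesis
    by (rule that[OF det a0[unfolded a_def] D0 aD[unfolded a_def] b M p[symmetric, unfolded a_def]
        s[symmetric, unfolded a_def]])
qed

context eta_hecke_form
begin

lemma IDX_D:
  assumes "(a, b) \<in> IDX"
  shows "a dvd l" "coprime a N" "b < l div a" "gcd (gcd a b) (l div a) = 1" "a > 0" "l div a > 0" "a * (l div a) = l"
  using assms l_pos by (auto simp: IDX_def intro!: gr0I dest: dvd_imp_le)

lemma IDX_Sigma: "IDX = (SIGMA a:{a. a dvd l \<and> coprime a N}. {b. b < l div a \<and> gcd (gcd a b) (l div a) = 1})"
  by (auto simp: IDX_def)

lemma finite_IDX: "finite IDX"
  unfolding IDX_Sigma using l_pos by (intro finite_SigmaI) (auto intro: finite_subset[OF _ finite_divisors_nat[of l]])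

text \<open>The Hermite form of the product is the new representative. Three properties must
  survive: the first diagonal entry is prime to N, the left factor lies in \<open>G0 N\<close>, and
  the matrix is primitive.\<close>

lemma rep_step:
  assumes "(a, b) \<in> IDX" "\<gamma> \<in> G0 N"
  shows "\<exists>A' \<gamma>'. A' \<in> IDX \<and> \<gamma>' \<in> G0 N \<and> mm (rep a b) \<gamma> = mm \<gamma>' (rep (fst A') (snd A'))"
proof -
  note A = IDX_D[OF assms(1)]
  define d where "d = l div a"
  obtain p q s t where \<gamma>: "\<gamma> = (p, q, s, t)" by (cases \<gamma>)
  have det: "p * t - q * s = 1" and Ns: "int N dvd s" using assms(2) by (auto simp: \<gamma> G0_def)
  obtain P Q R S where M: "mm (rep a b) \<gamma> = (P, Q, R, S)" by (metis prod_cases4)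
  have PR: "P = int a * p + int b * s" "R = int d * s"
    using M by (simp_all add: rep_def \<gamma> d_def)
  have "det2 (mm (rep a b) \<gamma>) = int l" using det2_rep[OF A(1)] det2_G0[OF assms(2)] by (simp add: det2_mm)
  then have "P * S - Q * R = int l" by (simp add: M)
  from hermite_form[OF this] l_pos obtain p' q' s' t' b' d' where h:
    "p' * t' - q' * s' = 1" "gcd P R > 0" "d' > 0" "gcd P R * d' = int l" "0 \<le> b'" "b' < d'"
    "mm (p', q', s', t') (gcd P R, b', 0, d') = (P, Q, R, S)" "p' * gcd P R = P" "s' * gcd P R = R"
    by (metis of_nat_0_less_iff)
  define a' where "a' = gcd P R"
  \<comment> \<open>N divides s, so modulo N the entry P is a p, a product of units.\<close>
  have coP: "coprime P (int N)"
  proof -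
    have "coprime p s" using det by (intro coprime_of_det[of t p q s]) (simp add: mult.commute)
    then have "coprime p (int N)" using Ns by (meson coprime_divisors dvd_refl)
    then have "coprime (int a * p) (int N)" using A(2) by simp
    moreover have "[P = int a * p] (mod int N)" using Ns by (simp add: PR cong_iff_dvd_diff)
    ultimately show ?thesis by (metis cong_imp_coprime cong_sym)
  qed
  then have coa: "coprime a' (int N)" unfolding a'_def by (meson coprime_divisors dvd_refl gcd_dvd1)
  have "int N dvd s' * a'" using h(9) Ns PR(2) by (simp add: a'_def)
  then have "int N dvd s'" using coa by (simp add: coprime_dvd_mult_left_iff coprime_commute)
  then have g': "(p', q', s', t') \<in> G0 N" using h(1) by (simp add: G0_def)
  define na nb where "na = nat a'" and "nb = nat b'"
  have ia: "int na = a'" "int nb = b'" using h(2,5) by (simp_all add: na_def nb_def a'_def)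
  have nad: "na dvd l"
  proof -
    have "int na dvd int l" using h(4) ia by (metis a'_def dvd_triv_left)
    then show ?thesis by simp
  qed
  have id: "int (l div na) = d'"
  proof -
    have "int l = int na * d'" using h(4) ia by (simp add: a'_def)
    then show ?thesis using h(2) ia by (simp add: zdiv_int a'_def)
  qed
  have rep': "rep na nb = (gcd P R, b', 0, d')" by (simp add: rep_def ia id a'_def)
  have eq: "mm (rep a b) \<gamma> = mm (p', q', s', t') (rep na nb)" unfolding rep' h(7) M ..
  \<comment> \<open>Matrices of determinant 1 are invertible over the integers, so a common divisor
    of the new entries also divides the old ones.\<close>
  have prim: "gcd (gcd na nb) (l div na) = 1"
  proof -
    define e where "e = int (gcd (gcd na nb) (l div na))"
    have "e dvd int na" "e dvd int nb" "e dvd int (l div na)"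
      unfolding e_def int_dvd_int_iff by (meson dvd_trans gcd_dvd1 gcd_dvd2)+
    then have ediv: "e dvd gcd P R" "e dvd b'" "e dvd d'" by (simp_all add: ia id a'_def)
    have "e dvd P" "e dvd Q" "e dvd R" "e dvd S"
      using h(7) ediv by (auto simp del: gcd_dvd1 gcd_dvd2)
    moreover have "rep a b = mm (P, Q, R, S) (adj2 \<gamma>)"
      using mm_adj_cancel(1)[OF det2_G0[OF assms(2)], of "rep a b"] unfolding M by simp
    ultimately have "e dvd int a" "e dvd int b" "e dvd int d"
      by (auto simp: rep_def \<gamma> d_def)
    then have "e dvd int (gcd (gcd a b) d)" by (simp add: e_def)
    then show ?thesis using A(4) by (simp add: d_def e_def)
  qed
  have "(na, nb) \<in> IDX"
    unfolding IDX_def using nad prim coa ia h(6) id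
    by (auto simp: coprime_int_iff[symmetric] simp del: coprime_int_iff)
  then show ?thesis using g' eq by (intro exI[of _ "(na, nb)"] exI[of _ "(p', q', s', t')"]) simp
qed

text \<open>Comparing entries forces \<gamma> to be a translation, and 0 \<le> b < d leaves only the
  trivial one.\<close>

lemma rep_unique:
  assumes "(a, b) \<in> IDX" "(a', b') \<in> IDX" "det2 \<gamma> = 1" "rep a b = mm \<gamma> (rep a' b')"
  shows "(a, b) = (a', b')"
proof -
  note A = IDX_D[OF assms(1)] and A' = IDX_D[OF assms(2)]
  define d d' where "d = l div a" and "d' = l div a'"
  obtain p q s t where \<gamma>: "\<gamma> = (p, q, s, t)" by (cases \<gamma>)
  have e: "int a = p * int a'" "int b = p * int b' + q * int d'" "0 = s * int a'" "int d = s * int b' + t * int d'"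
    using assms(4) by (simp_all add: rep_def \<gamma> d_def d'_def)
  have "s = 0" using e(3) A'(5) by simp
  then have pt: "p * t = 1" using assms(3) by (simp add: \<gamma>)
  have "p > 0" using e(1) A(5) A'(5) by (metis of_nat_0_less_iff zero_less_mult_pos2)
  then have p1: "p = 1" "t = 1" using pt by (auto simp: zmult_eq_1_iff)
  have aa: "a = a'" using e(1) p1 by simp
  then have dd: "d = d'" by (simp add: d_def d'_def)
  have b: "int b = int b' + q * int d'" using e(2) p1 by simp
  have "int b < int d'" "int b' < int d'" using A(3) A'(3) dd by (simp_all add: d_def d'_def)
  have "int b mod int d' = int b' mod int d'" using b by simp
  then have "b = b'" using \<open>int b < int d'\<close> \<open>int b' < int d'\<close> by simp
  then show ?thesis using aa by simp
qed

text \<open>Uniqueness of representatives makes right multiplication by \<gamma> injective on the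
  index set, hence a permutation of this finite set, and the terms are merely rearranged.\<close>

lemma sum_K_invariant:
  assumes "\<gamma> \<in> G0 N" "\<tau> \<in> HH"
  shows "(\<Sum>(a, b)\<in>IDX. K a b (act \<gamma> \<tau>)) = (\<Sum>(a, b)\<in>IDX. K a b \<tau>)"
proof -
  have "\<forall>A\<in>IDX. \<exists>A'. A' \<in> IDX \<and> (\<exists>\<gamma>'\<in>G0 N. mm (rep (fst A) (snd A)) \<gamma> = mm \<gamma>' (rep (fst A') (snd A')))"
    using rep_step[OF _ assms(1)] by (metis prod.collapse)
  then obtain h where h: "\<And>A. A \<in> IDX \<Longrightarrow> h A \<in> IDX"
    "\<And>A. A \<in> IDX \<Longrightarrow> \<exists>\<gamma>'\<in>G0 N. mm (rep (fst A) (snd A)) \<gamma> = mm \<gamma>' (rep (fst (h A)) (snd (h A)))"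
    by (metis (no_types, lifting))
  have "inj_on h IDX"
  proof (rule inj_onI)
    fix A B assume AB: "A \<in> IDX" "B \<in> IDX" "h A = h B"
    obtain g1 where g1: "g1 \<in> G0 N" "mm (rep (fst A) (snd A)) \<gamma> = mm g1 (rep (fst (h A)) (snd (h A)))"
      using h(2)[OF AB(1)] by blast
    obtain g2 where g2: "g2 \<in> G0 N" "mm (rep (fst B) (snd B)) \<gamma> = mm g2 (rep (fst (h A)) (snd (h A)))"
      using h(2)[OF AB(2)] AB(3) by metis
    note dets = det2_G0[OF assms(1)] det2_G0[OF g1(1)] det2_G0[OF g2(1)]
    have "rep (fst (h A)) (snd (h A)) = mm (adj2 g2) (mm (rep (fst B) (snd B)) \<gamma>)"
      unfolding g2(2) using mm_adj_cancel(3)[OF dets(3)] by simp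
    then have "mm (rep (fst A) (snd A)) \<gamma> = mm (mm (mm g1 (adj2 g2)) (rep (fst B) (snd B))) \<gamma>"
      unfolding g1(2) by (simp add: mm_assoc)
    then have "rep (fst A) (snd A) = mm (mm g1 (adj2 g2)) (rep (fst B) (snd B))"
      using mm_adj_cancel(1)[OF dets(1)] by metis
    moreover have "det2 (mm g1 (adj2 g2)) = 1"
      using det2_G0[OF G0_mm[OF g1(1) G0_adj[OF g2(1)]]] .
    ultimately show "A = B"
      using rep_unique[of "fst A" "snd A" "fst B" "snd B"] AB by simp
  qed
  then have bij: "bij_betw h IDX IDX"
    using h(1) finite_IDX by (simp add: bij_betw_def endo_inj_surj image_subset_iff)
  have "(\<Sum>A\<in>IDX. K (fst A) (snd A) (act \<gamma> \<tau>)) = (\<Sum>A\<in>IDX. K (fst (h A)) (snd (h A)) \<tau>)"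
  proof (rule sum.cong)
    fix A assume A: "A \<in> IDX"
    obtain \<gamma>' where "\<gamma>' \<in> G0 N" "mm (rep (fst A) (snd A)) \<gamma> = mm \<gamma>' (rep (fst (h A)) (snd (h A)))"
      using h(2)[OF A] by blast
    then show "K (fst A) (snd A) (act \<gamma> \<tau>) = K (fst (h A)) (snd (h A)) \<tau>"
      using K_step[of "fst A" "snd A" "fst (h A)" "snd (h A)" \<gamma> \<gamma>' \<tau>] A h(1)[OF A] assms by simp
  qed simp
  also have "\<dots> = (\<Sum>A\<in>IDX. K (fst A) (snd A) \<tau>)"
    by (rule sum.reindex_bij_betw[OF bij])
  finally show ?thesis by (simp add: case_prod_beta)
qed

definition coef :: "nat \<Rightarrow> nat \<Rightarrow> complex" where
  "coef a b = wgt a b * of_real (real (l div a) powr (- wt r))"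

definition hecke :: "complex \<Rightarrow> complex" where
  "hecke \<tau> = (\<Sum>(a, b)\<in>IDX. coef a b * f ((of_nat a * \<tau> + of_nat b) / of_nat (l div a)))"

lemma hecke_eq: "\<tau> \<in> HH \<Longrightarrow> hecke \<tau> = f \<tau> * (\<Sum>(a, b)\<in>IDX. K a b \<tau>)"
  using f_nonzero[of \<tau>] by (simp add: hecke_def K_def coef_def sum_distrib_left case_prod_beta)

text \<open>As f times an invariant function, the sum inherits the character and the chosen root,
  including the sign \<epsilon>, from f.\<close>

lemma transforms_hecke: "transforms r hecke"
  unfolding transforms_def
proof (intro allI impI ballI)
  fix p q s t :: int and \<epsilon> \<tau> :: complex
  assume g: "p * t - q * s = 1 \<and> int N dvd s \<and> (\<epsilon> = 1 \<or> \<epsilon> = -1)" and \<tau>: "\<tau> \<in> HH"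
  define k where "k = (\<Sum>(a, b)\<in>IDX. K a b \<tau>)"
  have G: "(p, q, s, t) \<in> G0 N" using g by (simp add: G0_def)
  have "act (p, q, s, t) \<tau> \<in> HH"
    by (rule act_in_HH[OF \<tau>]) (simp add: det2_G0[OF G] del: det2.simps)
  then have "hecke (act (p, q, s, t) \<tau>) = f (act (p, q, s, t) \<tau>) * k"
    using sum_K_invariant[OF G \<tau>] by (simp only: hecke_eq k_def)
  then have "slash r hecke p q s t \<epsilon> \<tau> = slash r f p q s t \<epsilon> \<tau> * k"
    by (simp add: slash_def)
  also have "slash r f p q s t \<epsilon> \<tau> = chi r p q s t \<epsilon> * f \<tau>"
    using transforms_f g \<tau> unfolding transforms_def by blast
  finally show "slash r hecke p q s t \<epsilon> \<tau> = chi r p q s t \<epsilon> * hecke \<tau>"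
    using \<tau> by (simp add: hecke_eq k_def)
qed

lemma affine_in_HH:
  assumes "a > 0" "d > 0" "\<tau> \<in> HH"
  shows "(of_nat a * \<tau> + of_nat b) / of_nat d \<in> HH"
  using assms by (simp add: HH_def)

lemma holomorphic_hecke:
  assumes "f holomorphic_on HH"
  shows "hecke holomorphic_on HH"
  unfolding hecke_def case_prod_beta
proof (intro holomorphic_intros)
  fix A assume A: "A \<in> IDX"
  then have ad: "fst A > 0" "l div fst A > 0" using IDX_D[of "fst A" "snd A"] by auto
  have "f \<circ> (\<lambda>\<tau>. (of_nat (fst A) * \<tau> + of_nat (snd A)) / of_nat (l div fst A)) holomorphic_on HH"
    by (rule holomorphic_on_compose_gen[OF _ assms])
       (use ad affine_in_HH in \<open>auto intro!: holomorphic_intros simp del: of_nat_div\<close>)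
  then show "(\<lambda>\<tau>. f ((of_nat (fst A) * \<tau> + of_nat (snd A)) / of_nat (l div fst A))) holomorphic_on HH"
    by (simp add: comp_def)
qed

end

section \<open>Expansions in fractional powers of q\<close>

definition qexp :: "bool \<Rightarrow> (complex \<Rightarrow> complex) \<Rightarrow> bool" where
  "qexp strict u \<longleftrightarrow> (\<exists>h::nat. h > 0 \<and> (\<exists>co::nat \<Rightarrow> complex. (strict \<longrightarrow> co 0 = 0) \<and>
     (\<forall>\<tau>\<in>HH. (\<lambda>m. co m * exp (2 * pi * \<i> * of_nat m * \<tau> / of_nat h)) sums u \<tau>)))"

lemma cusp_expansions_qexp:
  "cusp_expansions strict r g \<longleftrightarrow> (\<forall>a b c d. a * d - b * c = 1 \<longrightarrow> qexp strict (slash r g a b c d 1))"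
  unfolding cusp_expansions_def qexp_def ..

lemma sums_dilate:
  fixes co :: "nat \<Rightarrow> complex" and e :: "nat \<Rightarrow> complex"
  assumes "k > 0" "(\<lambda>m. co m * e (k * m)) sums s"
  shows "(\<lambda>m. (if k dvd m then co (m div k) else 0) * e m) sums s"
proof -
  have "strict_mono (\<lambda>m. k * m)" using assms(1) by (simp add: strict_mono_def)
  moreover have "(if k dvd n then co (n div k) else 0) * e n = 0" if "n \<notin> range (\<lambda>m. k * m)" for n
    using that by (auto simp: image_iff dvd_def)
  ultimately show ?thesis
    using assms by (subst sums_mono_reindex[symmetric, where g = "\<lambda>m. k * m"]) auto
qed

text \<open>The substitution twists the coefficients by roots of unity, dilates the exponents by a
  and multiplies their denominator by d. The constant term stays in place, so strictness is
  kept.\<close>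

lemma qexp_affine:
  assumes "qexp strict u" "a > 0" "d > 0"
  shows "qexp strict (\<lambda>\<tau>. u ((of_nat a * \<tau> + of_nat b) / of_nat d))"
proof -
  from assms(1) obtain h co where h: "h > 0" "strict \<longrightarrow> co 0 = 0"
    "\<And>\<tau>. \<tau> \<in> HH \<Longrightarrow> (\<lambda>m. co m * exp (2 * pi * \<i> * of_nat m * \<tau> / of_nat h)) sums u \<tau>"
    unfolding qexp_def by blast
  define co1 where "co1 m = co m * exp (2 * pi * \<i> * of_nat m * of_nat b / of_nat (d * h))" for m
  define co2 where "co2 m = (if a dvd m then co1 (m div a) else 0)" for m
  have "(\<lambda>m. co2 m * exp (2 * pi * \<i> * of_nat m * \<tau> / of_nat (d * h))) sums u ((of_nat a * \<tau> + of_nat b) / of_nat d)"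
    if \<tau>: "\<tau> \<in> HH" for \<tau>
  proof -
    have "(of_nat a * \<tau> + of_nat b) / of_nat d \<in> HH" using assms(2,3) \<tau> by (simp add: HH_def)
    from h(3)[OF this] have "(\<lambda>m. co m * exp (2 * pi * \<i> * of_nat m * ((of_nat a * \<tau> + of_nat b) / of_nat d) / of_nat h))
      sums u ((of_nat a * \<tau> + of_nat b) / of_nat d)" .
    moreover have "co m * exp (2 * pi * \<i> * of_nat m * ((of_nat a * \<tau> + of_nat b) / of_nat d) / of_nat h)
       = co1 m * exp (2 * pi * \<i> * of_nat (a * m) * \<tau> / of_nat (d * h))" for m
    proof -
      have "2 * pi * \<i> * of_nat m * ((of_nat a * \<tau> + of_nat b) / of_nat d) / of_nat h
        = 2 * pi * \<i> * of_nat m * of_nat b / of_nat (d * h) + 2 * pi * \<i> * of_nat (a * m) * \<tau> / of_nat (d * h)"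
        using h(1) assms by (simp add: field_simps)
      then show ?thesis unfolding co1_def by (simp only: exp_add mult.assoc)
    qed
    ultimately have "(\<lambda>m. co1 m * exp (2 * pi * \<i> * of_nat (a * m) * \<tau> / of_nat (d * h)))
      sums u ((of_nat a * \<tau> + of_nat b) / of_nat d)" by simp
    from sums_dilate[OF assms(2), of co1 "\<lambda>m. exp (2 * pi * \<i> * of_nat m * \<tau> / of_nat (d * h))", OF this]
    show ?thesis unfolding co2_def .
  qed
  moreover have "d * h > 0" using assms h by simp
  moreover have "strict \<longrightarrow> co2 0 = 0" using h(2) by (simp add: co2_def co1_def)
  ultimately show ?thesis unfolding qexp_def by blast
qed

lemma qexp_rescale:
  assumes "k > 0" "h > 0"
    "\<And>\<tau>. \<tau> \<in> HH \<Longrightarrow> (\<lambda>m. co m * exp (2 * pi * \<i> * of_nat m * \<tau> / of_nat h)) sums u \<tau>" "\<tau> \<in> HH"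
  shows "(\<lambda>m. (if k dvd m then co (m div k) else 0) * exp (2 * pi * \<i> * of_nat m * \<tau> / of_nat (h * k))) sums u \<tau>"
proof (rule sums_dilate[OF assms(1)])
  have "2 * pi * \<i> * of_nat (k * m) * \<tau> / of_nat (h * k) = 2 * pi * \<i> * of_nat m * \<tau> / of_nat h" for m
    using assms(1,2) by (simp add: field_simps)
  then show "(\<lambda>m. co m * exp (2 * pi * \<i> * of_nat (k * m) * \<tau> / of_nat (h * k))) sums u \<tau>"
    using assms(3,4) by simp
qed

lemma qexp_add:
  assumes "qexp strict u" "qexp strict v"
  shows "qexp strict (\<lambda>\<tau>. u \<tau> + v \<tau>)"
proof -
  from assms(1) obtain h co where h: "h > 0" "strict \<longrightarrow> co 0 = 0"
    "\<And>\<tau>. \<tau> \<in> HH \<Longrightarrow> (\<lambda>m. co m * exp (2 * pi * \<i> * of_nat m * \<tau> / of_nat h)) sums u \<tau>"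
    unfolding qexp_def by blast
  from assms(2) obtain h' co' where h': "h' > 0" "strict \<longrightarrow> co' 0 = 0"
    "\<And>\<tau>. \<tau> \<in> HH \<Longrightarrow> (\<lambda>m. co' m * exp (2 * pi * \<i> * of_nat m * \<tau> / of_nat h')) sums v \<tau>"
    unfolding qexp_def by blast
  define c where "c m = (if h' dvd m then co (m div h') else 0) + (if h dvd m then co' (m div h) else 0)" for m
  have "(\<lambda>m. c m * exp (2 * pi * \<i> * of_nat m * \<tau> / of_nat (h * h'))) sums (u \<tau> + v \<tau>)" if "\<tau> \<in> HH" for \<tau>
    using sums_add[OF qexp_rescale[OF h'(1) h(1,3) that] qexp_rescale[OF h(1) h'(1,3) that]]
    unfolding c_def distrib_right mult.commute[of h' h] .
  moreover have "strict \<longrightarrow> c 0 = 0" using h(2) h'(2) by (simp add: c_def)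
  moreover have "h * h' > 0" using h h' by simp
  ultimately show ?thesis unfolding qexp_def by blast
qed

lemma qexp_cmult:
  assumes "qexp strict u"
  shows "qexp strict (\<lambda>\<tau>. k * u \<tau>)"
proof -
  from assms(1) obtain h co where h: "h > 0" "strict \<longrightarrow> co 0 = 0"
    "\<And>\<tau>. \<tau> \<in> HH \<Longrightarrow> (\<lambda>m. co m * exp (2 * pi * \<i> * of_nat m * \<tau> / of_nat h)) sums u \<tau>"
    unfolding qexp_def by blast
  have "(\<lambda>m. (k * co m) * exp (2 * pi * \<i> * of_nat m * \<tau> / of_nat h)) sums (k * u \<tau>)" if "\<tau> \<in> HH" for \<tau>
    using sums_mult[OF h(3)[OF that], of k] by (simp add: mult.assoc)
  then show ?thesis unfolding qexp_def using h(1,2) by (intro exI[of _ h] conjI exI[of _ "\<lambda>m. k * co m"]) auto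
qed

lemma qexp_sum:
  assumes "finite I" "\<And>i. i \<in> I \<Longrightarrow> qexp strict (u i)"
  shows "qexp strict (\<lambda>\<tau>. \<Sum>i\<in>I. u i \<tau>)"
  using assms
proof (induction I rule: finite_induct)
  case empty
  show ?case unfolding qexp_def by (intro exI[of _ 1] conjI exI[of _ "\<lambda>_. 0"]) auto
next
  case (insert i I)
  then show ?case by (simp add: qexp_add)
qed

lemma qexp_cong: "(\<And>\<tau>. \<tau> \<in> HH \<Longrightarrow> u \<tau> = v \<tau>) \<Longrightarrow> qexp strict u \<longleftrightarrow> qexp strict v"
  unfolding qexp_def by auto

context eta_hecke_form
begin

text \<open>Hermite reduction of the representative times a matrix of determinant 1 turns the
  summand into an affine substitution in the expansion of f at some cusp. The automorphy factors
  differ by the positive number d/nd, so their roots differ by a constant.\<close>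

lemma slash_rep:
  assumes A: "(a, b) \<in> IDX" and det: "p * t - q * s = 1" and c: "cusp_expansions strict r f"
  shows "qexp strict (\<lambda>\<tau>. csqrt (of_int s * \<tau> + of_int t) powi (- wt2 r)
     * f ((of_nat a * act (p, q, s, t) \<tau> + of_nat b) / of_nat (l div a)))"
proof -
  note A' = IDX_D[OF A]
  define d where "d = l div a"
  obtain P Q R S where M: "mm (rep a b) (p, q, s, t) = (P, Q, R, S)" by (metis prod_cases4)
  have RS: "R = int d * s" "S = int d * t" using M by (simp_all add: rep_def d_def)
  have "det2 (mm (rep a b) (p, q, s, t)) = int l" using det2_rep[OF A'(1)] det by (simp only: det2_mm det2.simps)
  then have "P * S - Q * R = int l" by (simp add: M)
  from hermite_form[OF this] l_pos obtain p' q' s' t' b' d' where h: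
    "p' * t' - q' * s' = 1" "gcd P R > 0" "d' > 0" "gcd P R * d' = int l" "0 \<le> b'" "b' < d'"
    "mm (p', q', s', t') (gcd P R, b', 0, d') = (P, Q, R, S)" "p' * gcd P R = P" "s' * gcd P R = R"
    by (metis of_nat_0_less_iff)
  define na nb nd where "na = nat (gcd P R)" and "nb = nat b'" and "nd = nat d'"
  have int: "gcd P R = int na" "b' = int nb" "d' = int nd" and pos: "na > 0" "nd > 0" "d > 0"
    using h A'(6) by (simp_all add: na_def nb_def nd_def d_def)
  define \<sigma> where "\<sigma> \<tau> = (of_nat na * \<tau> + of_nat nb) / of_nat nd" for \<tau> :: complex
  define u where "u = slash r f p' q' s' t' 1"
  have qu: "qexp strict (\<lambda>\<tau>. u (\<sigma> \<tau>))"
  proof -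
    have "qexp strict u" using c h(1) unfolding cusp_expansions_qexp u_def by blast
    from qexp_affine[OF this pos(1,2)] show ?thesis unfolding \<sigma>_def .
  qed
  define k where "k = complex_of_real (sqrt (real d / real nd)) powi (- wt2 r)"
  have main: "csqrt (of_int s * \<tau> + of_int t) powi (- wt2 r)
     * f ((of_nat a * act (p, q, s, t) \<tau> + of_nat b) / of_nat (l div a)) = inverse k * u (\<sigma> \<tau>)"
    if \<tau>: "\<tau> \<in> HH" for \<tau>
  proof -
    have "(of_nat a * act (p, q, s, t) \<tau> + of_nat b) / of_nat (l div a) = act (rep a b) (act (p, q, s, t) \<tau>)"
      by (simp add: rep_def)
    also have "\<dots> = act (mm (rep a b) (p, q, s, t)) \<tau>"
      using det2_rep[OF A'(1)] l_pos det by (intro act_mm[OF \<tau>, symmetric]) simp_all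
    also have "mm (rep a b) (p, q, s, t) = mm (p', q', s', t') (gcd P R, b', 0, d')"
      by (simp only: h(7) M)
    also have "act \<dots> \<tau> = act (p', q', s', t') (act (gcd P R, b', 0, d') \<tau>)"
      using h(1-4) l_pos by (intro act_mm[OF \<tau>]) simp_all
    also have "act (gcd P R, b', 0, d') \<tau> = \<sigma> \<tau>" by (simp add: \<sigma>_def int)
    finally have e1: "(of_nat a * act (p, q, s, t) \<tau> + of_nat b) / of_nat (l div a) = act (p', q', s', t') (\<sigma> \<tau>)" .
    have e2: "of_int s' * \<sigma> \<tau> + of_int t' = of_real (real d / real nd) * (of_int s * \<tau> + of_int t)"
    proof -
      have "s' * int na = int d * s" "s' * int nb + t' * int nd = int d * t"
        using h(7,9) RS int by auto
      then have "of_int (s' * int na) = (of_int (int d * s) :: complex)"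
        "of_int (s' * int nb + t' * int nd) = (of_int (int d * t) :: complex)" by presburger+
      then have "of_int s' * of_nat na = of_nat d * (of_int s :: complex)"
        "of_int s' * of_nat nb + of_int t' * of_nat nd = of_nat d * (of_int t :: complex)" by simp_all
      moreover have "of_int s' * \<sigma> \<tau> + of_int t' = ((of_int s' * of_nat na) * \<tau> + (of_int s' * of_nat nb + of_int t' * of_nat nd)) / of_nat nd"
        using pos by (simp add: \<sigma>_def field_simps)
      ultimately have "of_int s' * \<sigma> \<tau> + of_int t' = (of_nat d * of_int s * \<tau> + of_nat d * of_int t) / of_nat nd"
        by simp
      then show ?thesis by (simp add: algebra_simps add_divide_distrib)
    qed
    have "csqrt (of_int s' * \<sigma> \<tau> + of_int t') = of_real (sqrt (real d / real nd)) * csqrt (of_int s * \<tau> + of_int t)"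
      unfolding e2 using pos by (intro csqrt_mult_of_real) simp
    then have e3: "csqrt (of_int s' * \<sigma> \<tau> + of_int t') powi (- wt2 r)
        = k * csqrt (of_int s * \<tau> + of_int t) powi (- wt2 r)"
      by (simp only: power_int_mult_distrib k_def)
    have k0: "k \<noteq> 0" using pos by (simp add: k_def)
    have "u (\<sigma> \<tau>) = (k * csqrt (of_int s * \<tau> + of_int t) powi (- wt2 r)) * f (act (p', q', s', t') (\<sigma> \<tau>))"
      unfolding u_def slash_def act.simps e3[symmetric] by simp
    then show ?thesis unfolding e1 using k0 by simp
  qed
  show ?thesis using qexp_cmult[OF qu, of "inverse k"] by (subst qexp_cong[OF main])
qed

lemma cusp_expansions_hecke:
  assumes "cusp_expansions strict r f"
  shows "cusp_expansions strict r hecke"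
  unfolding cusp_expansions_qexp
proof (intro allI impI)
  fix p q s t :: int
  assume det: "p * t - q * s = 1"
  have "qexp strict (\<lambda>\<tau>. \<Sum>A\<in>IDX. coef (fst A) (snd A) * (csqrt (of_int s * \<tau> + of_int t) powi (- wt2 r)
     * f ((of_nat (fst A) * act (p, q, s, t) \<tau> + of_nat (snd A)) / of_nat (l div fst A))))"
    by (intro qexp_sum finite_IDX qexp_cmult slash_rep[OF _ det assms]) simp
  moreover have "(\<Sum>A\<in>IDX. coef (fst A) (snd A) * (csqrt (of_int s * \<tau> + of_int t) powi (- wt2 r)
     * f ((of_nat (fst A) * act (p, q, s, t) \<tau> + of_nat (snd A)) / of_nat (l div fst A))))
     = slash r hecke p q s t 1 \<tau>" for \<tau>
    unfolding slash_def hecke_def act.simps by (simp add: sum_distrib_left case_prod_beta mult_ac)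
  ultimately show "qexp strict (slash r hecke p q s t 1)" by simp
qed

section \<open>Comparison of Fourier coefficients\<close>

definition hecke_coeff :: "real \<Rightarrow> complex" where
  "hecke_coeff n = (\<Sum>(a, b)\<in>IDX. coef a b * (cf r (real l * n / (real a)\<^sup>2) * ee (n * real b / real a)))"

lemma hecke_mean:
  assumes hol: "f holomorphic_on HH" and c: "\<And>\<tau>. \<tau> \<in> HH \<Longrightarrow> hecke \<tau> = c * f \<tau>"
    and n: "n = of_int (xN r) / 24 + of_int j"
  shows "hecke_coeff n = c * cf r n"
proof -
  \<comment> \<open>The frequencies are (x_N/24 + m) a/d - n, and l a/d is the square of a, so the
    length 24 l suits all summands at once.\<close>
  define L where "L = 24 * real l"
  have L0: "L > 0" using l_pos by (simp add: L_def)
  define E where "E t = exp (- 2 * pi * \<i> * of_real n * (of_real t + \<i>))" for t :: real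
  define F where "F a b t = f ((of_nat a * (of_real t + \<i>) + of_nat b) / of_nat (l div a))" for a b :: nat and t :: real
  have intF: "integral {0..L} (\<lambda>t. F a b t * E t)
      = of_real L * (cf r (real l * n / (real a)\<^sup>2) * ee (n * real b / real a))"
    and intgF: "(\<lambda>t. F a b t * E t) integrable_on {0..L}" if A: "(a, b) \<in> IDX" for a b
  proof -
    note A' = IDX_D[OF A]
    define d where "d = l div a"
    have lad: "real l = real a * real d" using A'(7) by (metis d_def of_nat_mult)
    have pos: "real a > 0" "real d > 0" using A' by (simp_all add: d_def)
    have ar: "(of_nat a * (of_real t + \<i>) + of_nat b) / of_nat (l div a)
       = of_real (real a / real d) * (of_real t + \<i>) + complex_of_real (real b / real d)" for t
      by (simp add: add_divide_distrib flip: d_def)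
    have Lint: "L * ((of_int (xN r) / 24 + real m) * (real a / real d) - n) \<in> \<int>" for m
    proof -
      have "L * ((of_int (xN r) / 24 + real m) * (real a / real d) - n)
         = of_int ((xN r + 24 * int m) * int a * int a - int l * (xN r + 24 * j))"
        unfolding L_def n using pos lad by (simp add: field_simps)
      then show ?thesis by (metis Ints_of_int)
    qed
    have "integral {0..L} (\<lambda>t. F a b t * E t)
      = of_real L * (cf r (n / (real a / real d)) * ee (n / (real a / real d) * (real b / real d)))"
      unfolding F_def E_def ar
      by (rule eta_quot_mean_cf[OF zero_notin _ L0 Lint]) (use pos in simp)
    moreover have "n / (real a / real d) = real l * n / (real a)\<^sup>2"
      using pos lad by (simp add: power2_eq_square)
    moreover have "n / (real a / real d) * (real b / real d) = n * real b / real a"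
      using pos by simp
    ultimately show "integral {0..L} (\<lambda>t. F a b t * E t)
      = of_real L * (cf r (real l * n / (real a)\<^sup>2) * ee (n * real b / real a))" by (simp only:)
    have "continuous_on {0..L} (\<lambda>t. F a b t)"
      unfolding F_def
    proof (rule continuous_on_compose2[OF holomorphic_on_imp_continuous_on[OF hol]])
      show "continuous_on {0..L} (\<lambda>t. (of_nat a * (complex_of_real t + \<i>) + of_nat b) / of_nat (l div a))"
        using A'(6) by (intro continuous_intros) auto
      show "(\<lambda>t. (of_nat a * (complex_of_real t + \<i>) + of_nat b) / of_nat (l div a)) ` {0..L} \<subseteq> HH"
      proof clarify
        fix t :: real
        show "(of_nat a * (complex_of_real t + \<i>) + of_nat b) / of_nat (l div a) \<in> HH"
          by (rule affine_in_HH[OF A'(5,6)]) (simp add: HH_def)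
      qed
    qed
    moreover have "continuous_on {0..L} E" unfolding E_def by (intro continuous_intros)
    ultimately show "(\<lambda>t. F a b t * E t) integrable_on {0..L}"
      by (intro integrable_continuous_interval continuous_on_mult)
  qed
  have f1: "integral {0..L} (\<lambda>t. f (of_real t + \<i>) * E t) = of_real L * cf r n"
  proof -
    have "L * ((of_int (xN r) / 24 + real m) * 1 - n) \<in> \<int>" for m
    proof -
      have "L * ((of_int (xN r) / 24 + real m) * 1 - n) = of_int (24 * int l * (int m - j))"
        unfolding L_def n by (simp add: algebra_simps)
      then show ?thesis by (metis Ints_of_int)
    qed
    from eta_quot_mean_cf[OF zero_notin _ L0 this, of 0] show ?thesis by (simp add: E_def)
  qed
  have "of_real L * hecke_coeff n
     = (\<Sum>(a, b)\<in>IDX. coef a b * integral {0..L} (\<lambda>t. F a b t * E t))"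
    unfolding hecke_coeff_def sum_distrib_left by (intro sum.cong refl) (auto simp: intF)
  also have "\<dots> = (\<Sum>A\<in>IDX. integral {0..L} (\<lambda>t. coef (fst A) (snd A) * (F (fst A) (snd A) t * E t)))"
    by (simp add: case_prod_beta)
  also have "\<dots> = integral {0..L} (\<lambda>t. \<Sum>A\<in>IDX. coef (fst A) (snd A) * (F (fst A) (snd A) t * E t))"
    by (rule integral_sum[symmetric]) (use finite_IDX intgF in \<open>auto intro!: integrable_on_mult_right\<close>)
  also have "(\<lambda>t. \<Sum>A\<in>IDX. coef (fst A) (snd A) * (F (fst A) (snd A) t * E t))
      = (\<lambda>t. c * (f (of_real t + \<i>) * E t))"
  proof
    fix t :: real
    have "(\<Sum>A\<in>IDX. coef (fst A) (snd A) * (F (fst A) (snd A) t * E t)) = hecke (of_real t + \<i>) * E t"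
      unfolding hecke_def F_def case_prod_beta sum_distrib_right by (simp only: mult.assoc)
    also have "hecke (of_real t + \<i>) = c * f (of_real t + \<i>)" by (rule c) (simp add: HH_def)
    finally show "(\<Sum>A\<in>IDX. coef (fst A) (snd A) * (F (fst A) (snd A) t * E t)) = c * (f (of_real t + \<i>) * E t)"
      by simp
  qed
  also have "integral {0..L} (\<lambda>t. c * (f (of_real t + \<i>) * E t)) = c * (of_real L * cf r n)"
    using f1 by (simp add: integral_mult_right)
  finally have "of_real L * hecke_coeff n
     = of_real L * (c * cf r n)" by simp
  then show ?thesis using L0 by simp
qed

text \<open>As l = a d, the normalization l^(-k/2) a^k equals l^(k/2) d^(-k), and e(b d n/l) = e(n
  b/a) separates from the part of the exponential contained in \<open>wgt\<close>.\<close>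

lemma hecke_lhs_eq:
  "hecke_lhs r l n = of_real (real l powr (wt r / 2))
     * hecke_coeff n"
proof -
  define T where "T a b = of_int (kronecker (int a) (varpi r)) * complex_of_real (real a powr wt r) *
         cf r (real l * n / (real a)\<^sup>2) * (of_int (kronecker (- int N * int b) (int (gcd a (l div a)))) powi wt2 r *
            ee (real b * real (l div a) * (n / real l - real_of_int (xN r) / 24)) * psi r l a b)" for a b
  have fin1: "finite {a. a dvd l \<and> coprime a N}"
    using l_pos by (auto intro: finite_subset[OF _ finite_divisors_nat[of l]])
  have "hecke_lhs r l n = complex_of_real (real l powr (- wt r / 2)) *
     (\<Sum>a\<in>{a. a dvd l \<and> coprime a N}. \<Sum>b\<in>{b. b < l div a \<and> gcd (gcd a b) (l div a) = 1}. T a b)"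
    unfolding hecke_lhs_def Let_def T_def sum_distrib_left ..
  also have "(\<Sum>a\<in>{a. a dvd l \<and> coprime a N}. \<Sum>b\<in>{b. b < l div a \<and> gcd (gcd a b) (l div a) = 1}. T a b)
      = (\<Sum>(a, b)\<in>IDX. T a b)"
    unfolding IDX_Sigma by (rule sum.Sigma[OF fin1]) auto
  also have "complex_of_real (real l powr (- wt r / 2)) * \<dots> = (\<Sum>(a, b)\<in>IDX. of_real (real l powr (wt r / 2))
      * (coef a b * (cf r (real l * n / (real a)\<^sup>2) * ee (n * real b / real a))))"
    unfolding sum_distrib_left
  proof (intro sum.cong refl, clarify)
    fix a b assume A: "(a, b) \<in> IDX"
    note A' = IDX_D[OF A]
    define d where "d = l div a"
    have lad: "real l = real a * real d" using A'(7) by (metis d_def of_nat_mult)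
    have pos: "real a > 0" "real d > 0" using A' by (simp_all add: d_def)
    have pw: "real l powr (- wt r / 2) * real a powr wt r = real l powr (wt r / 2) * real d powr (- wt r)"
    proof -
      have "real l powr (- wt r / 2) = real l powr (wt r / 2) * real l powr (- wt r)"
        using l_pos by (simp flip: powr_add)
      moreover have "real l powr (- wt r) * real a powr wt r = real d powr (- wt r)"
        using pos unfolding lad by (simp add: powr_mult powr_minus field_simps)
      ultimately show ?thesis by simp
    qed
    have e: "ee (real b * real (l div a) * (n / real l - real_of_int (xN r) / 24))
       = ee (- (real b * real (l div a) * of_int (xN r) / 24)) * ee (n * real b / real a)"
    proof -
      have "real b * real d * (n / real l - real_of_int (xN r) / 24)
        = - (real b * real d * of_int (xN r) / 24) + n * real b / real a"
        using pos lad by (simp add: field_simps)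
      then show ?thesis by (simp only: d_def[symmetric] ee_add)
    qed
    have pw': "complex_of_real (real l powr (- wt r / 2)) * complex_of_real (real a powr wt r)
       = complex_of_real (real l powr (wt r / 2)) * complex_of_real (real (l div a) powr (- wt r))"
      unfolding of_real_mult[symmetric] pw d_def ..
    have "complex_of_real (real l powr (- wt r / 2)) * T a b
      = (complex_of_real (real l powr (- wt r / 2)) * complex_of_real (real a powr wt r))
        * (of_int (kronecker (int a) (varpi r)) * (of_int (kronecker (- int N * int b) (int (gcd a (l div a)))) powi wt2 r
        * (ee (- (real b * real (l div a) * of_int (xN r) / 24)) * psi r l a b)))
        * (cf r (real l * n / (real a)\<^sup>2) * ee (n * real b / real a))"
      unfolding T_def e by (simp only: mult_ac)
    also have "\<dots> = of_real (real l powr (wt r / 2))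
      * (coef a b * (cf r (real l * n / (real a)\<^sup>2) * ee (n * real b / real a)))"
      unfolding pw' coef_def wgt_def by (simp only: mult_ac)
    finally show "complex_of_real (real l powr (- wt r / 2)) * T a b = of_real (real l powr (wt r / 2))
      * (coef a b * (cf r (real l * n / (real a)\<^sup>2) * ee (n * real b / real a)))" .
  qed
  finally show ?thesis unfolding hecke_coeff_def sum_distrib_left by (simp add: case_prod_beta)
qed

end

section \<open>One-dimensionality and the conclusion\<close>

lemma dim_eq_1_multiple:
  assumes "dim_eq_1 V" "V f" "V g" "\<tau>0 \<in> HH" "f \<tau>0 \<noteq> 0"
  obtains c where "\<And>\<tau>. \<tau> \<in> HH \<Longrightarrow> g \<tau> = c * f \<tau>"
proof -
  obtain u where u: "\<And>h. V h \<Longrightarrow> \<exists>c. \<forall>\<tau>\<in>HH. h \<tau> = c * u \<tau>"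
    using assms(1) unfolding dim_eq_1_def by blast
  obtain c1 where c1: "\<forall>\<tau>\<in>HH. f \<tau> = c1 * u \<tau>" using u[OF assms(2)] by blast
  obtain c2 where c2: "\<forall>\<tau>\<in>HH. g \<tau> = c2 * u \<tau>" using u[OF assms(3)] by blast
  have "c1 \<noteq> 0" using c1 assms(4,5) by auto
  then have "g \<tau> = (c2 / c1) * f \<tau>" if "\<tau> \<in> HH" for \<tau> using c1 c2 that by simp
  then show ?thesis using that by blast
qed

theorem theorem9p19:
  fixes r :: "nat \<Rightarrow> int" and l :: nat
  assumes "finite (supp r)"
    and "0 \<notin> supp r"
    and "weakly_admissible r"
    and "l \<in> Lf r"
  shows "(\<exists>!c. \<forall>n. (\<exists>m::int. n = real_of_int (xN r) / 24 + real_of_int m) \<longrightarrow>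
                 hecke_lhs r l n = c * cf r n)
       \<and> (\<forall>c. (\<forall>n. (\<exists>m::int. n = real_of_int (xN r) / 24 + real_of_int m) \<longrightarrow>
                 hecke_lhs r l n = c * cf r n)
              \<longrightarrow> c = hecke_lhs r l (real_of_int (xN r) / 24))"
proof -
  have M: "MF r (eta_quot r)" using assms(3) by (simp add: weakly_admissible_def)
  \<comment> \<open>Here l - 1 is a multiple of 24/G and z a multiple of G, where G is the gcd in
    the definition of \<open>mf\<close>.\<close>
  have div: "24 dvd (int l - 1) * z" if "gcd (yN r) (xN r) dvd z" for z
  proof -
    define G where "G = gcd 24 (gcd (yN r) (xN r))"
    have G: "G dvd 24" by (simp add: G_def)
    have "mf r = 24 div G" by (simp add: mf_def G_def yN_def)
    then have "24 div G dvd int l - 1" using assms(4) by (simp add: Lf_def cong_iff_dvd_diff)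
    then have "24 div G * G dvd (int l - 1) * z"
      using that by (intro mult_dvd_mono) (auto simp: G_def intro: dvd_trans)
    then show ?thesis using G by simp
  qed
  interpret eta_hecke_form r l
  proof
    show "24 dvd (int l - 1) * xN r" "24 dvd (int l - 1) * yN r" using div by auto
    show "l > 0" "odd (wt2 r) \<Longrightarrow> \<exists>s. l = s\<^sup>2" using assms(4) by (auto simp: Lf_def)
    show "transforms r (eta_quot r)" using M by (simp add: MF_def)
  qed (use assms in auto)
  have hol: "f holomorphic_on HH" using M by (simp add: MF_def)
  have i: "\<i> \<in> HH" by (simp add: HH_def)
  \<comment> \<open>In the second alternative of weak admissibility the one-dimensional space is
    that of cusp forms, so the strict form of the cusp expansions has to be preserved as
    well.\<close>
  obtain c where c: "\<And>\<tau>. \<tau> \<in> HH \<Longrightarrow> hecke \<tau> = c * f \<tau>"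
  proof (cases "dim_eq_1 (MF r)")
    case True
    have "MF r hecke"
      using M holomorphic_hecke transforms_hecke cusp_expansions_hecke by (simp add: MF_def)
    from dim_eq_1_multiple[OF True M this i f_nonzero[OF i]] that show ?thesis by blast
  next
    case False
    then have S: "dim_eq_1 (SF r)" "SF r f" using assms(3) by (auto simp: weakly_admissible_def)
    have "SF r hecke"
      using S(2) holomorphic_hecke transforms_hecke cusp_expansions_hecke by (simp add: SF_def)
    from dim_eq_1_multiple[OF S this i f_nonzero[OF i]] that show ?thesis by blast
  qed
  \<comment> \<open>The factor l^(k/2) is the gap between the normalization of the stated sum and
    that of \<open>hecke\<close>.\<close>
  define cl where "cl = of_real (real l powr (wt r / 2)) * c"
  have ex: "hecke_lhs r l n = cl * cf r n" if n: "\<exists>m::int. n = real_of_int (xN r) / 24 + real_of_int m" for n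
  proof -
    obtain j :: int where "n = real_of_int (xN r) / 24 + of_int j" using n by blast
    from hecke_mean[OF hol c this] show ?thesis unfolding hecke_lhs_eq cl_def by (simp add: mult.assoc)
  qed
  have un: "c' = hecke_lhs r l (real_of_int (xN r) / 24)"
    if "\<forall>n. (\<exists>m::int. n = real_of_int (xN r) / 24 + real_of_int m) \<longrightarrow> hecke_lhs r l n = c' * cf r n" for c'
  proof -
    have "\<exists>m::int. real_of_int (xN r) / 24 = real_of_int (xN r) / 24 + real_of_int m"
      by (rule exI[of _ 0]) simp
    then have "hecke_lhs r l (real_of_int (xN r) / 24) = c' * cf r (real_of_int (xN r) / 24)" using that by blast
    then show ?thesis using cf_xN[OF assms(2)] by simp
  qed
  show ?thesis
  proof (intro conjI allI impI un ex1I)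
    fix n assume "\<exists>m::int. n = real_of_int (xN r) / 24 + real_of_int m"
    then show "hecke_lhs r l n = cl * cf r n" by (rule ex)
  next
    fix c' assume "\<forall>n. (\<exists>m::int. n = real_of_int (xN r) / 24 + real_of_int m) \<longrightarrow> hecke_lhs r l n = c' * cf r n"
    then have "c' = hecke_lhs r l (real_of_int (xN r) / 24)" by (rule un)
    moreover have "cl = hecke_lhs r l (real_of_int (xN r) / 24)" using ex by (intro un) blast
    ultimately show "c' = cl" by simp
  qed blast
qed

end
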